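(* Let $a_2(t)$ denote the $a_2$ term of the heat kernel expansion of $D^2$ for the Robertson-Walker metric with scale factor $a(t)$, computed without performing the time integration. Then $$a_2(t)=C\cdot\int_{A_4}\Omega^\alpha_{(\alpha_1,\alpha_2)}\Big|_{\alpha=a(t),\,\alpha_1=a'(t),\,\alpha_2=a''(t)},$$ where $C\in\mathbb Q[(2\pi i)^{-1}]$, $\Omega^\alpha_{(\alpha_1,\alpha_2)}$ is the form $b_{-4}\,d\eta\wedge\sigma_{\xi,3}$ expressed in the coordinates $u_0=\sin^2\eta$, $u_1=\xi_1$, $u_2=\xi_2$, $u_3=\csc(\eta)\xi_3$, $u_4=\sec(\eta)\xi_4$ and the variables $\alpha,\alpha_1,\alpha_2$ in place of $a(t),a'(t),a''(t)$ (an algebraic differential form on $\mathbb A^5\smallsetminus(\widehat{CZ}_\alpha\cup H_0\cup H_1)$), and the domain of integration is the $\mathbb Q$-semialgebraic set $$A_4=\{(u_0,\dots,u_4)\in\mathbb A^5(\mathbb R): u_1^2+u_2^2+u_0u_3^2+(1-u_0)u_4^2=1,\ 0<u_i<1\text{ for }i=0,1,2\}.$$ For rational $\alpha\neq0$, $\alpha_1,\alpha_2$, this integral is a period of the mixed motive $$\mathfrak m\big(\mathbb A^5\smallsetminus(\widehat{CZ}_\alpha\cup H_0\cup H_1),\Sigma\big),$$ where $\widehat{CZ}_\alpha\subset\mathbb A^5$ is the hypersurface defined by the vanishing of $Q_{\alpha,2}=u_1^2+\alpha^{-2}(u_2^2+u_3^2+u_4^2)$, $H_0=\{u_0=0\}$,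 $H_1=\{u_0=1\}$, and $\Sigma=\bigcup_{i,c}H_{i,c}$ is the divisor given by the union of the hyperplanes $H_{i,c}=\{u_i=c\}$ with $i\in\{0,1,2\}$, $c\in\{0,1\}$.
   Context: Setting. Let $a(t)>0$ be a smooth function and consider the (Euclidean) Robertson-Walker metric $ds^2=dt^2+a(t)^2d\sigma^2$, with $d\sigma^2$ the round metric on $\mathbb S^3$, in Hopf coordinates $x=(x_1,x_2,x_3,x_4)=(t,\eta,\phi_1,\phi_2)$, $0<\eta<\pi/2$, $0<\phi_1,\phi_2<2\pi$: $ds^2=dt^2+a(t)^2(d\eta^2+\sin^2\eta\,d\phi_1^2+\cos^2\eta\,d\phi_2^2)$. In a local trivialization of the spinor bundle the Dirac operator $D$ has symbol $q_1+q_0$, with $q_1=\begin{pmatrix}0&A_1\\ B_1&0\end{pmatrix}$, $q_0=\begin{pmatrix}0&A_0\\ B_0&0\end{pmatrix}$ in $2\times2$ blocks, where (with $a=a(t)$) $$A_1=\begin{pmatrix}\frac{i\sec\eta\,\xi_4}{a}-\xi_1&\frac{i\xi_2+\csc\eta\,\xi_3}{a}\\ \frac{i\xi_2-\csc\eta\,\xi_3}{a}&-\xi_1-\frac{i\sec\eta\,\xi_4}{a}\end{pmatrix},\quad B_1=\begin{pmatrix}-\xi_1-\frac{i\sec\eta\,\xi_4}{a}&\frac{-i\xi_2-\csc\eta\,\xi_3}{a}\\ \frac{\csc\eta\,\xi_3-i\xi_2}{a}&\frac{i\sec\eta\,\xi_4}{a}-\xi_1\end{pmatrix},$$ $$A_0=\begin{pmatrix}\frac{3ia'}{2a}&\frac{\cot\eta-\tan\eta}{2a}\\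 \frac{\cot\eta-\tan\eta}{2a}&\frac{3ia'}{2a}\end{pmatrix},\quad B_0=\begin{pmatrix}\frac{3ia'}{2a}&\frac{\tan\eta-\cot\eta}{2a}\\ \frac{\tan\eta-\cot\eta}{2a}&\frac{3ia'}{2a}\end{pmatrix}.$$ The symbol of $D^2$ is $p_2+p_1+p_0$ with $p_2=q_1^2=\big(\xi_1^2+\frac{\xi_2^2+\csc^2\eta\,\xi_3^2+\sec^2\eta\,\xi_4^2}{a^2}\big)I_4$, $p_1=q_0q_1+q_1q_0-i\sum_j\partial_{\xi_j}q_1\,\partial_{x_j}q_1$, $p_0=q_0^2-i\sum_j\partial_{\xi_j}q_1\,\partial_{x_j}q_0$. Parametrix. The homogeneous terms of the symbol of the parametrix $(D^2)^{-1}$ are $\sigma_{-2}=p_2^{-1}$ and, for $N>0$, $\sigma_{-2-N}=-\big(\sum\frac{(-i)^{|\beta|}}{\beta!}(\partial_\xi^\beta\sigma_{-2-j})(\partial_x^\beta p_k)\big)\sigma_{-2}$, the sum being over $0\le j<N$, $0\le k\le2$, $\beta\in\mathbb Z_{\ge0}^4$ with $-2-j-|\beta|+k=-N$. The function $b_{-4}(t,\eta,\xi)$ is the part of $\mathrm{tr}(\sigma_{-4}(x,\xi))$ that is even in each $\xi_j$, $j=1,\dots,4$ (all terms with an odd power of some $\xi_j$ in the numerator are deleted). Put $\sigma_{\xi,3}=\sum_{j=1}^4(-1)^{j-1}\xi_j\,d\xi_1\wedge\cdots\wedge\widehat{d\xi_j}\wedge\cdots\wedge d\xi_4$. The term $a_2$.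 In the expansion $\mathrm{Tr}(e^{-sD^2})\sim_{s\to0^+}a_0s^{-2}+a_2s^{-1}+a_4+\cdots$, one has $a_2=\frac1{2^5\pi^4}\mathrm{Res}((D^2)^{-1})$ (Wodzicki residue). "Without performing the time integration" means the function $$a_2(t)=\frac1{2^5\pi^4}\int_0^{\pi/2}d\eta\int_0^{2\pi}d\phi_1\int_0^{2\pi}d\phi_2\int_{|\xi|=1}\mathrm{tr}(\sigma_{-4})\,\sigma_{\xi,3},$$ where $|\xi|=1$ is the unit sphere $\xi_1^2+\cdots+\xi_4^2=1$; odd terms integrate to zero so $\mathrm{tr}(\sigma_{-4})$ may be replaced by $b_{-4}$. Integrals over $A_4$ are taken in the same order (first over the slices with $u_0$ fixed, then over $u_0$), with $A_4$ oriented as the image of the corresponding part of $(0,\pi/2)\times\mathbb S^3$. Periods. A $\mathbb Q$-semialgebraic set is a subset of some $\mathbb R^n$ obtained from sets $\{P\ge0\}$, $P\in\mathbb Q[x_1,\dots,x_n]$, by finitely many complements, intersections and unions. For a variety $X$ over $\mathbb Q$ and a divisor $\Sigma$, $\mathfrak m(X,\Sigma)$ is the relative mixed motive, and a period of $\mathfrak m(X,\Sigma)$ here means a convergent integral of an algebraic differential form on $X$ defined over $\mathbb Q$ over a $\mathbb Q$-semialgebraic set whose boundary is contained in $\Sigma$. *)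

theory Defs
  imports "HOL-Analysis.Analysis" "HOL-Computational_Algebra.Polynomial"
begin

section \<open>Differential forms and their integrals\<close>

text \<open>A differential form of degree d on real^'n is given by its values on lists of d tangent
  vectors; values on lists of other lengths are irrelevant.\<close>

definition dwedge :: "'n list \<Rightarrow> (real^'n) list \<Rightarrow> real" where
  "dwedge is vs = (\<Sum>p | p permutes {..<length is}.
     of_int (sign p) * (\<Prod>k<length is. (vs ! k) $ (is ! p k)))"
  \<comment> \<open>\<open>(du\<^sub>i\<^sub>1 \<and> \<dots> \<and> du\<^sub>i\<^sub>d) (v\<^sub>1, \<dots>, v\<^sub>d) = det (du\<^sub>i\<^sub>j (v\<^sub>k))\<close>\<close>

definition is_form_on :: "(real^'n) set \<Rightarrow> nat \<Rightarrow> (real^'n \<Rightarrow> (real^'n) list \<Rightarrow> real) \<Rightarrow> bool" where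
  "is_form_on S d \<omega> \<longleftrightarrow> (\<exists>c. \<forall>u\<in>S. \<forall>vs. length vs = d \<longrightarrow>
     \<omega> u vs = (\<Sum>is | length is = d. c is u * dwedge is vs))"

definition pullback ::
  "('a::real_normed_vector \<Rightarrow> 'b::real_normed_vector) \<Rightarrow> ('b \<Rightarrow> 'b list \<Rightarrow> 'c) \<Rightarrow> 'a \<Rightarrow> 'a list \<Rightarrow> 'c" where
  "pullback f \<omega> p vs = \<omega> (f p) (map (frechet_derivative f (at p)) vs)"

text \<open>Injective immersions of class \<open>C\<^sup>1\<close>. The parameter space has a distinguished first coordinate.\<close>

definition param_chart ::
  "(real \<times> 'p::euclidean_space \<Rightarrow> real^'n) \<Rightarrow> (real \<times> 'p) set \<Rightarrow> bool" where
  "param_chart \<phi> U \<longleftrightarrow> open U \<and> inj_on \<phi> U \<and>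
     (\<forall>p\<in>U. \<phi> differentiable (at p) \<and> inj (frechet_derivative \<phi> (at p))) \<and>
     (\<forall>v. continuous_on U (\<lambda>p. frechet_derivative \<phi> (at p) v))"

definition param_frame :: "'p::euclidean_space list \<Rightarrow> (real \<times> 'p) list" where
  "param_frame bs = (1, 0) # map (\<lambda>b. (0, b)) bs"

text \<open>An orientation of a \<open>d\<close>-dimensional set is given by a \<open>d\<close>-form that is nonzero on its
  tangent spaces. The ordered basis \<open>bs\<close> fixes the orientation of the parameter space.\<close>

definition positive_chart ::
  "(real^'n \<Rightarrow> (real^'n) list \<Rightarrow> real) \<Rightarrow> (real \<times> 'p::euclidean_space \<Rightarrow> real^'n) \<Rightarrow>
   (real \<times> 'p) set \<Rightarrow> 'p list \<Rightarrow> bool" where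
  "positive_chart ori \<phi> U bs \<longleftrightarrow> distinct bs \<and> set bs = Basis \<and> param_chart \<phi> U \<and>
     (\<forall>p\<in>U. pullback \<phi> ori p (param_frame bs) > 0)"

text \<open>The integral of a \<open>(DIM('p) + 1)\<close>-form over the oriented set \<open>S\<close>, taken first over the slices
  of \<open>S\<close> on which the coordinate \<open>u\<^sub>k\<close> is fixed and then over \<open>u\<^sub>k\<close>; both integrals
  have to converge absolutely, but the form need not be absolutely integrable over \<open>S\<close>. The
  integral is computed in a positively oriented parametrization that is compatible with the slicing
  and covers \<open>S\<close> up to a set of measure zero.\<close>

definition has_form_integral ::
  "'p::euclidean_space itself \<Rightarrow> 'n \<Rightarrow> (real^'n \<Rightarrow> (real^'n) list \<Rightarrow> real) \<Rightarrow> (real^'n) set \<Rightarrow>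
   (real^'n \<Rightarrow> (real^'n) list \<Rightarrow> complex) \<Rightarrow> complex \<Rightarrow> bool" where
  "has_form_integral _ k ori S \<omega> z \<longleftrightarrow>
     (\<exists>(\<phi> :: real \<times> 'p \<Rightarrow> real^'n) U bs.
        positive_chart ori \<phi> U bs \<and> \<phi> ` U \<subseteq> S \<and>
        (\<exists>(N :: (real \<times> 'p) set) \<psi>. negligible N \<and> \<psi> differentiable_on N \<and> S - \<phi> ` U \<subseteq> \<psi> ` N) \<and>
        (\<forall>s \<theta>. (s, \<theta>) \<in> U \<longrightarrow> \<phi> (s, \<theta>) $ k = s) \<and>
        (let f = (\<lambda>s \<theta>. indicator U (s, \<theta>) *\<^sub>R pullback \<phi> \<omega> (s, \<theta>) (param_frame bs))
         in (AE s in lborel. integrable lborel (f s)) \<and>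
            integrable lborel (\<lambda>s. integral\<^sup>L lborel (f s)) \<and>
            z = (LINT s|lborel. integral\<^sup>L lborel (f s))))"

text \<open>The boundary of \<open>S\<close>: all points of the closure except those near which \<open>S\<close> is an embedded
  manifold of dimension \<open>DIM('p) + 1\<close>, oriented by \<open>ori\<close>.\<close>

definition oriented_boundary ::
  "'p::euclidean_space itself \<Rightarrow> (real^'n \<Rightarrow> (real^'n) list \<Rightarrow> real) \<Rightarrow> (real^'n) set \<Rightarrow> (real^'n) set" where
  "oriented_boundary _ ori S = closure S -
     {u \<in> S. \<exists>W (\<psi> :: real \<times> 'p \<Rightarrow> real^'n) V bs g. open W \<and> u \<in> W \<and>
        positive_chart ori \<psi> V bs \<and> homeomorphism V (S \<inter> W) \<psi> g}"


section \<open>Algebraic forms, semialgebraic sets and periods\<close>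

text \<open>Polynomials in the coordinates of affine space with coefficients in a subfield \<open>K\<close> of the
  reals, as functions on the real points. Varieties over \<open>K\<close> are given by their equations.\<close>

definition real_subfield :: "real set \<Rightarrow> bool" where
  "real_subfield K \<longleftrightarrow> 1 \<in> K \<and> (\<forall>x\<in>K. \<forall>y\<in>K. x - y \<in> K \<and> x * y \<in> K \<and> x / y \<in> K)"

inductive polynomial_over :: "real set \<Rightarrow> (real^'n \<Rightarrow> real) \<Rightarrow> bool" for K where
  const: "c \<in> K \<Longrightarrow> polynomial_over K (\<lambda>u. c)"
| coord: "polynomial_over K (\<lambda>u. u $ i)"
| add: "polynomial_over K P \<Longrightarrow> polynomial_over K Q \<Longrightarrow> polynomial_over K (\<lambda>u. P u + Q u)"
| mult: "polynomial_over K P \<Longrightarrow> polynomial_over K Q \<Longrightarrow> polynomial_over K (\<lambda>u. P u * Q u)"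

inductive Q_semialgebraic :: "(real^'n) set \<Rightarrow> bool" where
  nonneg: "polynomial_over \<rat> P \<Longrightarrow> Q_semialgebraic {u. P u \<ge> 0}"
| compl: "Q_semialgebraic S \<Longrightarrow> Q_semialgebraic (- S)"
| inter: "Q_semialgebraic S \<Longrightarrow> Q_semialgebraic T \<Longrightarrow> Q_semialgebraic (S \<inter> T)"
| union: "Q_semialgebraic S \<Longrightarrow> Q_semialgebraic T \<Longrightarrow> Q_semialgebraic (S \<union> T)"

definition zeros_of :: "(real^'n \<Rightarrow> real) set \<Rightarrow> (real^'n) set" where
  "zeros_of G = {u. \<exists>g\<in>G. g u = 0}"

text \<open>The regular functions over \<open>K\<close> on the complement of the union of the hypersurfaces
  \<open>g = 0\<close>, \<open>g \<in> G\<close> (a finite set), are the elements of \<open>K[u][1 / \<Prod>g]\<close>; they and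
  the forms with such coefficients are determined by their values at real points.\<close>

definition regular_function :: "real set \<Rightarrow> (real^'n \<Rightarrow> real) set \<Rightarrow> (real^'n \<Rightarrow> real) \<Rightarrow> bool" where
  "regular_function K G f \<longleftrightarrow>
     (\<exists>P m. polynomial_over K P \<and> (\<forall>u \<in> - zeros_of G. f u = P u / (\<Prod>g\<in>G. g u) ^ m))"

definition algebraic_form ::
  "real set \<Rightarrow> (real^'n \<Rightarrow> real) set \<Rightarrow> nat \<Rightarrow> (real^'n \<Rightarrow> (real^'n) list \<Rightarrow> complex) \<Rightarrow> bool" where
  "algebraic_form K G d \<omega> \<longleftrightarrow>
     (\<exists>c. (\<forall>is. regular_function K G (c is)) \<and>
          (\<forall>u \<in> - zeros_of G. \<forall>vs. length vs = d \<longrightarrow>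
             \<omega> u vs = of_real (\<Sum>is | length is = d. c is u * dwedge is vs)))"

text \<open>Periods of the relative motive of \<open>(X, \<Sigma>)\<close>, where \<open>X\<close> is the complement of the hypersurfaces
  \<open>g = 0\<close>, \<open>g \<in> G\<close>, in affine space and \<open>\<Sigma>\<close> is the union of the hypersurfaces \<open>h = 0\<close>, \<open>h \<in> H\<close>.
  The degree of the form is \<open>DIM('p) + 1\<close>.\<close>

definition is_period_integral ::
  "'p::euclidean_space itself \<Rightarrow> (real^'n \<Rightarrow> real) set \<Rightarrow> (real^'n \<Rightarrow> real) set \<Rightarrow>
   (real^'n \<Rightarrow> (real^'n) list \<Rightarrow> complex) \<Rightarrow> 'n \<Rightarrow> (real^'n \<Rightarrow> (real^'n) list \<Rightarrow> real) \<Rightarrow>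
   (real^'n) set \<Rightarrow> complex \<Rightarrow> bool" where
  "is_period_integral p G H \<omega> k ori S z \<longleftrightarrow>
     finite G \<and> finite H \<and> (\<forall>g \<in> G \<union> H. polynomial_over \<rat> g) \<and>
     algebraic_form \<rat> G (DIM('p) + 1) \<omega> \<and>
     Q_semialgebraic S \<and> S \<subseteq> - zeros_of G \<and>
     is_form_on S (DIM('p) + 1) ori \<and>
     oriented_boundary p ori S \<subseteq> zeros_of H \<and>
     has_form_integral p k ori S \<omega> z"

definition is_period_of_motive ::
  "'p::euclidean_space itself \<Rightarrow> (real^'n \<Rightarrow> real) set \<Rightarrow> (real^'n \<Rightarrow> real) set \<Rightarrow> complex \<Rightarrow> bool" where
  "is_period_of_motive p G H z \<longleftrightarrow> (\<exists>\<omega> k ori S. is_period_integral p G H \<omega> k ori S z)"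


section \<open>The symbol of the squared Dirac operator and its parametrix\<close>

text \<open>Points are \<open>x = (t, \<eta>, \<phi>\<^sub>1, \<phi>\<^sub>2)\<close>; in the type \<open>4\<close>, the index \<open>4\<close> is \<open>0\<close>.\<close>

type_synonym symb = "real^4 \<Rightarrow> real^4 \<Rightarrow> complex^4^4"

definition smooth_at_all :: "real set \<Rightarrow> (real \<Rightarrow> real) \<Rightarrow> bool" where
  "smooth_at_all T a \<longleftrightarrow> (\<forall>n. \<forall>s\<in>T. (deriv ^^ n) a differentiable (at s))"

definition off_diagonal :: "complex^2^2 \<Rightarrow> complex^2^2 \<Rightarrow> complex^4^4" where
  "off_diagonal A B = vector
     [vector [0, 0, A$1$1, A$1$2],
      vector [0, 0, A$2$1, A$2$2],
      vector [B$1$1, B$1$2, 0, 0],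
      vector [B$2$1, B$2$2, 0, 0]]"

definition A1 :: "(real \<Rightarrow> real) \<Rightarrow> real^4 \<Rightarrow> real^4 \<Rightarrow> complex^2^2" where
  "A1 a x \<xi> = (let \<alpha> = of_real (a (x$1));
       \<xi>1 = of_real (\<xi>$1); \<xi>2 = of_real (\<xi>$2);
       c3 = of_real (\<xi>$3 / sin (x$2)); s4 = of_real (\<xi>$4 / cos (x$2))
     in vector [vector [\<i> * s4 / \<alpha> - \<xi>1, (\<i> * \<xi>2 + c3) / \<alpha>],
                vector [(\<i> * \<xi>2 - c3) / \<alpha>, - \<xi>1 - \<i> * s4 / \<alpha>]])"

definition B1 :: "(real \<Rightarrow> real) \<Rightarrow> real^4 \<Rightarrow> real^4 \<Rightarrow> complex^2^2" where
  "B1 a x \<xi> = (let \<alpha> = of_real (a (x$1));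
       \<xi>1 = of_real (\<xi>$1); \<xi>2 = of_real (\<xi>$2);
       c3 = of_real (\<xi>$3 / sin (x$2)); s4 = of_real (\<xi>$4 / cos (x$2))
     in vector [vector [- \<xi>1 - \<i> * s4 / \<alpha>, (- \<i> * \<xi>2 - c3) / \<alpha>],
                vector [(c3 - \<i> * \<xi>2) / \<alpha>, \<i> * s4 / \<alpha> - \<xi>1]])"

definition A0 :: "(real \<Rightarrow> real) \<Rightarrow> real^4 \<Rightarrow> complex^2^2" where
  "A0 a x = (let d = 3 * \<i> * of_real (deriv a (x$1)) / (2 * of_real (a (x$1)));
       e = of_real ((cot (x$2) - tan (x$2)) / (2 * a (x$1)))
     in vector [vector [d, e], vector [e, d]])"

definition B0 :: "(real \<Rightarrow> real) \<Rightarrow> real^4 \<Rightarrow> complex^2^2" where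
  "B0 a x = (let d = 3 * \<i> * of_real (deriv a (x$1)) / (2 * of_real (a (x$1)));
       e = of_real ((tan (x$2) - cot (x$2)) / (2 * a (x$1)))
     in vector [vector [d, e], vector [e, d]])"

definition q1 :: "(real \<Rightarrow> real) \<Rightarrow> symb" where
  "q1 a x \<xi> = off_diagonal (A1 a x \<xi>) (B1 a x \<xi>)"

definition q0 :: "(real \<Rightarrow> real) \<Rightarrow> symb" where
  "q0 a x \<xi> = off_diagonal (A0 a x) (B0 a x)"

definition partial_x :: "4 \<Rightarrow> symb \<Rightarrow> symb" where
  "partial_x j s x \<xi> = vector_derivative (\<lambda>h. s (x + h *\<^sub>R axis j 1) \<xi>) (at 0)"

definition partial_xi :: "4 \<Rightarrow> symb \<Rightarrow> symb" where
  "partial_xi j s x \<xi> = vector_derivative (\<lambda>h. s x (\<xi> + h *\<^sub>R axis j 1)) (at 0)"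

definition multi_partial :: "(4 \<Rightarrow> symb \<Rightarrow> symb) \<Rightarrow> nat^4 \<Rightarrow> symb \<Rightarrow> symb" where
  "multi_partial D \<beta> = (D 1 ^^ (\<beta>$1)) \<circ> (D 2 ^^ (\<beta>$2)) \<circ> (D 3 ^^ (\<beta>$3)) \<circ> (D 4 ^^ (\<beta>$4))"

definition cscale :: "complex \<Rightarrow> complex^4^4 \<Rightarrow> complex^4^4" where
  "cscale c M = (\<chi> i j. c * M$i$j)"

text \<open>\<open>p_symbol a k\<close> is the part \<open>p\<^sub>k\<close> of the symbol of the squared Dirac operator that is homogeneous
  of degree \<open>k\<close>.\<close>

definition p_symbol :: "(real \<Rightarrow> real) \<Rightarrow> nat \<Rightarrow> symb" where
  "p_symbol a k x \<xi> =
     (if k = 2 then q1 a x \<xi> ** q1 a x \<xi>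
      else if k = 1 then q0 a x \<xi> ** q1 a x \<xi> + q1 a x \<xi> ** q0 a x \<xi>
        - cscale \<i> (\<Sum>j\<in>UNIV. partial_xi j (q1 a) x \<xi> ** partial_x j (q1 a) x \<xi>)
      else if k = 0 then q0 a x \<xi> ** q0 a x \<xi>
        - cscale \<i> (\<Sum>j\<in>UNIV. partial_xi j (q1 a) x \<xi> ** partial_x j (q0 a) x \<xi>)
      else 0)"

lemma vector_4 [simp]:
  "(vector [x, y, z, w] :: 'a::zero^4) $ 1 = x" "(vector [x, y, z, w] :: 'a^4) $ 2 = y"
  "(vector [x, y, z, w] :: 'a^4) $ 3 = z" "(vector [x, y, z, w] :: 'a^4) $ 4 = w"
  "(vector [x, y, z, w] :: 'a^4) $ 0 = w"
  unfolding vector_def by simp_all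

lemma p_symbol_2:
  "p_symbol a 2 x \<xi> = mat (of_real ((\<xi>$1)\<^sup>2 +
     ((\<xi>$2)\<^sup>2 + (\<xi>$3 / sin (x$2))\<^sup>2 + (\<xi>$4 / cos (x$2))\<^sup>2) / (a (x$1))\<^sup>2))"
proof -
  define r where "r = inverse (complex_of_real (a (x$1)))"
  define c where "c = complex_of_real (\<xi>$3 / sin (x$2))"
  define s where "s = complex_of_real (\<xi>$4 / cos (x$2))"
  define y where "y = complex_of_real (\<xi>$1)"
  define z where "z = complex_of_real (\<xi>$2)"
  have i: "\<i> * (\<i> * w) = - w" for w by (simp flip: mult.assoc)
  have m: "of_real ((\<xi>$1)\<^sup>2 + ((\<xi>$2)\<^sup>2 + (\<xi>$3 / sin (x$2))\<^sup>2 + (\<xi>$4 / cos (x$2))\<^sup>2) / (a (x$1))\<^sup>2)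
     = y * y + (z * z + c * c + s * s) * (r * r)"
    by (simp add: r_def c_def s_def y_def z_def power2_eq_square divide_inverse)
  have d: "w / complex_of_real (a (x$1)) = w * r" for w
    by (simp add: r_def divide_inverse)
  show ?thesis
    unfolding m p_symbol_def q1_def off_diagonal_def A1_def B1_def Let_def d
      c_def [symmetric] s_def [symmetric] y_def [symmetric] z_def [symmetric]
    by (simp add: vec_eq_iff forall_4 matrix_matrix_mult_def sum_4 mat_def)
       (simp add: algebra_simps i)
qed

text \<open>\<open>sigma a N\<close> is \<open>\<sigma>\<^bsub>-2-N\<^esub>\<close>.\<close>

function sigma :: "(real \<Rightarrow> real) \<Rightarrow> nat \<Rightarrow> symb" where
  "sigma a N = (if N = 0 then (\<lambda>x \<xi>. matrix_inv (p_symbol a 2 x \<xi>))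
     else (\<lambda>x \<xi>. - (\<Sum>j<N. \<Sum>k\<le>2. \<Sum>\<beta> | 2 + j + (\<Sum>i\<in>UNIV. \<beta>$i) = N + k.
         cscale ((- \<i>) ^ (\<Sum>i\<in>UNIV. \<beta>$i) / of_nat (\<Prod>i\<in>UNIV. fact (\<beta>$i)))
           (multi_partial partial_xi \<beta> (sigma a j) x \<xi> **
            multi_partial partial_x \<beta> (p_symbol a k) x \<xi>))
       ** matrix_inv (p_symbol a 2 x \<xi>)))"
  by pat_completeness auto
termination by (relation "Wellfounded.measure snd") auto

declare sigma.simps [simp del]

text \<open>The projection of \<open>tr \<sigma>\<^bsub>-4\<^esub>\<close> to its part even in each \<open>\<xi>\<^sub>j\<close>. The symbol does not depend on
  \<open>\<phi>\<^sub>1, \<phi>\<^sub>2\<close>, which are set to \<open>0\<close>.\<close>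

definition b4 :: "(real \<Rightarrow> real) \<Rightarrow> real \<Rightarrow> real \<Rightarrow> real^4 \<Rightarrow> complex" where
  "b4 a t \<eta> \<xi> = (\<Sum>J\<in>(UNIV :: 4 set set).
     trace (sigma a 2 (vector [t, \<eta>, 0, 0]) (\<chi> j. if j \<in> J then - \<xi>$j else \<xi>$j))) / 16"


section \<open>The heat kernel coefficient and the period form\<close>

definition sigma_xi3 :: "real^4 \<Rightarrow> (real^4) list \<Rightarrow> real" where
  "sigma_xi3 \<xi> vs = \<xi>$1 * dwedge [2, 3, 4] vs - \<xi>$2 * dwedge [1, 3, 4] vs
     + \<xi>$3 * dwedge [1, 2, 4] vs - \<xi>$4 * dwedge [1, 2, 3] vs"

text \<open>Hyperspherical coordinates; they are injective on the domain of integration below, cover the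
  unit sphere up to measure zero and pull \<open>\<sigma>\<^bsub>\<xi>,3\<^esub>\<close> back to the positive density
  \<open>sin\<^sup>2 \<theta>\<^sub>1 sin \<theta>\<^sub>2\<close>.\<close>

definition sphere_param :: "real \<times> real \<times> real \<Rightarrow> real^4" where
  "sphere_param = (\<lambda>(\<theta>1, \<theta>2, \<theta>3). vector
     [cos \<theta>1, sin \<theta>1 * cos \<theta>2, sin \<theta>1 * sin \<theta>2 * cos \<theta>3, sin \<theta>1 * sin \<theta>2 * sin \<theta>3])"

definition sphere_integral :: "(real^4 \<Rightarrow> (real^4) list \<Rightarrow> complex) \<Rightarrow> complex" where
  "sphere_integral \<omega> = (LINT \<theta> : {0<..<pi} \<times> {0<..<pi} \<times> {0<..<2*pi} | lborel.
     pullback sphere_param \<omega> \<theta> [(1, 0, 0), (0, 1, 0), (0, 0, 1)])"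

definition a2_term :: "(real \<Rightarrow> real) \<Rightarrow> real \<Rightarrow> complex" where
  "a2_term a t = 1 / (2 ^ 5 * of_real pi ^ 4) *
     (LINT \<eta> : {0<..<pi/2} | lborel. LINT \<phi>1 : {0<..<2*pi} | lborel. LINT \<phi>2 : {0<..<2*pi} | lborel.
        sphere_integral (\<lambda>\<xi> vs.
          trace (sigma a 2 (vector [t, \<eta>, \<phi>1, \<phi>2]) \<xi>) * of_real (sigma_xi3 \<xi> vs)))"

text \<open>The vectors \<open>(\<eta>, \<xi>\<^sub>1, \<dots>, \<xi>\<^sub>4)\<close> and \<open>(u\<^sub>0, \<dots>, u\<^sub>4)\<close> are indexed by the
  elements \<open>0, \<dots>, 4\<close> of the type \<open>5\<close>. The map \<open>of_u\<close> is inverse to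
  the coordinate change \<open>to_u\<close>.\<close>

definition to_u :: "real^5 \<Rightarrow> real^5" where
  "to_u y = (\<chi> i. if i = 0 then (sin (y$0))\<^sup>2
     else if i = 3 then y$3 / sin (y$0)
     else if i = 4 then y$4 / cos (y$0)
     else y$i)"

definition of_u :: "real^5 \<Rightarrow> real^5" where
  "of_u u = (\<chi> i. if i = 0 then arcsin (sqrt (u$0))
     else if i = 3 then sqrt (u$0) * u$3
     else if i = 4 then sqrt (1 - u$0) * u$4
     else u$i)"

lemma to_u_of_u:
  assumes "0 < u$0" "u$0 < 1"
  shows "to_u (of_u u) = u"
proof -
  have s: "sqrt (u$0) > 0" "sqrt (u$0) < 1" using assms by auto
  have "sin (arcsin (sqrt (u$0))) = sqrt (u$0)"
    by (rule sin_arcsin) (use s in linarith)+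
  moreover have "cos (arcsin (sqrt (u$0))) = sqrt (1 - u$0)"
    using assms by (subst cos_arcsin) (use s in \<open>linarith | simp\<close>)+
  ultimately show ?thesis using assms by (simp add: to_u_def of_u_def vec_eq_iff)
qed

lemma of_u_to_u:
  assumes "0 < y$0" "y$0 < pi/2"
  shows "of_u (to_u y) = y"
proof -
  have "sin (y$0) > 0" "cos (y$0) > 0"
    using assms by (auto simp: sin_gt_zero cos_gt_zero)
  moreover have "sqrt (1 - (sin (y$0))\<^sup>2) = cos (y$0)"
    using \<open>cos (y$0) > 0\<close> by (simp add: cos_squared_eq [symmetric])
  ultimately show ?thesis
    using assms by (auto simp: to_u_def of_u_def vec_eq_iff arcsin_sin)
qed

definition xi_part :: "real^5 \<Rightarrow> real^4" where
  "xi_part y = vector [y$1, y$2, y$3, y$4]"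

text \<open>\<open>d\<eta> \<and> \<sigma>\<^bsub>\<xi>,3\<^esub>\<close> in the coordinates \<open>(\<eta>, \<xi>)\<close>. It orients \<open>(0, \<pi>/2) \<times> S\<^sup>3\<close>.\<close>

definition eta_sigma :: "real^5 \<Rightarrow> (real^5) list \<Rightarrow> real" where
  "eta_sigma y vs = y$1 * dwedge [0, 2, 3, 4] vs - y$2 * dwedge [0, 1, 3, 4] vs
     + y$3 * dwedge [0, 1, 2, 4] vs - y$4 * dwedge [0, 1, 2, 3] vs"

text \<open>\<open>b\<^bsub>-4\<^esub>\<close> depends on \<open>a\<close> only through the 2-jet of \<open>a\<close> at \<open>t\<close>; the variables \<open>\<alpha>, \<alpha>\<^sub>1, \<alpha>\<^sub>2\<close> are put
  in place of \<open>a(t), a'(t), a''(t)\<close> by evaluating it for the quadratic polynomial with that 2-jet.\<close>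

definition jet :: "real \<Rightarrow> real \<Rightarrow> real \<Rightarrow> real \<Rightarrow> real" where
  "jet \<alpha> \<alpha>1 \<alpha>2 s = \<alpha> + \<alpha>1 * s + \<alpha>2 * s\<^sup>2 / 2"

definition b4_jet :: "real \<Rightarrow> real \<Rightarrow> real \<Rightarrow> real \<Rightarrow> real^4 \<Rightarrow> complex" where
  "b4_jet \<alpha> \<alpha>1 \<alpha>2 \<eta> \<xi> = b4 (jet \<alpha> \<alpha>1 \<alpha>2) 0 \<eta> \<xi>"

text \<open>The form \<open>\<Omega>\<close> in the coordinates \<open>u\<close>, on the range \<open>0 < u\<^sub>0 < 1\<close> of the coordinate map.\<close>

definition Omega :: "real \<Rightarrow> real \<Rightarrow> real \<Rightarrow> real^5 \<Rightarrow> (real^5) list \<Rightarrow> complex" where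
  "Omega \<alpha> \<alpha>1 \<alpha>2 =
     pullback of_u (\<lambda>y vs. b4_jet \<alpha> \<alpha>1 \<alpha>2 (y$0) (xi_part y) * of_real (eta_sigma y vs))"

definition A4 :: "(real^5) set" where
  "A4 = {u. (u$1)\<^sup>2 + (u$2)\<^sup>2 + u$0 * (u$3)\<^sup>2 + (1 - u$0) * (u$4)\<^sup>2 = 1 \<and>
            (\<forall>i\<in>{0, 1, 2}. 0 < u$i \<and> u$i < 1)}"

definition A4_orientation :: "real^5 \<Rightarrow> (real^5) list \<Rightarrow> real" where
  "A4_orientation = pullback of_u eta_sigma"

text \<open>Equations of the hypersurfaces removed from affine space, and of the divisor \<open>\<Sigma>\<close>.\<close>

definition Q2 :: "real \<Rightarrow> real^5 \<Rightarrow> real" where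
  "Q2 \<alpha> u = (u$1)\<^sup>2 + ((u$2)\<^sup>2 + (u$3)\<^sup>2 + (u$4)\<^sup>2) / \<alpha>\<^sup>2"

definition removed :: "real \<Rightarrow> (real^5 \<Rightarrow> real) set" where
  "removed \<alpha> = {Q2 \<alpha>, \<lambda>u. u$0, \<lambda>u. u$0 - 1}"

definition Sigma_div :: "(real^5 \<Rightarrow> real) set" where
  "Sigma_div = {\<lambda>u. u$i - c | i c. i \<in> {0, 1, 2} \<and> c \<in> {0, 1}}"

definition restricts_to_Omega ::
  "(real^5 \<Rightarrow> (real^5) list \<Rightarrow> complex) \<Rightarrow> real \<Rightarrow> real \<Rightarrow> real \<Rightarrow> bool" where
  "restricts_to_Omega \<omega> \<alpha> \<alpha>1 \<alpha>2 \<longleftrightarrow>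
     (\<forall>u \<in> - zeros_of (removed \<alpha>). \<forall>vs. 0 < u$0 \<and> u$0 < 1 \<and> length vs = 4 \<longrightarrow>
        \<omega> u vs = Omega \<alpha> \<alpha>1 \<alpha>2 u vs)"

type_synonym R3 = "real \<times> real \<times> real"

end

theory Submission
  imports Defs
begin

text \<open>Write \<open>q\<^sub>1\<close> as a real combination of four anticommuting square roots of 1. Then
\<open>p\<^sub>1\<close> and \<open>\<sigma>\<^sub>-\<^sub>3\<close> lie in the real span of six trace-orthogonal matrices, and only derivatives in
\<open>t\<close> and \<open>\<eta>\<close> occur, so \<open>tr \<sigma>\<^sub>-\<^sub>4\<close> is an explicit rational function. Its even part is
\<open>main + cot\<^sup>2 \<eta> \<sqdot> c\<^sub>3 + tan\<^sup>2 \<eta> \<sqdot> c\<^sub>4\<close>, where \<open>main\<close>, \<open>c\<^sub>3\<close>, \<open>c\<^sub>4\<close> are rational in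
\<open>\<xi>\<^sub>1, \<xi>\<^sub>2, csc \<eta> \<xi>\<^sub>3, sec \<eta> \<xi>\<^sub>4\<close>. As \<open>cot\<^sup>2 \<eta> = (1 - u\<^sub>0) / u\<^sub>0\<close>, this is algebraic in the coordinates \<open>u\<close>.

The coefficients \<open>cot\<^sup>2 \<eta>\<close> and \<open>tan\<^sup>2 \<eta>\<close> are not integrable over \<open>(0, \<pi>/2)\<close>. Convergence holds because \<open>c\<^sub>3\<close> and
\<open>c\<^sub>4\<close> are sums of \<open>\<xi>\<close>-derivatives of functions homogeneous of degree \<open>-3\<close>, whose integrals over the unit
sphere vanish by Stokes; so the integral over a slice is that of \<open>main\<close>, which is bounded in \<open>\<eta>\<close>.

The reflections in \<open>\<xi>\<^sub>1\<close> and \<open>\<xi>\<^sub>2\<close> identify the four quarters of the sphere, one of which is the slice of \<open>A4\<close>.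
Hence the constant is \<open>4 \<sqdot> (2\<pi>)\<^sup>2 / (2\<^sup>5 \<pi>\<^sup>4) = 1 / (2\<pi>\<^sup>2) = -2 (2\<pi>\<i>)\<^sup>-\<^sup>2\<close>. Finally \<open>A4\<close> is the graph of \<open>u\<^sub>1\<close> over
an open set of the remaining coordinates, so its boundary lies in the hyperplanes bounding the cube.\<close>

section \<open>The trace of the parametrix\<close>

text \<open>What keeps the computation small is that p_2 is scalar. In every product that enters tr
  \<sigma>_{-4}, except \<sigma>_{-3} p_1, one factor is a multiple of the identity, so only the
  trace of the other factor matters; the derivatives of p_1 and \<sigma>_{-3} are followed in their
  identity component alone. The obstacle to algebraicity is that cot \<eta> - tan \<eta> and the
  \<eta>-derivative of p_2 are not rational in u_0. Each of them occurs alone only next to an odd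
  power of \<xi>_1, so averaging over \<xi>_1 and -\<xi>_1 leaves their squares and their product,
  which are rational. Two parametrizations of \<open>A4\<close> are used because they do different
  work: the graph reaches every point, while the cancellation on a slice is visible only in angles,
  which miss a null set. Finally, \<open>Omega\<close> is a pullback along a map with square roots
  and is controlled only for 0 < u_0 < 1, so a separate form with rational coefficients has to carry
  the algebraic statements.\<close>

lemma scaleR_complex: "c *\<^sub>R (z :: complex) = of_real c * z"
  by (rule scaleR_conv_of_real)

lemma cscale_simps:
  "cscale c (M + N) = cscale c M + cscale c N"
  "cscale c (r *\<^sub>R M) = r *\<^sub>R cscale c M"
  "cscale c (cscale d M) = cscale (c * d) M"
  "cscale c 0 = 0"
  by (simp_all add: cscale_def vec_eq_iff algebra_simps)

lemma trace_cscale: "trace (cscale c M) = c * trace M"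
  by (simp add: cscale_def trace_def sum_distrib_left)

lemma trace_scaleR: "trace (c *\<^sub>R (M :: complex^'n^'n)) = of_real c * trace M"
  by (simp add: trace_def sum_distrib_left scaleR_complex)

lemma trace_uminus: "trace (- (M :: complex^'n^'n)) = - trace M"
  by (simp add: trace_def sum_negf)

lemma scaleR_mat_1: "c *\<^sub>R (mat 1 :: complex^4^4) = mat (of_real c)"
  by (simp add: mat_def vec_eq_iff scaleR_complex)

lemma scaleR_matrix_mult:
  fixes M N :: "complex^'n^'n"
  shows "(c *\<^sub>R M) ** N = c *\<^sub>R (M ** N)" "M ** (c *\<^sub>R N) = c *\<^sub>R (M ** N)"
  by (simp_all add: matrix_matrix_mult_def vec_eq_iff scaleR_sum_right)

lemma cscale_matrix_mult:
  "cscale c M ** N = cscale c (M ** N)" "M ** cscale c N = cscale c (M ** N)"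
  by (simp_all add: matrix_matrix_mult_def vec_eq_iff cscale_def sum_distrib_left mult_ac)

lemma matrix_inv_eqI:
  fixes A :: "'a::semiring_1^'n^'n"
  assumes "A ** B = mat 1" "B ** A = mat 1"
  shows "matrix_inv A = B"
proof -
  have inv: "A ** matrix_inv A = mat 1"
    unfolding matrix_inv_def by (rule someI2 [of _ B]) (use assms in auto)
  have "matrix_inv A = (B ** A) ** matrix_inv A"
    using assms by simp
  also have "\<dots> = B"
    using inv by (simp flip: matrix_mul_assoc)
  finally show ?thesis .
qed

lemma matrix_inv_mat:
  assumes "c \<noteq> 0"
  shows "matrix_inv (mat (of_real c) :: complex^4^4) = inverse c *\<^sub>R mat 1"
proof -
  have "(c *\<^sub>R mat 1 :: complex^4^4) ** (inverse c *\<^sub>R mat 1) = mat 1"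
    "(inverse c *\<^sub>R mat 1 :: complex^4^4) ** (c *\<^sub>R mat 1) = mat 1"
    using assms by (simp_all add: scaleR_matrix_mult)
  then show ?thesis
    unfolding scaleR_mat_1 [symmetric] by (rule matrix_inv_eqI)
qed

text \<open>The closed formulas for the symbols hold only on open sets (nonzero \<xi>, admissible
  x), so the function to be differentiated is known only near 0 on the coordinate line.\<close>

lemma partial_xI:
  assumes "eventually (\<lambda>h. s (x + h *\<^sub>R axis j 1) \<xi> = f h) (nhds 0)"
    and "(f has_vector_derivative D) (at 0)"
  shows "partial_x j s x \<xi> = D"
proof -
  have "((\<lambda>h. s (x + h *\<^sub>R axis j 1) \<xi>) has_vector_derivative D) (at 0)"
    using assms(2) by (rule has_vector_derivative_transform_within_open
      [OF _ _ _ _, where S = "interior {h. s (x + h *\<^sub>R axis j 1) \<xi> = f h}"])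
      (use assms(1) in \<open>auto simp: eventually_nhds interior_def dest!: subsetD\<close>)
  then show ?thesis unfolding partial_x_def by (rule vector_derivative_at)
qed

lemma partial_xiI:
  assumes "eventually (\<lambda>h. s x (\<xi> + h *\<^sub>R axis j 1) = f h) (nhds 0)"
    and "(f has_vector_derivative D) (at 0)"
  shows "partial_xi j s x \<xi> = D"
proof -
  have "partial_x j (\<lambda>\<xi> x. s x \<xi>) \<xi> x = D"
    by (rule partial_xI [OF _ assms(2)]) (use assms(1) in simp)
  then show ?thesis by (simp add: partial_x_def partial_xi_def)
qed

section \<open>Clifford matrices and the real span containing p_1\<close>

definition gam1 :: "complex^4^4" where
  "gam1 = off_diagonal (vector [vector [-1, 0], vector [0, -1]]) (vector [vector [-1, 0], vector [0, -1]])"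
definition gam2 :: "complex^4^4" where
  "gam2 = off_diagonal (vector [vector [0, \<i>], vector [\<i>, 0]]) (vector [vector [0, -\<i>], vector [-\<i>, 0]])"
definition gam3 :: "complex^4^4" where
  "gam3 = off_diagonal (vector [vector [0, 1], vector [-1, 0]]) (vector [vector [0, -1], vector [1, 0]])"
definition gam4 :: "complex^4^4" where
  "gam4 = off_diagonal (vector [vector [\<i>, 0], vector [0, -\<i>]]) (vector [vector [-\<i>, 0], vector [0, \<i>]])"

lemmas gam_defs = gam1_def gam2_def gam3_def gam4_def off_diagonal_def

lemma q1_gam:
  "q1 a x \<xi> = (\<xi>$1) *\<^sub>R gam1 + (\<xi>$2 / a (x$1)) *\<^sub>R gam2
     + (\<xi>$3 / sin (x$2) / a (x$1)) *\<^sub>R gam3 + (\<xi>$4 / cos (x$2) / a (x$1)) *\<^sub>R gam4"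
  by (simp add: q1_def A1_def B1_def Let_def gam_defs vec_eq_iff forall_4)
     (simp add: scaleR_complex algebra_simps add_divide_distrib diff_divide_distrib)

lemma q0_gam:
  "q0 a x \<xi> = (- 3 * deriv a (x$1) / (2 * a (x$1))) *\<^sub>R cscale \<i> gam1
     + ((tan (x$2) - cot (x$2)) / (2 * a (x$1))) *\<^sub>R cscale \<i> gam2"
  by (simp add: q0_def A0_def B0_def Let_def gam_defs vec_eq_iff forall_4 cscale_def)
     (simp add: scaleR_complex algebra_simps divide_simps)

text \<open>The matrices spanning \<open>p\<^sub>1\<close> and \<open>\<sigma>\<^sub>-\<^sub>3\<close>: \<open>- \<i>\<close> times the identity and, up to scalars, the products of two
distinct \<open>gam\<close> matrices that occur in \<open>p\<^sub>1\<close>.\<close>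

definition bas0 :: "complex^4^4" where
  "bas0 = vector
    [vector [- \<i>, 0, 0, 0],
     vector [0, - \<i>, 0, 0],
     vector [0, 0, - \<i>, 0],
     vector [0, 0, 0, - \<i>]]"
definition bas1 :: "complex^4^4" where
  "bas1 = vector
    [vector [0, -1, 0, 0],
     vector [-1, 0, 0, 0],
     vector [0, 0, 0, 1],
     vector [0, 0, 1, 0]]"
definition bas2 :: "complex^4^4" where
  "bas2 = vector
    [vector [0, \<i>, 0, 0],
     vector [- \<i>, 0, 0, 0],
     vector [0, 0, 0, - \<i>],
     vector [0, 0, \<i>, 0]]"
definition bas3 :: "complex^4^4" where
  "bas3 = vector
    [vector [-1, 0, 0, 0],
     vector [0, 1, 0, 0],
     vector [0, 0, 1, 0],
     vector [0, 0, 0, -1]]"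
definition bas4 :: "complex^4^4" where
  "bas4 = vector
    [vector [-1, 0, 0, 0],
     vector [0, 1, 0, 0],
     vector [0, 0, -1, 0],
     vector [0, 0, 0, 1]]"
definition bas5 :: "complex^4^4" where
  "bas5 = vector
    [vector [0, \<i>, 0, 0],
     vector [- \<i>, 0, 0, 0],
     vector [0, 0, 0, \<i>],
     vector [0, 0, - \<i>, 0]]"

lemmas bas_defs = bas0_def bas1_def bas2_def bas3_def bas4_def bas5_def

lemma trace_bas:
  "trace bas0 = - 4 * \<i>" "trace bas1 = 0" "trace bas2 = 0" "trace bas3 = 0" "trace bas4 = 0" "trace bas5 = 0"
  by (simp_all add: trace_def bas_defs sum_4)

text \<open>The six matrices are orthogonal for the trace form. The single minus sign comes from
  \<open>bas0\<close>, whose square is minus the identity; the other five square to the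
  identity.\<close>

lemma trace_sq:
  "trace ((l0 *\<^sub>R bas0 + l1 *\<^sub>R bas1 + l2 *\<^sub>R bas2 + l3 *\<^sub>R bas3 + l4 *\<^sub>R bas4 + l5 *\<^sub>R bas5) **
     (m0 *\<^sub>R bas0 + m1 *\<^sub>R bas1 + m2 *\<^sub>R bas2 + m3 *\<^sub>R bas3 + m4 *\<^sub>R bas4 + m5 *\<^sub>R bas5)) =
   of_real (4 * (- l0 * m0 + l1 * m1 + l2 * m2 + l3 * m3 + l4 * m4 + l5 * m5))"
  by (simp add: trace_def matrix_matrix_mult_def bas_defs sum_4 complex_eq_iff algebra_simps)

text \<open>By the Clifford relations the anticommutator of q_0 and q_1 is scalar and yields
  \<open>bas0\<close>. The other five matrices come from the derivative term: \<open>bas1\<close>,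
  \<open>bas2\<close>, \<open>bas3\<close> are i times \<open>gam1 ** gam2\<close>,
  \<open>gam1 ** gam3\<close>, \<open>gam1 ** gam4\<close>, and \<open>bas4\<close>,
  \<open>bas5\<close> are i and -i times \<open>gam2 ** gam3\<close>, \<open>gam2 ** gam4\<close>.
  The parameters w are the coefficients of q_0, v the orthonormal components of \<xi>, h and k the
  derivatives of q_1 in t and \<eta> up to sign, and c is 1/a.\<close>

lemma p1_algebra:
  "((w1 *\<^sub>R cscale \<i> gam1 + w2 *\<^sub>R cscale \<i> gam2) ** (v1 *\<^sub>R gam1 + v2 *\<^sub>R gam2 + v3 *\<^sub>R gam3 + v4 *\<^sub>R gam4)
   + (v1 *\<^sub>R gam1 + v2 *\<^sub>R gam2 + v3 *\<^sub>R gam3 + v4 *\<^sub>R gam4) ** (w1 *\<^sub>R cscale \<i> gam1 + w2 *\<^sub>R cscale \<i> gam2))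
   - cscale \<i> (gam1 ** ((- h2) *\<^sub>R gam2 + (- h3) *\<^sub>R gam3 + (- h4) *\<^sub>R gam4)
       + (c *\<^sub>R gam2) ** ((- k3) *\<^sub>R gam3 + k4 *\<^sub>R gam4))
   = (-2 * (w1 * v1 + w2 * v2)) *\<^sub>R bas0 + h2 *\<^sub>R bas1 + h3 *\<^sub>R bas2 + h4 *\<^sub>R bas3
     + (c * k3) *\<^sub>R bas4 + (c * k4) *\<^sub>R bas5"
  by (simp add: bas_defs gam_defs matrix_matrix_mult_def vec_eq_iff sum_4 forall_4 cscale_def complex_eq_iff algebra_simps)

definition lin6 :: "real \<Rightarrow> real \<Rightarrow> real \<Rightarrow> real \<Rightarrow> real \<Rightarrow> real \<Rightarrow> complex^4^4" where
  "lin6 l0 l1 l2 l3 l4 l5 =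
     l0 *\<^sub>R bas0 + l1 *\<^sub>R bas1 + l2 *\<^sub>R bas2 + l3 *\<^sub>R bas3 + l4 *\<^sub>R bas4 + l5 *\<^sub>R bas5"

lemma trace_lin6: "trace (lin6 l0 l1 l2 l3 l4 l5) = - 4 * \<i> * of_real l0"
  by (simp add: lin6_def trace_add trace_scaleR trace_bas)

text \<open>Only \<open>bas0\<close> has nonzero trace, so the derivative is computed for its
  coefficient; for the other five, existence is enough to make the matrix derivative
  meaningful.\<close>

lemma lin6_deriv:
  fixes f0 :: "real \<Rightarrow> real"
  assumes f0: "(f0 has_real_derivative d0) (at z)"
    and "f1 differentiable (at z)" "f2 differentiable (at z)" "f3 differentiable (at z)"
      "f4 differentiable (at z)" "f5 differentiable (at z)"
  obtains D where "((\<lambda>h. lin6 (f0 h) (f1 h) (f2 h) (f3 h) (f4 h) (f5 h)) has_vector_derivative D) (at z)"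
    "trace D = - 4 * \<i> * of_real d0"
proof -
  from assms(2-) obtain d1 d2 d3 d4 d5 where
    "(f1 has_real_derivative d1) (at z)" "(f2 has_real_derivative d2) (at z)"
    "(f3 has_real_derivative d3) (at z)" "(f4 has_real_derivative d4) (at z)"
    "(f5 has_real_derivative d5) (at z)"
    by (auto simp: real_differentiable_def)
  with f0 have "((\<lambda>h. lin6 (f0 h) (f1 h) (f2 h) (f3 h) (f4 h) (f5 h)) has_vector_derivative
      lin6 d0 d1 d2 d3 d4 d5) (at z)"
    unfolding lin6_def by (auto intro!: derivative_eq_intros)
  then show thesis by (rule that) (simp add: trace_lin6)
qed

section \<open>The recursion for the parametrix up to \<sigma>_{-4}\<close>

definition multi_indices :: "nat \<Rightarrow> (nat^4) set" where
  "multi_indices n = {\<beta>. (\<Sum>i\<in>UNIV. \<beta>$i) = n}"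

lemma multi_indices_0: "multi_indices 0 = {vector [0, 0, 0, 0]}"
  by (auto simp: multi_indices_def vec_eq_iff forall_4 sum_4)

lemma multi_indices_1:
  "multi_indices 1 = {vector [1, 0, 0, 0], vector [0, 1, 0, 0], vector [0, 0, 1, 0], vector [0, 0, 0, 1]}"
  by (auto simp: multi_indices_def vec_eq_iff forall_4 sum_4)

text \<open>The grouping separates the three indices in t and \<eta> from the seven that
  differentiate in an angle \<phi>_1 or \<phi>_2 and will contribute nothing.\<close>

lemma multi_indices_2:
  "multi_indices 2 = {vector [2, 0, 0, 0], vector [1, 1, 0, 0], vector [0, 2, 0, 0]} \<union>
     ({vector [1, 0, 1, 0], vector [0, 1, 1, 0], vector [0, 0, 2, 0],
       vector [1, 0, 0, 1], vector [0, 1, 0, 1], vector [0, 0, 1, 1], vector [0, 0, 0, 2]})"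
proof -
  have "\<beta> \<in> multi_indices 2 \<longleftrightarrow> \<beta> \<in> {vector [2, 0, 0, 0], vector [1, 1, 0, 0], vector [0, 2, 0, 0],
     vector [1, 0, 1, 0], vector [0, 1, 1, 0], vector [0, 0, 2, 0],
       vector [1, 0, 0, 1], vector [0, 1, 0, 1], vector [0, 0, 1, 1], vector [0, 0, 0, 2]}" for \<beta>
    by (simp add: multi_indices_def vec_eq_iff forall_4 sum_4) arith
  then show ?thesis by blast
qed

definition sigma_term :: "(real \<Rightarrow> real) \<Rightarrow> nat \<Rightarrow> nat \<Rightarrow> nat^4 \<Rightarrow> symb" where
  "sigma_term a j k \<beta> x \<xi> = cscale ((- \<i>) ^ (\<Sum>i\<in>UNIV. \<beta>$i) / of_nat (\<Prod>i\<in>UNIV. fact (\<beta>$i)))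
     (multi_partial partial_xi \<beta> (sigma a j) x \<xi> ** multi_partial partial_x \<beta> (p_symbol a k) x \<xi>)"

lemma multi_index_shift:
  "{\<beta> :: nat^4. 2 + j + (\<Sum>i\<in>UNIV. \<beta>$i) = N + k} = (if 2 + j \<le> N + k then multi_indices (N + k - (2 + j)) else {})"
  by (auto simp: multi_indices_def)

lemma sigma_0: "sigma a 0 x \<xi> = matrix_inv (p_symbol a 2 x \<xi>)"
  by (simp add: sigma.simps)

lemma sigma_1:
  "sigma a 1 x \<xi> = - ((\<Sum>\<beta>\<in>multi_indices 0. sigma_term a 0 1 \<beta> x \<xi>)
     + (\<Sum>\<beta>\<in>multi_indices 1. sigma_term a 0 2 \<beta> x \<xi>)) ** matrix_inv (p_symbol a 2 x \<xi>)"
  unfolding sigma.simps [of a 1] multi_index_shift sigma_term_def [symmetric]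
  by (simp add: numeral_2_eq_2 atMost_Suc add.commute del: minus_add_distrib)

text \<open>For N = 2 the degree condition reads |\<beta>| = k - j, which leaves the five pairs (j,
  k) = (0,0), (0,1), (0,2), (1,1), (1,2).\<close>

lemma sigma_2:
  "sigma a 2 x \<xi> = - ((\<Sum>\<beta>\<in>multi_indices 0. sigma_term a 0 0 \<beta> x \<xi>)
     + (\<Sum>\<beta>\<in>multi_indices 1. sigma_term a 0 1 \<beta> x \<xi>)
     + (\<Sum>\<beta>\<in>multi_indices 2. sigma_term a 0 2 \<beta> x \<xi>)
     + (\<Sum>\<beta>\<in>multi_indices 0. sigma_term a 1 1 \<beta> x \<xi>)
     + (\<Sum>\<beta>\<in>multi_indices 1. sigma_term a 1 2 \<beta> x \<xi>)) ** matrix_inv (p_symbol a 2 x \<xi>)"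
  unfolding sigma.simps [of a 2] multi_index_shift sigma_term_def [symmetric]
  by (simp add: numeral_2_eq_2 atMost_Suc lessThan_Suc ac_simps)

section \<open>Derivatives along coordinate lines\<close>

lemma eventually_line:
  fixes x v :: "'a::real_normed_vector"
  assumes "open S" "x \<in> S"
  shows "eventually (\<lambda>h. x + h *\<^sub>R v \<in> S) (nhds 0)"
proof -
  have "open ((\<lambda>h. x + h *\<^sub>R v) -` S)"
    by (intro open_vimage assms continuous_intros)
  then show ?thesis unfolding eventually_nhds
    using assms(2) by (intro exI [of _ "(\<lambda>h. x + h *\<^sub>R v) -` S"]) simp
qed

lemma DERIV_line: "(f has_real_derivative D) (at t) \<Longrightarrow> ((\<lambda>h. f (t + h)) has_real_derivative D) (at 0)"
  using DERIV_shift [of f D 0 t] by (simp add: add.commute)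

lemma has_vector_derivative_scaleR_const:
  "(f has_real_derivative D) (at z) \<Longrightarrow> ((\<lambda>h. f h *\<^sub>R M) has_vector_derivative D *\<^sub>R M) (at z)"
  using has_vector_derivative_scaleR [of f D z UNIV "\<lambda>_. M" 0] by simp

lemma axis_nth_if [simp]: "axis i c $ j = (if i = j then c else 0)"
  by (simp add: axis_def)

text \<open>With this and \<open>sec4\<close> as variables, an \<eta>-derivative multiplies them by
  - cot \<eta> and tan \<eta>, so everything stays polynomial in \<open>csc3\<close>,
  \<open>sec4\<close>, cot and tan.\<close>

definition csc3 :: "real^4 \<Rightarrow> real^4 \<Rightarrow> real" where "csc3 x \<xi> = \<xi>$3 / sin (x$2)"
definition sec4 :: "real^4 \<Rightarrow> real^4 \<Rightarrow> real" where "sec4 x \<xi> = \<xi>$4 / cos (x$2)"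

lemma csc3_line:
  "csc3 (x + h *\<^sub>R axis 1 1) \<xi> = csc3 x \<xi>" "csc3 (x + h *\<^sub>R axis 3 1) \<xi> = csc3 x \<xi>"
  "csc3 (x + h *\<^sub>R axis 4 1) \<xi> = csc3 x \<xi>"
  "csc3 x (\<xi> + h *\<^sub>R axis 1 1) = csc3 x \<xi>" "csc3 x (\<xi> + h *\<^sub>R axis 2 1) = csc3 x \<xi>"
  "sec4 (x + h *\<^sub>R axis 1 1) \<xi> = sec4 x \<xi>" "sec4 (x + h *\<^sub>R axis 3 1) \<xi> = sec4 x \<xi>"
  "sec4 (x + h *\<^sub>R axis 4 1) \<xi> = sec4 x \<xi>"
  "sec4 x (\<xi> + h *\<^sub>R axis 1 1) = sec4 x \<xi>" "sec4 x (\<xi> + h *\<^sub>R axis 2 1) = sec4 x \<xi>"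
  by (simp_all add: csc3_def sec4_def)

lemma DERIV_csc3:
  assumes "sin (x$2) \<noteq> 0"
  shows "((\<lambda>h. csc3 (x + h *\<^sub>R axis 2 1) \<xi>) has_real_derivative - (cot (x$2) * csc3 x \<xi>)) (at 0)"
  unfolding csc3_def by (rule derivative_eq_intros | use assms in \<open>simp add: cot_def power2_eq_square\<close>)+

lemma DERIV_sec4:
  assumes "cos (x$2) \<noteq> 0"
  shows "((\<lambda>h. sec4 (x + h *\<^sub>R axis 2 1) \<xi>) has_real_derivative tan (x$2) * sec4 x \<xi>) (at 0)"
  unfolding sec4_def by (rule derivative_eq_intros | use assms in \<open>simp add: tan_def power2_eq_square\<close>)+

lemma DERIV_cot_line:
  assumes "sin (y::real) \<noteq> 0"
  shows "((\<lambda>h. cot (y + h)) has_real_derivative - (1 + (cot y)\<^sup>2)) (at 0)"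
  by (rule DERIV_cong [OF DERIV_line [OF DERIV_cot [OF assms]]])
     (use assms sin_cos_squared_add [of y] in \<open>simp add: cot_def field_simps\<close>)

lemma DERIV_tan_line:
  assumes "cos (y::real) \<noteq> 0"
  shows "((\<lambda>h. tan (y + h)) has_real_derivative 1 + (tan y)\<^sup>2) (at 0)"
  by (rule DERIV_cong [OF DERIV_line [OF DERIV_tan [OF assms]]])
     (use assms sin_cos_squared_add [of y] in \<open>simp add: tan_def field_simps\<close>)

text \<open>\<open>PP\<close> is the scalar \<open>p\<^sub>2\<close>. Its first and second derivatives in \<open>x\<^sub>1, x\<^sub>2\<close> are \<open>YY\<close> and \<open>ZZ\<close>, and the derivatives of
\<open>1 / PP\<close> in \<open>\<xi>\<^sub>1, \<xi>\<^sub>2\<close> are \<open>S\<close>; \<open>LL\<close> is \<open>\<i> tr(p\<^sub>1) / 4\<close> and \<open>EE\<close> is the sum of \<open>\<partial>\<^bsub>\<xi>\<^sub>j\<^esub> p\<^sub>2 \<partial>\<^bsub>x\<^sub>j\<^esub> p\<^sub>2\<close>. The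
indices 3 and 4 never occur, since the symbol does not depend on \<open>\<phi>\<^sub>1, \<phi>\<^sub>2\<close>.\<close>

definition PP :: "(real \<Rightarrow> real) \<Rightarrow> real^4 \<Rightarrow> real^4 \<Rightarrow> real" where
  "PP a x \<xi> = (\<xi>$1)\<^sup>2 + ((\<xi>$2)\<^sup>2 + (csc3 x \<xi>)\<^sup>2 + (sec4 x \<xi>)\<^sup>2) / (a (x$1))\<^sup>2"

lemma p2_PP: "p_symbol a 2 x \<xi> = PP a x \<xi> *\<^sub>R mat 1"
  unfolding p_symbol_2 PP_def csc3_def sec4_def scaleR_mat_1 ..

definition YY1 :: "(real \<Rightarrow> real) \<Rightarrow> real^4 \<Rightarrow> real^4 \<Rightarrow> real" where
  "YY1 a x \<xi> = - 2 * deriv a (x$1) * ((\<xi>$2)\<^sup>2 + (csc3 x \<xi>)\<^sup>2 + (sec4 x \<xi>)\<^sup>2) / (a (x$1)) ^ 3"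

definition YY2 :: "(real \<Rightarrow> real) \<Rightarrow> real^4 \<Rightarrow> real^4 \<Rightarrow> real" where
  "YY2 a x \<xi> = (2 * tan (x$2) * (sec4 x \<xi>)\<^sup>2 - 2 * cot (x$2) * (csc3 x \<xi>)\<^sup>2) / (a (x$1))\<^sup>2"

definition LL :: "(real \<Rightarrow> real) \<Rightarrow> real^4 \<Rightarrow> real^4 \<Rightarrow> real" where
  "LL a x \<xi> = 3 * deriv a (x$1) / a (x$1) * \<xi>$1 + (cot (x$2) - tan (x$2)) / (a (x$1))\<^sup>2 * \<xi>$2"

definition EE :: "(real \<Rightarrow> real) \<Rightarrow> real^4 \<Rightarrow> real^4 \<Rightarrow> real" where
  "EE a x \<xi> = 2 * \<xi>$1 * YY1 a x \<xi> + 2 * \<xi>$2 / (a (x$1))\<^sup>2 * YY2 a x \<xi>"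

lemma partial_x_scal:
  assumes "eventually (\<lambda>h. s (x + h *\<^sub>R axis j 1) \<xi> = f h *\<^sub>R M) (nhds 0)"
    and "(f has_real_derivative D) (at 0)"
  shows "partial_x j s x \<xi> = D *\<^sub>R M"
  using assms(1) has_vector_derivative_scaleR_const [OF assms(2)] by (rule partial_xI)

lemma partial_xi_scal:
  assumes "eventually (\<lambda>h. s x (\<xi> + h *\<^sub>R axis j 1) = f h *\<^sub>R M) (nhds 0)"
    and "(f has_real_derivative D) (at 0)"
  shows "partial_xi j s x \<xi> = D *\<^sub>R M"
  using assms(1) has_vector_derivative_scaleR_const [OF assms(2)] by (rule partial_xiI)

lemma partial_x_const:
  assumes "\<And>h. s (x + h *\<^sub>R axis j 1) \<xi> = s x \<xi>"
  shows "partial_x j s x \<xi> = 0"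
  by (rule partial_xI [where f = "\<lambda>_. s x \<xi>"]) (simp_all add: assms)

text \<open>Stated as equality of functions because in a mixed derivative such as
  \<open>D 1 (D 3 s)\<close> the derivative in the angle is the inner one.\<close>

lemma partial_x_p2_34:
  "partial_x 3 (p_symbol a 2) = (\<lambda>_ _. 0)" "partial_x 4 (p_symbol a 2) = (\<lambda>_ _. 0)"
  by (intro ext partial_x_const, simp add: p2_PP PP_def csc3_line)+

lemma partial_x_0: "partial_x j (\<lambda>_ _. 0) = (\<lambda>_ _. 0)"
  by (intro ext partial_x_const) simp

lemma partial_xi_q1:
  "partial_xi 1 (q1 a) x \<xi> = gam1"
  "partial_xi 2 (q1 a) x \<xi> = (1 / a (x$1)) *\<^sub>R gam2"
proof -
  have "partial_xi 1 (q1 a) x \<xi> = 1 *\<^sub>R gam1 + 0 *\<^sub>R 0"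
    unfolding q1_gam by (rule partial_xiI [OF always_eventually]) (rule allI, rule refl, auto intro!: derivative_eq_intros)
  then show "partial_xi 1 (q1 a) x \<xi> = gam1" by simp
  show "partial_xi 2 (q1 a) x \<xi> = (1 / a (x$1)) *\<^sub>R gam2"
    unfolding q1_gam divide_inverse
    by (rule partial_xiI [OF always_eventually]) (rule allI, rule refl, auto intro!: derivative_eq_intros)
qed

lemma partial_x_q_34:
  "partial_x 3 (q1 a) x \<xi> = 0" "partial_x 4 (q1 a) x \<xi> = 0"
  "partial_x 3 (q0 a) x \<xi> = 0" "partial_x 4 (q0 a) x \<xi> = 0"
  by (rule partial_x_const, simp add: q1_gam q0_gam)+

text \<open>\<sigma>_{-4} involves a and its first two derivatives. Positivity is weakened to a
  nonvanishing condition on an open set so that the locale also covers the quadratic jet, where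
  \<alpha> may be negative and the polynomial may have zeros elsewhere.\<close>

locale scale_factor =
  fixes a :: "real \<Rightarrow> real" and T :: "real set"
  assumes open_T: "open T"
    and a_nz: "s \<in> T \<Longrightarrow> a s \<noteq> 0"
    and deriv_a: "s \<in> T \<Longrightarrow> (a has_real_derivative deriv a s) (at s)"
    and deriv2_a: "s \<in> T \<Longrightarrow> (deriv a has_real_derivative deriv (deriv a) s) (at s)"
begin

definition adm :: "(real^4) set" where
  "adm = {x. x$1 \<in> T \<and> sin (x$2) \<noteq> 0 \<and> cos (x$2) \<noteq> 0}"

lemma admD: "x \<in> adm \<Longrightarrow> x$1 \<in> T" "x \<in> adm \<Longrightarrow> sin (x$2) \<noteq> 0" "x \<in> adm \<Longrightarrow> cos (x$2) \<noteq> 0"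
  "x \<in> adm \<Longrightarrow> a (x$1) \<noteq> 0"
  by (auto simp: adm_def a_nz)

lemma open_adm: "open adm"
proof -
  have "adm = ((\<lambda>x. x$1) -` T) \<inter> ((\<lambda>x. sin (x$2)) -` (- {0})) \<inter> ((\<lambda>x. cos (x$2)) -` (- {0}))"
    by (auto simp: adm_def)
  also have "open \<dots>"
    by (intro open_Int open_vimage open_T continuous_intros open_Compl closed_singleton)
  finally show ?thesis .
qed

lemma eventually_adm: "x \<in> adm \<Longrightarrow> eventually (\<lambda>h. x + h *\<^sub>R axis j 1 \<in> adm) (nhds 0)"
  by (rule eventually_line [OF open_adm])

lemma eventually_nz: "\<xi> \<noteq> 0 \<Longrightarrow> eventually (\<lambda>h. (\<xi>::real^4) + h *\<^sub>R axis j 1 \<noteq> 0) (nhds 0)"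
  using eventually_line [of "- {0}" \<xi>] by (auto simp: open_Compl)

lemma PP_pos:
  assumes "x \<in> adm" "\<xi> \<noteq> 0"
  shows "PP a x \<xi> > 0"
proof -
  have "\<xi>$1 \<noteq> 0 \<or> \<xi>$2 \<noteq> 0 \<or> csc3 x \<xi> \<noteq> 0 \<or> sec4 x \<xi> \<noteq> 0"
    using assms by (auto simp: csc3_def sec4_def vec_eq_iff forall_4 admD)
  then have "0 < (\<xi>$1)\<^sup>2 \<or> 0 < (\<xi>$2)\<^sup>2 + (csc3 x \<xi>)\<^sup>2 + (sec4 x \<xi>)\<^sup>2"
    by (auto simp: add_pos_nonneg add_nonneg_pos)
  then show ?thesis
    using admD(4) [OF assms(1)] unfolding PP_def
    by (auto simp: add_pos_nonneg add_nonneg_pos)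
qed

lemma
  assumes "x \<in> adm"
  shows DERIV_a: "((\<lambda>h. a (x$1 + h)) has_real_derivative deriv a (x$1)) (at 0)"
    and DERIV_a1: "((\<lambda>h. deriv a (x$1 + h)) has_real_derivative deriv (deriv a) (x$1)) (at 0)"
  using assms by (auto intro!: DERIV_line deriv_a deriv2_a dest: admD)

lemma PP_x1:
  assumes "x \<in> adm"
  shows "((\<lambda>h. PP a (x + h *\<^sub>R axis 1 1) \<xi>) has_real_derivative YY1 a x \<xi>) (at 0)"
  unfolding PP_def csc3_line YY1_def
  by simp (rule derivative_eq_intros DERIV_a [OF assms] refl | use admD [OF assms] in
    \<open>simp add: field_simps eval_nat_numeral\<close>)+

lemma PP_x2:
  assumes "x \<in> adm"
  shows "((\<lambda>h. PP a (x + h *\<^sub>R axis 2 1) \<xi>) has_real_derivative YY2 a x \<xi>) (at 0)"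
  unfolding PP_def YY2_def
  by simp (rule DERIV_csc3 [OF admD(2) [OF assms]] DERIV_sec4 [OF admD(3) [OF assms]] derivative_eq_intros refl | use admD [OF assms] in
    \<open>simp add: field_simps eval_nat_numeral\<close>)+

lemma partial_x_p2:
  assumes "x \<in> adm"
  shows "partial_x 1 (p_symbol a 2) x \<xi> = YY1 a x \<xi> *\<^sub>R mat 1"
    and "partial_x 2 (p_symbol a 2) x \<xi> = YY2 a x \<xi> *\<^sub>R mat 1"
  unfolding p2_PP using PP_x1 [OF assms] PP_x2 [OF assms] by (auto intro!: partial_x_scal)

definition ZZ11 where
  "ZZ11 x \<xi> = ((\<xi>$2)\<^sup>2 + (csc3 x \<xi>)\<^sup>2 + (sec4 x \<xi>)\<^sup>2) *
     (6 * (deriv a (x$1))\<^sup>2 / (a (x$1)) ^ 4 - 2 * deriv (deriv a) (x$1) / (a (x$1)) ^ 3)"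

definition ZZ12 where "ZZ12 x \<xi> = - 2 * deriv a (x$1) / a (x$1) * YY2 a x \<xi>"

definition ZZ22 where
  "ZZ22 x \<xi> = ((2 + 6 * (cot (x$2))\<^sup>2) * (csc3 x \<xi>)\<^sup>2 + (2 + 6 * (tan (x$2))\<^sup>2) * (sec4 x \<xi>)\<^sup>2) / (a (x$1))\<^sup>2"

lemma YY_x:
  assumes "x \<in> adm"
  shows "((\<lambda>h. YY1 a (x + h *\<^sub>R axis 1 1) \<xi>) has_real_derivative ZZ11 x \<xi>) (at 0)" (is ?t1)
    and "((\<lambda>h. YY2 a (x + h *\<^sub>R axis 1 1) \<xi>) has_real_derivative ZZ12 x \<xi>) (at 0)" (is ?t2)
    and "((\<lambda>h. YY2 a (x + h *\<^sub>R axis 2 1) \<xi>) has_real_derivative ZZ22 x \<xi>) (at 0)" (is ?t3)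
proof -
  note a = DERIV_a [OF assms] DERIV_a1 [OF assms]
    and y = DERIV_cot_line [OF admD(2) [OF assms]] DERIV_tan_line [OF admD(3) [OF assms]]
      DERIV_csc3 [OF admD(2) [OF assms]] DERIV_sec4 [OF admD(3) [OF assms]]
    and nz = admD [OF assms]
  show ?t1
    unfolding YY1_def ZZ11_def csc3_line
    by simp (rule a derivative_eq_intros refl | use nz in \<open>simp add: field_simps eval_nat_numeral\<close>)+
  show ?t2
    unfolding YY2_def ZZ12_def csc3_line
    by simp (rule a derivative_eq_intros refl | use nz in \<open>simp add: field_simps eval_nat_numeral\<close>)+
  show ?t3
    unfolding YY2_def ZZ22_def
    by simp (rule y derivative_eq_intros refl | use nz in \<open>simp add: field_simps eval_nat_numeral\<close>)+
qed

lemma partial_x_x_p2: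
  assumes "x \<in> adm"
  shows "partial_x 1 (partial_x 1 (p_symbol a 2)) x \<xi> = ZZ11 x \<xi> *\<^sub>R mat 1" (is ?t1)
    and "partial_x 1 (partial_x 2 (p_symbol a 2)) x \<xi> = ZZ12 x \<xi> *\<^sub>R mat 1" (is ?t2)
    and "partial_x 2 (partial_x 2 (p_symbol a 2)) x \<xi> = ZZ22 x \<xi> *\<^sub>R mat 1" (is ?t3)
proof -
  note ev = eventually_mono [OF eventually_adm [OF assms]]
  show ?t1
    by (rule partial_x_scal [OF ev YY_x(1) [OF assms]]) (rule partial_x_p2)
  show ?t2
    by (rule partial_x_scal [OF ev YY_x(2) [OF assms]]) (rule partial_x_p2)
  show ?t3
    by (rule partial_x_scal [OF ev YY_x(3) [OF assms]]) (rule partial_x_p2)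
qed

lemma sigma_0_PP: "x \<in> adm \<Longrightarrow> \<xi> \<noteq> 0 \<Longrightarrow> sigma a 0 x \<xi> = (1 / PP a x \<xi>) *\<^sub>R mat 1"
  using PP_pos [of x \<xi>] matrix_inv_mat [of "PP a x \<xi>"]
  by (simp add: sigma_0 p2_PP scaleR_mat_1 inverse_eq_divide)

lemma matrix_inv_PP: "x \<in> adm \<Longrightarrow> \<xi> \<noteq> 0 \<Longrightarrow> matrix_inv (p_symbol a 2 x \<xi>) = (1 / PP a x \<xi>) *\<^sub>R mat 1"
  using sigma_0_PP [of x \<xi>] by (simp add: sigma_0)

lemma PP_xi:
  assumes "x \<in> adm"
  shows "((\<lambda>h. PP a x (\<xi> + h *\<^sub>R axis 1 1)) has_real_derivative 2 * \<xi>$1) (at 0)"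
    and "((\<lambda>h. PP a x (\<xi> + h *\<^sub>R axis 2 1)) has_real_derivative 2 * \<xi>$2 / (a (x$1))\<^sup>2) (at 0)"
  unfolding PP_def using admD(4) [OF assms]
  by (auto simp: csc3_line field_simps eval_nat_numeral intro!: derivative_eq_intros)

definition S1 where "S1 x \<xi> = - (2 * \<xi>$1) / (PP a x \<xi>)\<^sup>2"
definition S2 where "S2 x \<xi> = - (2 * \<xi>$2 / (a (x$1))\<^sup>2) / (PP a x \<xi>)\<^sup>2"
definition S11 where "S11 x \<xi> = 2 * (2 * \<xi>$1)\<^sup>2 / (PP a x \<xi>) ^ 3 - 2 / (PP a x \<xi>)\<^sup>2"
definition S12 where "S12 x \<xi> = 2 * (2 * \<xi>$1) * (2 * \<xi>$2 / (a (x$1))\<^sup>2) / (PP a x \<xi>) ^ 3"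
definition S22 where
  "S22 x \<xi> = 2 * (2 * \<xi>$2 / (a (x$1))\<^sup>2)\<^sup>2 / (PP a x \<xi>) ^ 3 - 2 / (a (x$1))\<^sup>2 / (PP a x \<xi>)\<^sup>2"

lemma S_xi:
  assumes "x \<in> adm" "\<xi> \<noteq> 0"
  shows "((\<lambda>h. 1 / PP a x (\<xi> + h *\<^sub>R axis 1 1)) has_real_derivative S1 x \<xi>) (at 0)"
    and "((\<lambda>h. 1 / PP a x (\<xi> + h *\<^sub>R axis 2 1)) has_real_derivative S2 x \<xi>) (at 0)"
    and "((\<lambda>h. S1 x (\<xi> + h *\<^sub>R axis 1 1)) has_real_derivative S11 x \<xi>) (at 0)"
    and "((\<lambda>h. S2 x (\<xi> + h *\<^sub>R axis 1 1)) has_real_derivative S12 x \<xi>) (at 0)"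
    and "((\<lambda>h. S2 x (\<xi> + h *\<^sub>R axis 2 1)) has_real_derivative S22 x \<xi>) (at 0)"
  unfolding S1_def S2_def S11_def S12_def S22_def using PP_pos [OF assms] admD(4) [OF assms(1)]
  by (auto intro!: PP_xi [OF assms(1)] derivative_eq_intros simp: field_simps eval_nat_numeral)

lemma partial_xi_sigma_0:
  assumes "x \<in> adm" "\<xi> \<noteq> 0"
  shows "partial_xi 1 (sigma a 0) x \<xi> = S1 x \<xi> *\<^sub>R mat 1" (is ?t1)
    and "partial_xi 2 (sigma a 0) x \<xi> = S2 x \<xi> *\<^sub>R mat 1" (is ?t2)
proof -
  note ev = eventually_mono [OF eventually_nz [OF assms(2)]]
  show ?t1
    by (rule partial_xi_scal [OF ev S_xi(1) [OF assms]]) (rule sigma_0_PP [OF assms(1)])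
  show ?t2
    by (rule partial_xi_scal [OF ev S_xi(2) [OF assms]]) (rule sigma_0_PP [OF assms(1)])
qed

lemma partial_xi_xi_sigma_0:
  assumes "x \<in> adm" "\<xi> \<noteq> 0"
  shows "partial_xi 1 (partial_xi 1 (sigma a 0)) x \<xi> = S11 x \<xi> *\<^sub>R mat 1" (is ?t1)
    and "partial_xi 1 (partial_xi 2 (sigma a 0)) x \<xi> = S12 x \<xi> *\<^sub>R mat 1" (is ?t2)
    and "partial_xi 2 (partial_xi 2 (sigma a 0)) x \<xi> = S22 x \<xi> *\<^sub>R mat 1" (is ?t3)
proof -
  note ev = eventually_mono [OF eventually_nz [OF assms(2)]]
  show ?t1
    by (rule partial_xi_scal [OF ev S_xi(3) [OF assms]]) (rule partial_xi_sigma_0 [OF assms(1)])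
  show ?t2
    by (rule partial_xi_scal [OF ev S_xi(4) [OF assms]]) (rule partial_xi_sigma_0 [OF assms(1)])
  show ?t3
    by (rule partial_xi_scal [OF ev S_xi(5) [OF assms]]) (rule partial_xi_sigma_0 [OF assms(1)])
qed

end

lemma gam_sq: "gam1 ** gam1 = mat 1" "gam2 ** gam2 = mat 1"
  by (simp_all add: gam_defs matrix_matrix_mult_def vec_eq_iff sum_4 forall_4 mat_def)

lemma matrix_add_rdistrib: "(A + B) ** C = A ** C + B ** (C :: complex^'n^'n)"
  by (simp add: matrix_matrix_mult_def vec_eq_iff sum.distrib distrib_right)

lemma vector_4_eq_iff:
  "(vector [a, b, c, d] :: 'a::zero^4) = vector [a', b', c', d'] \<longleftrightarrow> a = a' \<and> b = b' \<and> c = c' \<and> d = d'"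
  by (simp add: vec_eq_iff forall_4)

lemma sum_multi_indices:
  "(\<Sum>\<beta>\<in>multi_indices 0. f \<beta>) = f (vector [0, 0, 0, 0])"
  "(\<Sum>\<beta>\<in>multi_indices 1. f \<beta>) = f (vector [1, 0, 0, 0]) + f (vector [0, 1, 0, 0])
     + f (vector [0, 0, 1, 0]) + f (vector [0, 0, 0, 1])"
  "(\<Sum>\<beta>\<in>multi_indices 2. f \<beta>) = f (vector [2, 0, 0, 0]) + f (vector [1, 1, 0, 0]) + f (vector [0, 2, 0, 0])
     + (f (vector [1, 0, 1, 0]) + f (vector [0, 1, 1, 0]) + f (vector [0, 0, 2, 0])
     + f (vector [1, 0, 0, 1]) + f (vector [0, 1, 0, 1]) + f (vector [0, 0, 1, 1]) + f (vector [0, 0, 0, 2]))"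
  unfolding multi_indices_0 multi_indices_1 multi_indices_2
  by (simp_all add: vector_4_eq_iff add_ac)

lemma sigma_term_vector:
  "sigma_term a j k (vector [n1, n2, n3, n4]) x \<xi> =
    cscale ((- \<i>) ^ (n1 + n2 + n3 + n4) / of_nat (fact n1 * fact n2 * fact n3 * fact n4))
     (multi_partial partial_xi (vector [n1, n2, n3, n4]) (sigma a j) x \<xi> **
      multi_partial partial_x (vector [n1, n2, n3, n4]) (p_symbol a k) x \<xi>)"
proof -
  have "(\<Sum>i\<in>UNIV. (vector [n1, n2, n3, n4] :: nat^4) $ i) = n1 + n2 + n3 + n4"
    by (simp add: sum_4)
  moreover have "(\<Prod>i\<in>UNIV. fact ((vector [n1, n2, n3, n4] :: nat^4) $ i) :: nat)
      = fact n1 * fact n2 * fact n3 * fact n4"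
    unfolding UNIV_4 by simp
  ultimately show ?thesis by (simp only: sigma_term_def)
qed

lemma multi_partial_vector:
  "multi_partial D (vector [0, 0, 0, 0]) s = s"
  "multi_partial D (vector [1, 0, 0, 0]) s = D 1 s"
  "multi_partial D (vector [0, 1, 0, 0]) s = D 2 s"
  "multi_partial D (vector [0, 0, 1, 0]) s = D 3 s"
  "multi_partial D (vector [0, 0, 0, 1]) s = D 4 s"
  "multi_partial D (vector [2, 0, 0, 0]) s = D 1 (D 1 s)"
  "multi_partial D (vector [1, 1, 0, 0]) s = D 1 (D 2 s)"
  "multi_partial D (vector [0, 2, 0, 0]) s = D 2 (D 2 s)"
  "multi_partial D (vector [1, 0, 1, 0]) s = D 1 (D 3 s)"
  "multi_partial D (vector [0, 1, 1, 0]) s = D 2 (D 3 s)"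
  "multi_partial D (vector [0, 0, 2, 0]) s = D 3 (D 3 s)"
  "multi_partial D (vector [1, 0, 0, 1]) s = D 1 (D 4 s)"
  "multi_partial D (vector [0, 1, 0, 1]) s = D 2 (D 4 s)"
  "multi_partial D (vector [0, 0, 1, 1]) s = D 3 (D 4 s)"
  "multi_partial D (vector [0, 0, 0, 2]) s = D 4 (D 4 s)"
  by (simp_all add: multi_partial_def numeral_2_eq_2)

lemma bas0_cscale: "bas0 = cscale (- \<i>) (mat 1)"
  by (simp add: bas0_def cscale_def mat_def vec_eq_iff forall_4)

lemma cscale_1: "cscale 1 M = M"
  by (simp add: cscale_def vec_eq_iff)

lemma trace_mat_1: "trace (mat 1 :: complex^4^4) = 4"
  by (simp add: trace_def mat_def)

section \<open>The symbols p_1, p_0, \<sigma>_{-3} and the trace of \<sigma>_{-4}\<close>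

context scale_factor
begin

lemma partial_x_q1:
  assumes "x \<in> adm"
  shows "partial_x 1 (q1 a) x \<xi> = (- (deriv a (x$1) / (a (x$1))\<^sup>2 * \<xi>$2)) *\<^sub>R gam2
      + (- (deriv a (x$1) / (a (x$1))\<^sup>2 * csc3 x \<xi>)) *\<^sub>R gam3
      + (- (deriv a (x$1) / (a (x$1))\<^sup>2 * sec4 x \<xi>)) *\<^sub>R gam4" (is ?t1)
    and "partial_x 2 (q1 a) x \<xi> = (- (cot (x$2) * csc3 x \<xi> / a (x$1))) *\<^sub>R gam3
      + (tan (x$2) * sec4 x \<xi> / a (x$1)) *\<^sub>R gam4" (is ?t2)
proof -
  note nz = admD [OF assms]
  have d: "((\<lambda>h. c / a (x$1 + h)) has_real_derivative - (deriv a (x$1) / (a (x$1))\<^sup>2 * c)) (at 0)" for c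
    by (rule DERIV_a [OF assms] derivative_eq_intros refl | use nz in \<open>simp add: power2_eq_square\<close>)+
  note S = has_vector_derivative_scaleR_const and A = has_vector_derivative_add and C = has_vector_derivative_const
  show ?t1
    using A [OF A [OF A [OF C S [OF d]] S [OF d]] S [OF d], of "\<xi>$1 *\<^sub>R gam1"]
    unfolding partial_x_def q1_gam csc3_def [symmetric] sec4_def [symmetric] csc3_line
    by (intro vector_derivative_at) simp
  show ?t2
    using A [OF A [OF C S [OF DERIV_cdivide [OF DERIV_csc3 [OF nz(2)]]]] S [OF DERIV_cdivide [OF DERIV_sec4 [OF nz(3)]]],
      of "\<xi>$1 *\<^sub>R gam1 + (\<xi>$2 / a (x$1)) *\<^sub>R gam2"]
    unfolding partial_x_def q1_gam csc3_def [symmetric] sec4_def [symmetric] csc3_line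
    by (intro vector_derivative_at) simp
qed

lemma partial_x_q0:
  assumes "x \<in> adm"
  shows "partial_x 1 (q0 a) x \<xi> = (- 3 / 2 * (deriv (deriv a) (x$1) / a (x$1) - (deriv a (x$1) / a (x$1))\<^sup>2)) *\<^sub>R cscale \<i> gam1
      + (- ((tan (x$2) - cot (x$2)) * deriv a (x$1) / (2 * (a (x$1))\<^sup>2))) *\<^sub>R cscale \<i> gam2" (is ?t1)
    and "partial_x 2 (q0 a) x \<xi> = ((2 + (tan (x$2))\<^sup>2 + (cot (x$2))\<^sup>2) / (2 * a (x$1))) *\<^sub>R cscale \<i> gam2" (is ?t2)
proof -
  note nz = admD [OF assms]
  have "((\<lambda>h. - 3 * deriv a (x$1 + h) / (2 * a (x$1 + h))) has_real_derivative
      - 3 / 2 * (deriv (deriv a) (x$1) / a (x$1) - (deriv a (x$1) / a (x$1))\<^sup>2)) (at 0)"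
    by (rule DERIV_a [OF assms] DERIV_a1 [OF assms] derivative_eq_intros refl
        | use nz in \<open>simp add: power2_eq_square field_simps\<close>)+
  moreover have "((\<lambda>h. (tan (x$2) - cot (x$2)) / (2 * a (x$1 + h))) has_real_derivative
      - ((tan (x$2) - cot (x$2)) * deriv a (x$1) / (2 * (a (x$1))\<^sup>2))) (at 0)"
    by (rule DERIV_a [OF assms] derivative_eq_intros refl
        | use nz in \<open>simp add: power2_eq_square field_simps\<close>)+
  ultimately show ?t1
    unfolding partial_x_def q0_gam
    by (intro vector_derivative_at has_vector_derivative_add has_vector_derivative_scaleR_const) auto
  have "((\<lambda>h. (tan (x$2 + h) - cot (x$2 + h)) / (2 * a (x$1))) has_real_derivative
      (2 + (tan (x$2))\<^sup>2 + (cot (x$2))\<^sup>2) / (2 * a (x$1))) (at 0)"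
    by (rule DERIV_cong [OF DERIV_cdivide [OF DERIV_diff [OF DERIV_tan_line [OF nz(3)] DERIV_cot_line [OF nz(2)]]]]) simp
  from has_vector_derivative_scaleR_const [OF this, of "cscale \<i> gam2"]
  have "((\<lambda>h. c + ((tan (x$2 + h) - cot (x$2 + h)) / (2 * a (x$1))) *\<^sub>R cscale \<i> gam2) has_vector_derivative
      0 + ((2 + (tan (x$2))\<^sup>2 + (cot (x$2))\<^sup>2) / (2 * a (x$1))) *\<^sub>R cscale \<i> gam2) (at 0)" for c
    by (intro has_vector_derivative_add has_vector_derivative_const)
  from this [of "(- 3 * deriv a (x$1) / (2 * a (x$1))) *\<^sub>R cscale \<i> gam1"] show ?t2
    unfolding partial_x_def q0_gam by (intro vector_derivative_at) simp
qed

text \<open>The coefficients of \<open>bas1\<close> to \<open>bas5\<close> in p_1. Numbering them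
  lets differentiability be proved for all five at once.\<close>

definition KK where
  "KK k x \<xi> = [deriv a (x$1) / (a (x$1))\<^sup>2 * \<xi>$2, deriv a (x$1) / (a (x$1))\<^sup>2 * csc3 x \<xi>,
     deriv a (x$1) / (a (x$1))\<^sup>2 * sec4 x \<xi>, cot (x$2) / (a (x$1))\<^sup>2 * csc3 x \<xi>,
     tan (x$2) / (a (x$1))\<^sup>2 * sec4 x \<xi>] ! k"

abbreviation p1_comb :: "real^4 \<Rightarrow> real^4 \<Rightarrow> complex^4^4" where
  "p1_comb x \<xi> \<equiv> lin6 (LL a x \<xi>) (KK 0 x \<xi>) (KK 1 x \<xi>) (KK 2 x \<xi>) (KK 3 x \<xi>) (KK 4 x \<xi>)"

abbreviation sigma_1_coeff :: "real^4 \<Rightarrow> real^4 \<Rightarrow> real" where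
  "sigma_1_coeff x \<xi> \<equiv> EE a x \<xi> / (PP a x \<xi>) ^ 3 - LL a x \<xi> / (PP a x \<xi>)\<^sup>2"

abbreviation sigma_1_comb :: "real^4 \<Rightarrow> real^4 \<Rightarrow> complex^4^4" where
  "sigma_1_comb x \<xi> \<equiv> lin6 (sigma_1_coeff x \<xi>) (- KK 0 x \<xi> / (PP a x \<xi>)\<^sup>2) (- KK 1 x \<xi> / (PP a x \<xi>)\<^sup>2)
     (- KK 2 x \<xi> / (PP a x \<xi>)\<^sup>2) (- KK 3 x \<xi> / (PP a x \<xi>)\<^sup>2) (- KK 4 x \<xi> / (PP a x \<xi>)\<^sup>2)"

lemma p1_lin6:
  assumes "x \<in> adm"
  shows "p_symbol a 1 x \<xi> = p1_comb x \<xi>"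
proof -
  note alg = p1_algebra [of "- 3 * deriv a (x$1) / (2 * a (x$1))" "(tan (x$2) - cot (x$2)) / (2 * a (x$1))"
    "\<xi>$1" "\<xi>$2 / a (x$1)" "csc3 x \<xi> / a (x$1)" "sec4 x \<xi> / a (x$1)"
    "KK 0 x \<xi>" "KK 1 x \<xi>" "KK 2 x \<xi>" "1 / a (x$1)" "cot (x$2) * csc3 x \<xi> / a (x$1)" "tan (x$2) * sec4 x \<xi> / a (x$1)"]
  have "p_symbol a 1 x \<xi> = q0 a x \<xi> ** q1 a x \<xi> + q1 a x \<xi> ** q0 a x \<xi>
     - cscale \<i> (gam1 ** partial_x 1 (q1 a) x \<xi> + ((1 / a (x$1)) *\<^sub>R gam2) ** partial_x 2 (q1 a) x \<xi>)"
    by (simp add: p_symbol_def sum_4 partial_xi_q1 partial_x_q_34)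
  also have "\<dots> = (-2 * (- 3 * deriv a (x$1) / (2 * a (x$1)) * \<xi>$1
       + (tan (x$2) - cot (x$2)) / (2 * a (x$1)) * (\<xi>$2 / a (x$1)))) *\<^sub>R bas0
     + KK 0 x \<xi> *\<^sub>R bas1 + KK 1 x \<xi> *\<^sub>R bas2 + KK 2 x \<xi> *\<^sub>R bas3
     + (1 / a (x$1) * (cot (x$2) * csc3 x \<xi> / a (x$1))) *\<^sub>R bas4
     + (1 / a (x$1) * (tan (x$2) * sec4 x \<xi> / a (x$1))) *\<^sub>R bas5"
    unfolding alg [symmetric] partial_x_q1 [OF assms] q1_gam [of a x \<xi>, folded csc3_def sec4_def] q0_gam
    by (simp add: KK_def)
  also have "\<dots> = p1_comb x \<xi>"
  proof -
    have "-2 * (- 3 * deriv a (x$1) / (2 * a (x$1)) * \<xi>$1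
       + (tan (x$2) - cot (x$2)) / (2 * a (x$1)) * (\<xi>$2 / a (x$1))) = LL a x \<xi>"
      using admD(4) [OF assms] by (simp add: LL_def power2_eq_square field_simps)
    moreover have "1 / a (x$1) * (cot (x$2) * csc3 x \<xi> / a (x$1)) = KK 3 x \<xi>"
      "1 / a (x$1) * (tan (x$2) * sec4 x \<xi> / a (x$1)) = KK 4 x \<xi>"
      by (simp_all add: KK_def power2_eq_square)
    ultimately show ?thesis
      unfolding lin6_def by simp
  qed
  finally show ?thesis .
qed

text \<open>\<open>gam1 ** gam2\<close> has trace zero, so only squares of the Clifford matrices
  survive. The factor i in q_0 gives the squares in q_0^2 a minus sign and cancels the -i in front
  of the derivative term.\<close>

lemma trace_p0:
  assumes "x \<in> adm"
  shows "trace (p_symbol a 0 x \<xi>) = of_real (4 * (- (9 / 4 * (deriv a (x$1) / a (x$1))\<^sup>2)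
     - (cot (x$2) - tan (x$2))\<^sup>2 / (4 * (a (x$1))\<^sup>2)
     + - 3 / 2 * (deriv (deriv a) (x$1) / a (x$1) - (deriv a (x$1) / a (x$1))\<^sup>2)
     + (2 + (tan (x$2))\<^sup>2 + (cot (x$2))\<^sup>2) / (2 * (a (x$1))\<^sup>2)))"
proof -
  have tr: "trace (gam1 ** gam2) = 0" "trace (gam2 ** gam1) = 0" "trace (mat 1 :: complex^4^4) = 4"
    by (simp_all add: trace_def gam_defs matrix_matrix_mult_def sum_4 mat_def)
  have 1: "trace ((w1 *\<^sub>R cscale \<i> gam1 + w2 *\<^sub>R cscale \<i> gam2) ** (w1 *\<^sub>R cscale \<i> gam1 + w2 *\<^sub>R cscale \<i> gam2)
     - cscale \<i> (gam1 ** (v1 *\<^sub>R cscale \<i> gam1 + v2 *\<^sub>R cscale \<i> gam2) + (c *\<^sub>R gam2) ** (v3 *\<^sub>R cscale \<i> gam2)))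
     = of_real (4 * (- w1\<^sup>2 - w2\<^sup>2 + v1 + c * v3))" for w1 w2 v1 v2 v3 c
    by (simp add: matrix_add_ldistrib matrix_add_rdistrib scaleR_matrix_mult cscale_matrix_mult cscale_simps
      trace_add trace_sub trace_scaleR trace_cscale gam_sq tr power2_eq_square algebra_simps)
  have "p_symbol a 0 x \<xi> = q0 a x \<xi> ** q0 a x \<xi> - cscale \<i> (gam1 ** partial_x 1 (q0 a) x \<xi>
     + ((1 / a (x$1)) *\<^sub>R gam2) ** partial_x 2 (q0 a) x \<xi>)"
    by (simp add: p_symbol_def sum_4 partial_xi_q1 partial_x_q_34)
  then have "trace (p_symbol a 0 x \<xi>) = of_real (4 * (- (- 3 * deriv a (x$1) / (2 * a (x$1)))\<^sup>2 - ((tan (x$2) - cot (x$2)) / (2 * a (x$1)))\<^sup>2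
     + - 3 / 2 * (deriv (deriv a) (x$1) / a (x$1) - (deriv a (x$1) / a (x$1))\<^sup>2)
     + 1 / a (x$1) * ((2 + (tan (x$2))\<^sup>2 + (cot (x$2))\<^sup>2) / (2 * a (x$1)))))"
    unfolding q0_gam partial_x_q0 [OF assms] by (simp only: 1)
  moreover have "(- 3 * deriv a (x$1) / (2 * a (x$1)))\<^sup>2 = 9 / 4 * (deriv a (x$1) / a (x$1))\<^sup>2"
    by (simp add: power_divide power_mult_distrib)
  moreover have "((tan (x$2) - cot (x$2)) / (2 * a (x$1)))\<^sup>2 = (cot (x$2) - tan (x$2))\<^sup>2 / (4 * (a (x$1))\<^sup>2)"
    by (simp add: power_divide power_mult_distrib power2_commute)
  moreover have "1 / a (x$1) * ((2 + (tan (x$2))\<^sup>2 + (cot (x$2))\<^sup>2) / (2 * a (x$1))) =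
      (2 + (tan (x$2))\<^sup>2 + (cot (x$2))\<^sup>2) / (2 * (a (x$1))\<^sup>2)"
    by (simp add: power2_eq_square)
  ultimately show ?thesis by (simp only:)
qed

definition LL1 where
  "LL1 x \<xi> = 3 * (deriv (deriv a) (x$1) / a (x$1) - (deriv a (x$1) / a (x$1))\<^sup>2) * \<xi>$1
     - 2 * deriv a (x$1) * (cot (x$2) - tan (x$2)) / (a (x$1)) ^ 3 * \<xi>$2"

definition LL2 where
  "LL2 x \<xi> = - (2 + (cot (x$2))\<^sup>2 + (tan (x$2))\<^sup>2) / (a (x$1))\<^sup>2 * \<xi>$2"

lemma LL_x:
  assumes "x \<in> adm"
  shows "((\<lambda>h. LL a (x + h *\<^sub>R axis 1 1) \<xi>) has_real_derivative LL1 x \<xi>) (at 0)" (is ?t1)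
    and "((\<lambda>h. LL a (x + h *\<^sub>R axis 2 1) \<xi>) has_real_derivative LL2 x \<xi>) (at 0)" (is ?t2)
proof -
  note a = DERIV_a [OF assms] DERIV_a1 [OF assms]
    and y = DERIV_cot_line [OF admD(2) [OF assms]] DERIV_tan_line [OF admD(3) [OF assms]]
    and nz = admD [OF assms]
  show ?t1
    unfolding LL_def LL1_def
    by simp (rule a derivative_eq_intros refl | use nz in \<open>simp add: field_simps eval_nat_numeral\<close>)+
  show ?t2
    unfolding LL_def LL2_def
    by simp (rule y derivative_eq_intros refl | use nz in \<open>simp add: field_simps eval_nat_numeral\<close>)+
qed

lemma KK_x_differentiable:
  assumes "x \<in> adm" "k < 5" "j = 1 \<or> j = 2"
  shows "(\<lambda>h. KK k (x + h *\<^sub>R axis j 1) \<xi>) differentiable (at 0)"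
proof -
  note nz = admD [OF assms(1)]
  have d: "(\<lambda>h. a (x$1 + h)) differentiable (at 0)" "(\<lambda>h. deriv a (x$1 + h)) differentiable (at 0)"
    "(\<lambda>h. cot (x$2 + h)) differentiable (at 0)" "(\<lambda>h. tan (x$2 + h)) differentiable (at 0)"
    "(\<lambda>h. csc3 (x + h *\<^sub>R axis 2 1) \<xi>) differentiable (at 0)" "(\<lambda>h. sec4 (x + h *\<^sub>R axis 2 1) \<xi>) differentiable (at 0)"
    using DERIV_a [OF assms(1)] DERIV_a1 [OF assms(1)] DERIV_cot_line [OF nz(2)] DERIV_tan_line [OF nz(3)]
      DERIV_csc3 [OF nz(2)] DERIV_sec4 [OF nz(3)]
    unfolding real_differentiable_def by blast+
  have "k = 0 \<or> k = 1 \<or> k = 2 \<or> k = 3 \<or> k = 4" using assms(2) by arith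
  then show ?thesis
    using assms(3) nz by (auto simp: KK_def csc3_line
      intro!: d differentiable_mult differentiable_divide differentiable_power differentiable_const)
qed

text \<open>The trace suffices because these derivatives are multiplied by \<xi>-derivatives of
  \<sigma>_{-2}, which are scalar.\<close>

lemma trace_partial_x_p1:
  assumes "x \<in> adm"
  shows "trace (partial_x 1 (p_symbol a 1) x \<xi>) = - 4 * \<i> * of_real (LL1 x \<xi>)" (is ?t1)
    and "trace (partial_x 2 (p_symbol a 1) x \<xi>) = - 4 * \<i> * of_real (LL2 x \<xi>)" (is ?t2)
proof -
  note k = KK_x_differentiable [OF assms]
  have t: "trace (partial_x j (p_symbol a 1) x \<xi>) = - 4 * \<i> * of_real d"
    if j: "j = 1 \<or> j = 2" and d: "((\<lambda>h. LL a (x + h *\<^sub>R axis j 1) \<xi>) has_real_derivative d) (at 0)" for j d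
  proof (rule lin6_deriv [OF d k [OF _ j] k [OF _ j] k [OF _ j] k [OF _ j] k [OF _ j]])
    fix D assume D: "trace D = - 4 * \<i> * of_real d"
      "((\<lambda>h. p1_comb (x + h *\<^sub>R axis j 1) \<xi>) has_vector_derivative D) (at 0)"
    have "partial_x j (p_symbol a 1) x \<xi> = D"
      by (rule partial_xI [OF eventually_mono [OF eventually_adm [OF assms]] D(2)]) (rule p1_lin6)
    with D show ?thesis by simp
  qed simp_all
  show ?t1 ?t2
    by (intro t LL_x assms; simp)+
qed

lemma partial_x_p1_34:
  assumes "x \<in> adm"
  shows "partial_x 3 (p_symbol a 1) x \<xi> = 0" "partial_x 4 (p_symbol a 1) x \<xi> = 0"
proof -
  have "x + h *\<^sub>R axis 3 1 \<in> adm" "x + h *\<^sub>R axis 4 1 \<in> adm" for h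
    using assms by (auto simp: adm_def)
  then show "partial_x 3 (p_symbol a 1) x \<xi> = 0" "partial_x 4 (p_symbol a 1) x \<xi> = 0"
    by (auto intro!: partial_x_const simp: p1_lin6 assms LL_def KK_def csc3_line simp del: One_nat_def)
qed

text \<open>The terms with |\<beta>| = 1 are -i times a real multiple of the identity, hence
  multiples of \<open>bas0\<close>. They produce the summand with \<open>EE\<close>, while the other
  five coefficients are those of p_1 divided by - p_2^2.\<close>

lemma sigma_1_lin6:
  assumes "x \<in> adm" "\<xi> \<noteq> 0"
  shows "sigma a 1 x \<xi> = sigma_1_comb x \<xi>"
proof -
  have P: "PP a x \<xi> \<noteq> 0" using PP_pos [OF assms] by simp
  have "sigma a 1 x \<xi> = (- 1 / PP a x \<xi>) *\<^sub>R ((1 / PP a x \<xi>) *\<^sub>R p_symbol a 1 x \<xi>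
     + (S1 x \<xi> * YY1 a x \<xi>) *\<^sub>R bas0 + (S2 x \<xi> * YY2 a x \<xi>) *\<^sub>R bas0)"
    unfolding sigma_1 sum_multi_indices sigma_term_vector multi_partial_vector matrix_inv_PP [OF assms]
    by (simp add: sigma_0_PP assms partial_x_p2 partial_x_p2_34 partial_xi_sigma_0 scaleR_matrix_mult
      cscale_simps bas0_cscale cscale_1 algebra_simps del: One_nat_def)
  also have "\<dots> = sigma_1_comb x \<xi>"
  proof -
    have "sigma_1_coeff x \<xi> =
      - 1 / PP a x \<xi> * (1 / PP a x \<xi> * LL a x \<xi>) + (- 1 / PP a x \<xi> * (S1 x \<xi> * YY1 a x \<xi>)
       + - 1 / PP a x \<xi> * (S2 x \<xi> * YY2 a x \<xi>))"
      using P admD(4) [OF assms(1)] by (simp add: S1_def S2_def EE_def field_simps eval_nat_numeral)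
    moreover have "- KK k x \<xi> / (PP a x \<xi>)\<^sup>2 = - 1 / PP a x \<xi> * (1 / PP a x \<xi> * KK k x \<xi>)" for k
      by (simp add: power2_eq_square)
    ultimately show ?thesis
      unfolding p1_lin6 [OF assms(1)] lin6_def
      by (simp only: scaleR_add_right scaleR_add_left scaleR_scaleR add_ac)
  qed
  finally show ?thesis .
qed

definition d1 where
  "d1 x \<xi> = 2 * YY1 a x \<xi> / (PP a x \<xi>) ^ 3 - 6 * \<xi>$1 * EE a x \<xi> / (PP a x \<xi>) ^ 4
     - 3 * deriv a (x$1) / a (x$1) / (PP a x \<xi>)\<^sup>2 + 4 * \<xi>$1 * LL a x \<xi> / (PP a x \<xi>) ^ 3"

definition d2 where
  "d2 x \<xi> = (2 / (a (x$1))\<^sup>2 * YY2 a x \<xi> - 8 * \<xi>$1 * deriv a (x$1) * \<xi>$2 / (a (x$1)) ^ 3) / (PP a x \<xi>) ^ 3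
     - 6 * \<xi>$2 / (a (x$1))\<^sup>2 * EE a x \<xi> / (PP a x \<xi>) ^ 4
     - (cot (x$2) - tan (x$2)) / (a (x$1))\<^sup>2 / (PP a x \<xi>)\<^sup>2 + 4 * \<xi>$2 / (a (x$1))\<^sup>2 * LL a x \<xi> / (PP a x \<xi>) ^ 3"

lemma d_xi:
  assumes "x \<in> adm" "\<xi> \<noteq> 0"
  shows "((\<lambda>h. sigma_1_coeff x (\<xi> + h *\<^sub>R axis 1 1)) has_real_derivative d1 x \<xi>) (at 0)" (is ?t1)
    and "((\<lambda>h. sigma_1_coeff x (\<xi> + h *\<^sub>R axis 2 1)) has_real_derivative d2 x \<xi>) (at 0)" (is ?t2)
proof -
  have P: "PP a x \<xi> \<noteq> 0" using PP_pos [OF assms] by simp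
  note nz = admD [OF assms(1)] P
  have quot: "((\<lambda>h. E h / (Q h) ^ 3 - L h / (Q h)\<^sup>2) has_real_derivative
      E' / (Q 0) ^ 3 - 3 * Q' * E 0 / (Q 0) ^ 4 - L' / (Q 0)\<^sup>2 + 2 * Q' * L 0 / (Q 0) ^ 3) (at 0)"
    if "(E has_real_derivative E') (at 0)" "(Q has_real_derivative Q') (at 0)" "(L has_real_derivative L') (at 0)"
      "Q 0 \<noteq> 0" for E Q L :: "real \<Rightarrow> real" and E' Q' L'
    by (rule that(1-3) derivative_eq_intros refl | use that(4) in \<open>simp add: field_simps eval_nat_numeral\<close>)+
  have E1: "((\<lambda>h. EE a x (\<xi> + h *\<^sub>R axis 1 1)) has_real_derivative 2 * YY1 a x \<xi>) (at 0)"
    unfolding EE_def YY1_def YY2_def csc3_line using nz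
    by simp (rule derivative_eq_intros refl | simp add: field_simps eval_nat_numeral)+
  have L1: "((\<lambda>h. LL a x (\<xi> + h *\<^sub>R axis 1 1)) has_real_derivative 3 * deriv a (x$1) / a (x$1)) (at 0)"
    unfolding LL_def by (rule derivative_eq_intros refl | simp)+
  show ?t1
    by (intro DERIV_cong [OF quot [OF E1 PP_xi(1) [OF assms(1)] L1]]) (use P in \<open>simp_all add: d1_def\<close>)
  have E2: "((\<lambda>h. EE a x (\<xi> + h *\<^sub>R axis 2 1)) has_real_derivative
      2 / (a (x$1))\<^sup>2 * YY2 a x \<xi> - 8 * \<xi>$1 * deriv a (x$1) * \<xi>$2 / (a (x$1)) ^ 3) (at 0)"
    unfolding EE_def YY1_def YY2_def csc3_line using nz
    by simp (rule derivative_eq_intros refl | simp add: field_simps eval_nat_numeral)+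
  have L2: "((\<lambda>h. LL a x (\<xi> + h *\<^sub>R axis 2 1)) has_real_derivative (cot (x$2) - tan (x$2)) / (a (x$1))\<^sup>2) (at 0)"
    unfolding LL_def by (rule derivative_eq_intros refl | simp)+
  show ?t2
    by (intro DERIV_cong [OF quot [OF E2 PP_xi(2) [OF assms(1)] L2]]) (use P in \<open>simp_all add: d2_def\<close>)
qed

lemma trace_partial_xi_sigma_1:
  assumes "x \<in> adm" "\<xi> \<noteq> 0"
  shows "trace (partial_xi 1 (sigma a 1) x \<xi>) = - 4 * \<i> * of_real (d1 x \<xi>)" (is ?t1)
    and "trace (partial_xi 2 (sigma a 1) x \<xi>) = - 4 * \<i> * of_real (d2 x \<xi>)" (is ?t2)
proof -
  have k: "(\<lambda>h. - KK k x (\<xi> + h *\<^sub>R axis j 1) / (PP a x (\<xi> + h *\<^sub>R axis j 1))\<^sup>2) differentiable (at 0)"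
    if "j = 1 \<or> j = 2" "k < 5" for j k
  proof -
    have "(\<lambda>h. PP a x (\<xi> + h *\<^sub>R axis j 1)) differentiable (at 0)"
      using PP_xi [OF assms(1)] that(1) unfolding real_differentiable_def by blast
    moreover have "k = 0 \<or> k = 1 \<or> k = 2 \<or> k = 3 \<or> k = 4" using that by arith
    ultimately show ?thesis
      using that(1) PP_pos [OF assms] admD(4) [OF assms(1)] by (auto simp: KK_def csc3_line intro!: differentiable_minus differentiable_add differentiable_ident
        differentiable_mult differentiable_divide differentiable_power differentiable_const)
  qed
  have t: "trace (partial_xi j (sigma a 1) x \<xi>) = - 4 * \<i> * of_real d"
    if j: "j = 1 \<or> j = 2" and d: "((\<lambda>h. sigma_1_coeff x (\<xi> + h *\<^sub>R axis j 1)) has_real_derivative d) (at 0)" for j d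
  proof (rule lin6_deriv [OF d k [OF j] k [OF j] k [OF j] k [OF j] k [OF j]])
    fix D assume D: "trace D = - 4 * \<i> * of_real d"
      "((\<lambda>h. sigma_1_comb x (\<xi> + h *\<^sub>R axis j 1)) has_vector_derivative D) (at 0)"
    have "partial_xi j (sigma a 1) x \<xi> = D"
      by (rule partial_xiI [OF eventually_mono [OF eventually_nz [OF assms(2)]] D(2)]) (rule sigma_1_lin6 [OF assms(1)])
    with D show ?thesis by simp
  qed simp_all
  show ?t1 ?t2
    by (intro t d_xi assms; simp)+
qed

definition pp0 where
  "pp0 x = - (9 / 4 * (deriv a (x$1) / a (x$1))\<^sup>2)
     - (cot (x$2) - tan (x$2))\<^sup>2 / (4 * (a (x$1))\<^sup>2)
     + - 3 / 2 * (deriv (deriv a) (x$1) / a (x$1) - (deriv a (x$1) / a (x$1))\<^sup>2)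
     + (2 + (tan (x$2))\<^sup>2 + (cot (x$2))\<^sup>2) / (2 * (a (x$1))\<^sup>2)"

text \<open>The one product of two nonscalar factors is \<sigma>_{-3} p_1, which trace orthogonality
  evaluates as a sum of products of coefficients. In all other terms a scalar factor can be pulled
  out of the trace.\<close>

lemma trace_sigma_2_raw:
  assumes "x \<in> adm" "\<xi> \<noteq> 0"
  shows "trace (sigma a 2 x \<xi>) = of_real (- 4 / PP a x \<xi> * (pp0 x / PP a x \<xi>
     - S1 x \<xi> * LL1 x \<xi> - S2 x \<xi> * LL2 x \<xi>
     - (S11 x \<xi> * ZZ11 x \<xi> / 2 + S12 x \<xi> * ZZ12 x \<xi> + S22 x \<xi> * ZZ22 x \<xi> / 2)
     + ((LL a x \<xi>)\<^sup>2 / (PP a x \<xi>)\<^sup>2 - EE a x \<xi> * LL a x \<xi> / (PP a x \<xi>) ^ 3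
        - ((KK 0 x \<xi>)\<^sup>2 + (KK 1 x \<xi>)\<^sup>2 + (KK 2 x \<xi>)\<^sup>2 + (KK 3 x \<xi>)\<^sup>2 + (KK 4 x \<xi>)\<^sup>2) / (PP a x \<xi>)\<^sup>2)
     - YY1 a x \<xi> * d1 x \<xi> - YY2 a x \<xi> * d2 x \<xi>))"
proof -
  have t1: "trace (sigma a 1 x \<xi> ** p_symbol a 1 x \<xi>) =
    of_real (4 * (- (sigma_1_coeff x \<xi>) * LL a x \<xi>
      + - KK 0 x \<xi> / (PP a x \<xi>)\<^sup>2 * KK 0 x \<xi> + - KK 1 x \<xi> / (PP a x \<xi>)\<^sup>2 * KK 1 x \<xi>
      + - KK 2 x \<xi> / (PP a x \<xi>)\<^sup>2 * KK 2 x \<xi> + - KK 3 x \<xi> / (PP a x \<xi>)\<^sup>2 * KK 3 x \<xi>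
      + - KK 4 x \<xi> / (PP a x \<xi>)\<^sup>2 * KK 4 x \<xi>))"
    unfolding sigma_1_lin6 [OF assms] p1_lin6 [OF assms(1)] lin6_def by (rule trace_sq)
  have T0: "trace (sigma a 2 x \<xi>) = - (1 / of_real (PP a x \<xi>)) * (
       trace (\<Sum>\<beta>\<in>multi_indices 0. sigma_term a 0 0 \<beta> x \<xi>)
     + trace (\<Sum>\<beta>\<in>multi_indices 1. sigma_term a 0 1 \<beta> x \<xi>)
     + trace (\<Sum>\<beta>\<in>multi_indices 2. sigma_term a 0 2 \<beta> x \<xi>)
     + trace (\<Sum>\<beta>\<in>multi_indices 0. sigma_term a 1 1 \<beta> x \<xi>)
     + trace (\<Sum>\<beta>\<in>multi_indices 1. sigma_term a 1 2 \<beta> x \<xi>))"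
    unfolding sigma_2 matrix_inv_PP [OF assms] scaleR_matrix_mult matrix_mul_rid trace_scaleR trace_uminus trace_add
    by (simp only: of_real_divide of_real_1 mult_minus_right mult_minus_left)
  note simps = sigma_0_PP [OF assms] partial_x_p2 [OF assms(1)] partial_x_p2_34 partial_x_p1_34 [OF assms(1)]
    partial_xi_sigma_0 [OF assms] scaleR_matrix_mult partial_x_x_p2 [OF assms(1)] partial_xi_xi_sigma_0 [OF assms]
    partial_x_0 trace_add trace_sub trace_uminus trace_scaleR trace_cscale cscale_simps cscale_1 trace_mat_1
    trace_p0 [OF assms(1)] trace_partial_x_p1 [OF assms(1)] trace_partial_xi_sigma_1 [OF assms]
  have T1: "trace (\<Sum>\<beta>\<in>multi_indices 0. sigma_term a 0 0 \<beta> x \<xi>) = of_real (4 * pp0 x / PP a x \<xi>)"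
    unfolding sum_multi_indices sigma_term_vector multi_partial_vector pp0_def by (simp add: simps del: One_nat_def)
  \<comment> \<open>Both -i from the recursion and -4i from the trace of \<open>bas0\<close> enter
    here; their product -4 makes the result real.\<close>
  have T2: "trace (\<Sum>\<beta>\<in>multi_indices 1. sigma_term a 0 1 \<beta> x \<xi>) =
      of_real (- 4 * S1 x \<xi> * LL1 x \<xi> - 4 * S2 x \<xi> * LL2 x \<xi>)"
    unfolding sum_multi_indices sigma_term_vector multi_partial_vector
    by (simp add: simps del: One_nat_def) (simp add: complex_eq_iff)
  \<comment> \<open>The factor is (-i)^2 4 / \<beta>!, that is -2 for a repeated index and -4 for
    the mixed one.\<close>
  have T3: "trace (\<Sum>\<beta>\<in>multi_indices 2. sigma_term a 0 2 \<beta> x \<xi>) =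
      of_real (- 2 * S11 x \<xi> * ZZ11 x \<xi> - 4 * S12 x \<xi> * ZZ12 x \<xi> - 2 * S22 x \<xi> * ZZ22 x \<xi>)"
    unfolding sum_multi_indices sigma_term_vector multi_partial_vector
    by (simp add: simps del: One_nat_def)
  have T4: "trace (\<Sum>\<beta>\<in>multi_indices 0. sigma_term a 1 1 \<beta> x \<xi>) =
     of_real (4 * ((LL a x \<xi>)\<^sup>2 / (PP a x \<xi>)\<^sup>2 - EE a x \<xi> * LL a x \<xi> / (PP a x \<xi>) ^ 3
        - ((KK 0 x \<xi>)\<^sup>2 + (KK 1 x \<xi>)\<^sup>2 + (KK 2 x \<xi>)\<^sup>2 + (KK 3 x \<xi>)\<^sup>2 + (KK 4 x \<xi>)\<^sup>2) / (PP a x \<xi>)\<^sup>2))"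
    unfolding sum_multi_indices sigma_term_vector multi_partial_vector
    by (simp add: cscale_1 t1 del: One_nat_def of_real_mult of_real_add of_real_diff of_real_divide of_real_minus)
       (simp add: power2_eq_square add_divide_distrib algebra_simps)
  have T5: "trace (\<Sum>\<beta>\<in>multi_indices 1. sigma_term a 1 2 \<beta> x \<xi>) =
      of_real (- 4 * YY1 a x \<xi> * d1 x \<xi> - 4 * YY2 a x \<xi> * d2 x \<xi>)"
    unfolding sum_multi_indices sigma_term_vector multi_partial_vector
    by (simp add: simps del: One_nat_def) (simp add: complex_eq_iff)
  have real: "- (1 / p) * (4 * u1 / p + (- 4 * u2 * u3 - 4 * u4 * u5)
     + (- 2 * u6 * u7 - 4 * u8 * u9 - 2 * v1 * v2) + 4 * v3 + (- 4 * v4 * v5 - 4 * v6 * v7)) =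
     - 4 / p * (u1 / p - u2 * u3 - u4 * u5 - (u6 * u7 / 2 + u8 * u9 + v1 * v2 / 2) + v3 - v4 * v5 - v6 * v7)"
    for p u1 u2 u3 u4 u5 u6 u7 u8 u9 v1 v2 v3 v4 v5 v6 v7 :: real
  proof -
    have "4 * u1 / p + (- 4 * u2 * u3 - 4 * u4 * u5)
     + (- 2 * u6 * u7 - 4 * u8 * u9 - 2 * v1 * v2) + 4 * v3 + (- 4 * v4 * v5 - 4 * v6 * v7)
     = 4 * (u1 / p - u2 * u3 - u4 * u5 - (u6 * u7 / 2 + u8 * u9 + v1 * v2 / 2) + v3 - v4 * v5 - v6 * v7)"
      by simp
    then show ?thesis by simp
  qed
  have complex: "- (1 / of_real p) * (of_real r1 + of_real r2 + of_real r3 + of_real r4 + of_real r5) =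
     complex_of_real (- (1 / p) * (r1 + r2 + r3 + r4 + r5))" for p r1 r2 r3 r4 r5
    by simp
  show ?thesis
    unfolding T0 T1 T2 T3 T4 T5 complex real ..
qed

end

text \<open>In the polynomials below \<open>b\<close> stands for \<open>1 / a\<close>, \<open>r\<close> for \<open>1 / p\<^sub>2\<close>, \<open>g1, g2\<close> for the derivatives of \<open>a\<close>, \<open>d\<close> for
\<open>cot \<eta> - tan \<eta>\<close>, \<open>y\<close> for the \<open>\<eta>\<close>-derivative of \<open>p\<^sub>2\<close>, \<open>k, t\<close> for \<open>cot\<^sup>2 \<eta>, tan\<^sup>2 \<eta>\<close>, and \<open>x3, x4\<close> for
\<open>csc \<eta> \<xi>\<^sub>3, sec \<eta> \<xi>\<^sub>4\<close>. Then \<open>full_poly\<close> is \<open>tr \<sigma>\<^sub>-\<^sub>4\<close> and \<open>dens_poly\<close> its even part.\<close>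

definition cot_part :: "real \<Rightarrow> real \<Rightarrow> real \<Rightarrow> real \<Rightarrow> real" where
  "cot_part b r x2 x3 = - 4 * b\<^sup>2 * r * (r / 4 - r\<^sup>2 * b\<^sup>2 * x2\<^sup>2 + 3 * r\<^sup>2 * b\<^sup>2 * x3\<^sup>2
     - 12 * r ^ 3 * b ^ 4 * x2\<^sup>2 * x3\<^sup>2 - 8 * r ^ 3 * b ^ 4 * x3 ^ 4 + 48 * r ^ 4 * b ^ 6 * x2\<^sup>2 * x3 ^ 4)"

definition main_part ::
  "real \<Rightarrow> real \<Rightarrow> real \<Rightarrow> real \<Rightarrow> real \<Rightarrow> real \<Rightarrow> real \<Rightarrow> real \<Rightarrow> real" where
  "main_part b r g1 g2 x1 x2 x3 x4 = (let w = b\<^sup>2 * (x2\<^sup>2 + x3\<^sup>2 + x4\<^sup>2); h = g1 * b in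
     - 4 * r * (r * (- 3 / 4 * h\<^sup>2 - 3 / 2 * g2 * b) + 6 * r\<^sup>2 * x1\<^sup>2 * (g2 * b - h\<^sup>2)
       - (4 * r ^ 3 * x1\<^sup>2 - r\<^sup>2) * w * (6 * h\<^sup>2 - 2 * g2 * b) + 9 * r\<^sup>2 * h\<^sup>2 * x1\<^sup>2
       - 7 * r\<^sup>2 * h\<^sup>2 * w + 36 * r ^ 3 * h\<^sup>2 * w * x1\<^sup>2 + 48 * r ^ 4 * h\<^sup>2 * x1\<^sup>2 * w\<^sup>2 - 8 * r ^ 3 * h\<^sup>2 * w\<^sup>2)
     - 4 * b\<^sup>2 * r * (3 / 2 * r - 6 * r\<^sup>2 * b\<^sup>2 * x2\<^sup>2 + 4 * r\<^sup>2 * b\<^sup>2 * (x3\<^sup>2 + x4\<^sup>2)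
       - 20 * r ^ 3 * b ^ 4 * x2\<^sup>2 * (x3\<^sup>2 + x4\<^sup>2) - 8 * (12 * r ^ 4 * b\<^sup>2 * x2\<^sup>2 - 2 * r ^ 3) * b ^ 4 * x3\<^sup>2 * x4\<^sup>2))"

definition dens_poly ::
  "real \<Rightarrow> real \<Rightarrow> real \<Rightarrow> real \<Rightarrow> real \<Rightarrow> real \<Rightarrow> real \<Rightarrow> real \<Rightarrow> real \<Rightarrow> real \<Rightarrow> real" where
  "dens_poly b r g1 g2 k t x1 x2 x3 x4 =
     main_part b r g1 g2 x1 x2 x3 x4 + k * cot_part b r x2 x3 + t * cot_part b r x2 x4"

definition full_poly ::
  "real \<Rightarrow> real \<Rightarrow> real \<Rightarrow> real \<Rightarrow> real \<Rightarrow> real \<Rightarrow> real \<Rightarrow> real \<Rightarrow> real \<Rightarrow> real \<Rightarrow> real \<Rightarrow> real \<Rightarrow> real" where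
  "full_poly b r g1 g2 d y k t x1 x2 x3 x4 = (
    let w = x2\<^sup>2 + x3\<^sup>2 + x4\<^sup>2;
      y1 = - 2 * g1 * w * b ^ 3;
      l = 3 * g1 * b * x1 + d * b\<^sup>2 * x2;
      e = 2 * x1 * y1 + 2 * x2 * b\<^sup>2 * y
    in - 4 * r * ((- (9 / 4 * (g1 * b)\<^sup>2) - d\<^sup>2 * b\<^sup>2 / 4 + - 3 / 2 * (g2 * b - (g1 * b)\<^sup>2) + (2 + t + k) * b\<^sup>2 / 2) * r
     - (- (2 * x1) * r\<^sup>2) * (3 * (g2 * b - (g1 * b)\<^sup>2) * x1 - 2 * g1 * d * b ^ 3 * x2)
     - (- (2 * x2 * b\<^sup>2) * r\<^sup>2) * (- (2 + k + t) * b\<^sup>2 * x2)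
     - ((8 * x1\<^sup>2 * r ^ 3 - 2 * r\<^sup>2) * (w * (6 * g1\<^sup>2 * b ^ 4 - 2 * g2 * b ^ 3)) / 2
        + 8 * x1 * x2 * b\<^sup>2 * r ^ 3 * (- 2 * g1 * b * y)
        + (8 * x2\<^sup>2 * b ^ 4 * r ^ 3 - 2 * b\<^sup>2 * r\<^sup>2) * (((2 + 6 * k) * x3\<^sup>2 + (2 + 6 * t) * x4\<^sup>2) * b\<^sup>2) / 2)
     + (l\<^sup>2 * r\<^sup>2 - e * l * r ^ 3 - (g1\<^sup>2 * b ^ 4 * w + b ^ 4 * (k * x3\<^sup>2 + t * x4\<^sup>2)) * r\<^sup>2)
     - y1 * (2 * y1 * r ^ 3 - 6 * x1 * e * r ^ 4 - 3 * g1 * b * r\<^sup>2 + 4 * x1 * l * r ^ 3)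
     - y * ((2 * b\<^sup>2 * y - 8 * x1 * g1 * x2 * b ^ 3) * r ^ 3 - 6 * x2 * b\<^sup>2 * e * r ^ 4 - d * b\<^sup>2 * r\<^sup>2
         + 4 * x2 * b\<^sup>2 * l * r ^ 3)))"

text \<open>The difference of the two sides is an explicit combination of the three assumed
  relations. The relations concern only \<open>d\<^sup>2\<close>, \<open>d * y\<close> and
  \<open>y\<^sup>2\<close>, because terms with a lone \<open>d\<close> or \<open>y\<close> contain
  \<open>x1\<close> to an odd power and cancel in the sum. The result is even in every variable, so
  the reflection in \<open>x1\<close> already removes all odd terms.\<close>

lemma full_poly_even:
  assumes "d\<^sup>2 = k + t - 2"
    and "d * y = 2 * b\<^sup>2 * ((1 - k) * x3\<^sup>2 + (1 - t) * x4\<^sup>2)"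
    and "y\<^sup>2 = 4 * b ^ 4 * (k * x3 ^ 4 - 2 * x3\<^sup>2 * x4\<^sup>2 + t * x4 ^ 4)"
  shows "full_poly b r g1 g2 d y k t x1 x2 x3 x4 + full_poly b r g1 g2 d y k t (- x1) x2 x3 x4
     = 2 * dens_poly b r g1 g2 k t x1 x2 x3 x4"
proof -
  have "full_poly b r g1 g2 d y k t x1 x2 x3 x4 + full_poly b r g1 g2 d y k t (- x1) x2 x3 x4
     - 2 * dens_poly b r g1 g2 k t x1 x2 x3 x4
    = - 8 * r * ((- r * b\<^sup>2 / 4 + b ^ 4 * x2\<^sup>2 * r\<^sup>2) * (d\<^sup>2 - (k + t - 2))
      + (- 6 * x2\<^sup>2 * b ^ 4 * r ^ 3 + b\<^sup>2 * r\<^sup>2) * (d * y - 2 * b\<^sup>2 * ((1 - k) * x3\<^sup>2 + (1 - t) * x4\<^sup>2))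
      + (12 * x2\<^sup>2 * b ^ 4 * r ^ 4 - 2 * b\<^sup>2 * r ^ 3) * (y\<^sup>2 - 4 * b ^ 4 * (k * x3 ^ 4 - 2 * x3\<^sup>2 * x4\<^sup>2 + t * x4 ^ 4)))"
    unfolding full_poly_def dens_poly_def main_part_def cot_part_def Let_def
    by algebra
  then show ?thesis using assms by simp
qed

lemma full_poly_flip:
  "full_poly b r g1 g2 d y k t x1 x2 (- x3) x4 = full_poly b r g1 g2 d y k t x1 x2 x3 x4"
  "full_poly b r g1 g2 d y k t x1 x2 x3 (- x4) = full_poly b r g1 g2 d y k t x1 x2 x3 x4"
  "dens_poly b r g1 g2 k t (- x1) x2 x3 x4 = dens_poly b r g1 g2 k t x1 x2 x3 x4"
  "dens_poly b r g1 g2 k t x1 (- x2) x3 x4 = dens_poly b r g1 g2 k t x1 x2 x3 x4"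
  "dens_poly b r g1 g2 k t x1 x2 (- x3) x4 = dens_poly b r g1 g2 k t x1 x2 x3 x4"
  "dens_poly b r g1 g2 k t x1 x2 x3 (- x4) = dens_poly b r g1 g2 k t x1 x2 x3 x4"
  by (simp_all add: full_poly_def dens_poly_def main_part_def cot_part_def Let_def)

section \<open>The even part of the trace and its dependence on the 2-jet\<close>

context scale_factor
begin

lemma trace_sigma_2:
  assumes "x \<in> adm" "\<xi> \<noteq> 0"
  shows "trace (sigma a 2 x \<xi>) = of_real (full_poly (1 / a (x$1)) (1 / PP a x \<xi>) (deriv a (x$1)) (deriv (deriv a) (x$1))
    (cot (x$2) - tan (x$2)) (YY2 a x \<xi>) ((cot (x$2))\<^sup>2) ((tan (x$2))\<^sup>2) (\<xi>$1) (\<xi>$2) (csc3 x \<xi>) (sec4 x \<xi>))"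
  unfolding trace_sigma_2_raw [OF assms] full_poly_def Let_def
  unfolding KK_def S1_def S2_def S11_def S12_def S22_def ZZ11_def ZZ12_def ZZ22_def LL1_def LL2_def d1_def d2_def pp0_def
  unfolding EE_def LL_def YY1_def
  by (rule arg_cong [where f = of_real]) (simp add: power_divide power_mult_distrib add_divide_distrib distrib_left)

end

text \<open>The numbers \<open>g0\<close>, \<open>g1\<close>, \<open>g2\<close> stand for a(t),
  a'(t), a''(t). As a itself does not appear, expressing \<open>b4\<close> by \<open>dens\<close>
  shows that it depends on the 2-jet alone.\<close>

definition dens :: "real \<Rightarrow> real \<Rightarrow> real \<Rightarrow> real \<Rightarrow> real^4 \<Rightarrow> real" where
  "dens g0 g1 g2 \<eta> \<xi> = (let x3 = \<xi>$3 / sin \<eta>; x4 = \<xi>$4 / cos \<eta> in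
     dens_poly (1 / g0) (1 / ((\<xi>$1)\<^sup>2 + ((\<xi>$2)\<^sup>2 + x3\<^sup>2 + x4\<^sup>2) / g0\<^sup>2)) g1 g2
       ((cot \<eta>)\<^sup>2) ((tan \<eta>)\<^sup>2) (\<xi>$1) (\<xi>$2) x3 x4)"

definition flip1 :: "real^4 \<Rightarrow> real^4" where "flip1 \<xi> = (\<chi> j. if j = 1 then - \<xi>$j else \<xi>$j)"

context scale_factor
begin

lemma trace_sigma_2_flip1:
  assumes "x \<in> adm" "\<xi> \<noteq> 0"
  shows "trace (sigma a 2 x \<xi>) + trace (sigma a 2 x (flip1 \<xi>)) =
    of_real (2 * dens (a (x$1)) (deriv a (x$1)) (deriv (deriv a) (x$1)) (x$2) \<xi>)"
proof -
  have nz: "flip1 \<xi> \<noteq> 0" using assms(2) by (auto simp: flip1_def vec_eq_iff forall_4)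
  have fl: "flip1 \<xi> $ 1 = - \<xi>$1" "flip1 \<xi> $ 2 = \<xi>$2" "csc3 x (flip1 \<xi>) = csc3 x \<xi>" "sec4 x (flip1 \<xi>) = sec4 x \<xi>"
    "PP a x (flip1 \<xi>) = PP a x \<xi>" "YY2 a x (flip1 \<xi>) = YY2 a x \<xi>"
    by (simp_all add: flip1_def csc3_def sec4_def PP_def YY2_def)
  \<comment> \<open>This relation is the source of all three hypotheses of
    \<open>full_poly_even\<close>: it turns the mixed terms of cot - tan and of \<open>YY2\<close>
    into constants.\<close>
  have ct: "cot (x$2) * tan (x$2) = 1"
    using admD [OF assms(1)] by (simp add: cot_def tan_def)
  have ctw: "cot (x$2) * (tan (x$2) * w) = w" for w
    using ct by (simp flip: mult.assoc)
  have tcw: "tan (x$2) * cot (x$2) = 1" "tan (x$2) * (cot (x$2) * w) = w" for w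
    using ct ctw by (simp_all add: mult.commute mult.left_commute)
  define b where "b = 1 / a (x$1)"
  have y: "YY2 a x \<xi> = (2 * tan (x$2) * (sec4 x \<xi>)\<^sup>2 - 2 * cot (x$2) * (csc3 x \<xi>)\<^sup>2) * b\<^sup>2"
    by (simp add: YY2_def b_def power_divide)
  have e1: "(cot (x$2) - tan (x$2))\<^sup>2 = (cot (x$2))\<^sup>2 + (tan (x$2))\<^sup>2 - 2"
    by (simp add: power2_diff ct)
  have e2: "(cot (x$2) - tan (x$2)) * YY2 a x \<xi> = 2 * b\<^sup>2 *
    ((1 - (cot (x$2))\<^sup>2) * (csc3 x \<xi>)\<^sup>2 + (1 - (tan (x$2))\<^sup>2) * (sec4 x \<xi>)\<^sup>2)"
    unfolding y by (simp add: algebra_simps power2_eq_square ctw tcw ct)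
  have e3: "(YY2 a x \<xi>)\<^sup>2 = 4 * b ^ 4 * ((cot (x$2))\<^sup>2 * (csc3 x \<xi>) ^ 4
     - 2 * (csc3 x \<xi>)\<^sup>2 * (sec4 x \<xi>)\<^sup>2 + (tan (x$2))\<^sup>2 * (sec4 x \<xi>) ^ 4)"
    unfolding y by (simp add: algebra_simps eval_nat_numeral ctw tcw ct)
  show ?thesis
    unfolding trace_sigma_2 [OF assms] trace_sigma_2 [OF assms(1) nz] fl of_real_add [symmetric]
      full_poly_even [OF e1 e2 [unfolded b_def] e3 [unfolded b_def]]
    by (simp add: dens_def Let_def csc3_def sec4_def PP_def)
qed

lemma b4_eq_dens:
  assumes "t \<in> T" "0 < \<eta>" "\<eta> < pi / 2" "\<xi> \<noteq> 0"
  shows "b4 a t \<eta> \<xi> = of_real (dens (a t) (deriv a t) (deriv (deriv a) t) \<eta> \<xi>)"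
proof -
  define x :: "real^4" where "x = vector [t, \<eta>, 0, 0]"
  have x: "x \<in> adm" "x$1 = t" "x$2 = \<eta>"
    using assms sin_gt_zero [of \<eta>] cos_gt_zero [of \<eta>] by (auto simp: x_def adm_def)
  define fl :: "4 set \<Rightarrow> real^4" where "fl J = (\<chi> j. if j \<in> J then - \<xi>$j else \<xi>$j)" for J
  define g where "g J = trace (sigma a 2 x (fl J))" for J
  \<comment> \<open>Toggling the membership of 1 is an involution of the sixteen sign patterns. It
    pairs each with its reflection in \<xi>_1, and every pair contributes twice the same even
    function.\<close>
  define tg :: "4 set \<Rightarrow> 4 set" where "tg J = (if 1 \<in> J then J - {1} else insert 1 J)" for J
  have nz: "fl J \<noteq> 0" for J using assms(4) by (auto simp: fl_def vec_eq_iff forall_4)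
  have dens_fl: "dens g0 g1 g2 \<eta> (fl J) = dens g0 g1 g2 \<eta> \<xi>" for g0 g1 g2 J
    by (simp add: dens_def Let_def fl_def full_poly_flip)
  have fltg: "fl (tg J) = flip1 (fl J)" for J
    by (auto simp: fl_def tg_def flip1_def vec_eq_iff)
  have "(\<Sum>J\<in>UNIV. g J) = (\<Sum>J\<in>UNIV. g (tg J))"
    by (rule sum.reindex_bij_witness [of _ tg tg]) (auto simp: tg_def insert_absorb)
  then have "2 * (\<Sum>J\<in>UNIV. g J) = (\<Sum>J\<in>UNIV. g J + g (tg J))"
    by (simp add: sum.distrib)
  also have "\<dots> = (\<Sum>J\<in>(UNIV :: 4 set set). of_real (2 * dens (a t) (deriv a t) (deriv (deriv a) t) \<eta> \<xi>))"
    unfolding g_def fltg trace_sigma_2_flip1 [OF x(1) nz] x dens_fl ..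
  also have "\<dots> = 2 * (16 * of_real (dens (a t) (deriv a t) (deriv (deriv a) t) \<eta> \<xi>))"
    by (simp add: card_UNIV_set)
  finally show ?thesis
    unfolding b4_def x_def [symmetric] fl_def [symmetric] g_def [symmetric] by simp
qed

end

section \<open>Integrals of divergences over the sphere\<close>

lemma integral_zero_snd:
  fixes f :: "'a::euclidean_space \<times> 'b::euclidean_space \<Rightarrow> real"
  assumes "continuous_on (cbox (a, c) (b, d)) f"
    and "\<And>x. x \<in> cbox a b \<Longrightarrow> integral (cbox c d) (\<lambda>y. f (x, y)) = 0"
  shows "integral (cbox (a, c) (b, d)) f = 0"
proof -
  have "integral (cbox (a, c) (b, d)) f = integral (cbox a b) (\<lambda>x. integral (cbox c d) (\<lambda>y. f (x, y)))"
    by (rule integral_prod_continuous [OF assms(1)])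
  also have "\<dots> = integral (cbox a b) (\<lambda>_. 0)"
    by (rule integral_cong) (rule assms(2))
  finally show ?thesis by simp
qed

lemma integral_prod_continuous_swap:
  fixes f :: "'a::euclidean_space \<times> 'b::euclidean_space \<Rightarrow> real"
  assumes "continuous_on (cbox (a, c) (b, d)) f"
  shows "integral (cbox (a, c) (b, d)) f = integral (cbox c d) (\<lambda>y. integral (cbox a b) (\<lambda>x. f (x, y)))"
  using integral_prod_continuous [OF assms] integral_swap_continuous [of a c b d "\<lambda>x y. f (x, y)"] assms
  by simp

lemma integral_zero_fst:
  fixes f :: "'a::euclidean_space \<times> 'b::euclidean_space \<Rightarrow> real"
  assumes "continuous_on (cbox (a, c) (b, d)) f"
    and "\<And>y. y \<in> cbox c d \<Longrightarrow> integral (cbox a b) (\<lambda>x. f (x, y)) = 0"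
  shows "integral (cbox (a, c) (b, d)) f = 0"
proof -
  have "integral (cbox (a, c) (b, d)) f = integral (cbox c d) (\<lambda>y. integral (cbox a b) (\<lambda>x. f (x, y)))"
    by (rule integral_prod_continuous_swap [OF assms(1)])
  also have "\<dots> = integral (cbox c d) (\<lambda>_. 0)"
    by (rule integral_cong) (rule assms(2))
  finally show ?thesis by simp
qed

lemma continuous_on_slice_snd:
  assumes "continuous_on (cbox (a, c) (b, d)) f" "x \<in> cbox a b"
  shows "continuous_on (cbox c d) (\<lambda>y. f (x, y))"
  by (rule continuous_on_compose2 [OF assms(1)]) (use assms(2) in \<open>auto intro!: continuous_intros\<close>)

lemma integral_deriv_zero:
  fixes F :: "real \<Rightarrow> real"
  assumes "a \<le> b" "F a = F b" "\<And>x. (F has_real_derivative f x) (at x)"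
  shows "integral (cbox a b) f = 0"
proof -
  have "(f has_integral (F b - F a)) {a..b}"
    using assms by (intro fundamental_theorem_of_calculus)
      (auto simp flip: has_real_derivative_iff_has_vector_derivative intro: has_field_derivative_at_within)
  then show ?thesis using assms(2) by (simp add: integral_unique)
qed

text \<open>Each summand is integrated first in the variable in which it is a derivative, where
  equal boundary values make it vanish. Continuity allows Fubini in either order, so no summand
  needs a separate integrability argument.\<close>

lemma integral_divergence_zero:
  fixes H1 H2 H3 :: "real \<Rightarrow> real \<Rightarrow> real \<Rightarrow> real"
  assumes le: "a1 \<le> b1" "a2 \<le> b2" "a3 \<le> b3"
    and d1: "\<And>x y z. ((\<lambda>x. H1 x y z) has_real_derivative D1 (x, y, z)) (at x)"
    and d2: "\<And>x y z. ((\<lambda>y. H2 x y z) has_real_derivative D2 (x, y, z)) (at y)"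
    and d3: "\<And>x y z. ((\<lambda>z. H3 x y z) has_real_derivative D3 (x, y, z)) (at z)"
    and c: "continuous_on UNIV D1" "continuous_on UNIV D2" "continuous_on UNIV D3"
    and b: "\<And>y z. H1 a1 y z = H1 b1 y z" "\<And>x z. H2 x a2 z = H2 x b2 z" "\<And>x y. H3 x y a3 = H3 x y b3"
  shows "((\<lambda>p. D1 p + D2 p + D3 p) has_integral 0) (cbox (a1, a2, a3) (b1, b2, b3))"
proof -
  have c: "continuous_on (cbox (a1, a2, a3) (b1, b2, b3)) D" if "continuous_on UNIV D" for D :: "real \<times> real \<times> real \<Rightarrow> real"
    using that by (rule continuous_on_subset) simp
  note C = this [OF assms(7)] this [OF assms(8)] this [OF assms(9)]
  have "integral (cbox (a1, a2, a3) (b1, b2, b3)) D1 = 0"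
  proof (rule integral_zero_fst [OF C(1)])
    fix y assume "y \<in> cbox (a2, a3) (b2, b3)"
    show "integral (cbox a1 b1) (\<lambda>x. D1 (x, y)) = 0"
      by (cases y, simp only:) (rule integral_deriv_zero [OF le(1) b(1) d1])
  qed
  moreover have "integral (cbox (a1, a2, a3) (b1, b2, b3)) D2 = 0"
  proof (rule integral_zero_snd [OF C(2)])
    fix x assume x: "x \<in> cbox a1 b1"
    show "integral (cbox (a2, a3) (b2, b3)) (\<lambda>y. D2 (x, y)) = 0"
      by (rule integral_zero_fst [OF continuous_on_slice_snd [OF C(2) x]])
         (rule integral_deriv_zero [OF le(2) b(2) d2])
  qed
  moreover have "integral (cbox (a1, a2, a3) (b1, b2, b3)) D3 = 0"
  proof (rule integral_zero_snd [OF C(3)])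
    fix x assume x: "x \<in> cbox a1 b1"
    show "integral (cbox (a2, a3) (b2, b3)) (\<lambda>y. D3 (x, y)) = 0"
      by (rule integral_zero_snd [OF continuous_on_slice_snd [OF C(3) x]])
         (rule integral_deriv_zero [OF le(3) b(3) d3])
  qed
  ultimately have "(D1 has_integral 0) (cbox (a1, a2, a3) (b1, b2, b3))"
    "(D2 has_integral 0) (cbox (a1, a2, a3) (b1, b2, b3))" "(D3 has_integral 0) (cbox (a1, a2, a3) (b1, b2, b3))"
    using integrable_continuous C by (metis has_integral_integrable_integral)+
  then have "((\<lambda>p. D1 p + D2 p + D3 p) has_integral 0 + 0 + 0) (cbox (a1, a2, a3) (b1, b2, b3))"
    by (intro has_integral_add)
  then show ?thesis by simp
qed

section \<open>Derivatives of functions of degree -3 integrate to zero over the sphere\<close>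

definition sphere_weight :: "R3 \<Rightarrow> real" where
  "sphere_weight \<theta> = (sin (fst \<theta>))\<^sup>2 * sin (fst (snd \<theta>))"

definition sphere_box :: "R3 set" where
  "sphere_box = cbox (0, 0, 0) (pi, pi, 2 * pi)"

lemma sphere_param_nth [simp]:
  "sphere_param (x, y, z) $ 1 = cos x" "sphere_param (x, y, z) $ 2 = sin x * cos y"
  "sphere_param (x, y, z) $ 3 = sin x * sin y * cos z" "sphere_param (x, y, z) $ 4 = sin x * sin y * sin z"
  by (simp_all add: sphere_param_def)

lemma sphere_param_sq:
  "(sphere_param \<theta> $ 1)\<^sup>2 + (sphere_param \<theta> $ 2)\<^sup>2 + (sphere_param \<theta> $ 3)\<^sup>2 + (sphere_param \<theta> $ 4)\<^sup>2 = 1"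
proof (cases \<theta>)
  case (fields x y z)
  have "(sin x)\<^sup>2 + (cos x)\<^sup>2 = 1" "(sin y)\<^sup>2 + (cos y)\<^sup>2 = 1" "(sin z)\<^sup>2 + (cos z)\<^sup>2 = 1" by simp_all
  then show ?thesis unfolding fields sphere_param_nth by algebra
qed

lemma sphere_param_nz: "sphere_param \<theta> \<noteq> 0"
  using sphere_param_sq [of \<theta>] by auto

lemma has_derivative_nth: "((\<lambda>u::real^'n. u$i) has_derivative (\<lambda>h. h$i)) F"
  by (rule bounded_linear_imp_has_derivative) (rule bounded_linear_vec_nth)

lemma has_derivative_vecI:
  fixes f :: "'a::real_normed_vector \<Rightarrow> real^'n"
  assumes "\<And>i. ((\<lambda>x. f x $ i) has_derivative (\<lambda>h. f' h $ i)) (at x)"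
  shows "(f has_derivative f') (at x)"
proof (subst has_derivative_componentwise_within, rule ballI)
  fix b :: "real^'n" assume "b \<in> Basis"
  then obtain i where b: "b = axis i 1" by (auto simp: Basis_vec_def)
  show "((\<lambda>x. f x \<bullet> b) has_derivative (\<lambda>h. f' h \<bullet> b)) (at x)"
    using assms [of i] by (simp add: b inner_axis)
qed

lemma continuous_on_vecI:
  fixes f :: "'a::topological_space \<Rightarrow> real^'n"
  assumes "\<And>i. continuous_on S (\<lambda>x. f x $ i)"
  shows "continuous_on S f"
proof -
  have "continuous_on S (\<lambda>x. \<chi> i. f x $ i)"
    by (rule continuous_on_vec_lambda) (rule assms)
  then show ?thesis by simp
qed

lemma continuous_on_sphere_param: "continuous_on S sphere_param"
proof (rule continuous_on_vecI)
  show "continuous_on S (\<lambda>\<theta>. sphere_param \<theta> $ i)" for i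
    using exhaust_4 [of i]
    by (elim disjE; simp add: sphere_param_def split_def; intro continuous_intros)
qed

text \<open>Homogeneity is used in the form of Euler's identity. The tangential part of the unit
  vector e_i has divergence -3 \<xi>_i on the 3-sphere, and degree -3 is exactly the one for which
  the Euler term cancels this, so that the divergence of the tangential part of f e_i is the partial
  derivative of f.\<close>

context
  fixes f f1 f2 f3 f4 :: "real^4 \<Rightarrow> real"
  assumes deriv: "\<And>\<xi>. \<xi> \<noteq> 0 \<Longrightarrow> (f has_derivative (\<lambda>h. f1 \<xi> * h$1 + f2 \<xi> * h$2 + f3 \<xi> * h$3 + f4 \<xi> * h$4)) (at \<xi>)"
    and cont: "continuous_on (- {0}) f1" "continuous_on (- {0}) f2" "continuous_on (- {0}) f3" "continuous_on (- {0}) f4"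
    and euler: "\<And>\<xi>. \<xi> \<noteq> 0 \<Longrightarrow> \<xi>$1 * f1 \<xi> + \<xi>$2 * f2 \<xi> + \<xi>$3 * f3 \<xi> + \<xi>$4 * f4 \<xi> = - 3 * f \<xi>"
begin

lemma DERIV_sphere:
  fixes g :: "real \<Rightarrow> real^4"
  assumes "g x \<noteq> 0"
    "((\<lambda>x. g x $ 1) has_real_derivative e1) (at x)" "((\<lambda>x. g x $ 2) has_real_derivative e2) (at x)"
    "((\<lambda>x. g x $ 3) has_real_derivative e3) (at x)" "((\<lambda>x. g x $ 4) has_real_derivative e4) (at x)"
  shows "((\<lambda>x. f (g x)) has_real_derivative f1 (g x) * e1 + f2 (g x) * e2 + f3 (g x) * e3 + f4 (g x) * e4) (at x)"
proof -
  define d :: "real^4" where "d = vector [e1, e2, e3, e4]"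
  have "((\<lambda>x. g x $ i) has_derivative (\<lambda>h. (h *\<^sub>R d) $ i)) (at x)" for i
    using exhaust_4 [of i] assms(2-) by (auto simp: d_def has_field_derivative_def mult_commute_abs)
  then have "(g has_derivative (\<lambda>h. h *\<^sub>R d)) (at x)"
    by (rule has_derivative_vecI)
  from has_derivative_compose [OF this deriv [OF assms(1)]]
  show ?thesis
    unfolding has_field_derivative_def
    by (rule has_derivative_eq_rhs) (simp add: fun_eq_iff algebra_simps d_def)
qed

lemma DERIV_sphere_param:
  "((\<lambda>x. f (sphere_param (x, y, z))) has_real_derivative
     f1 (sphere_param (x, y, z)) * - sin x + f2 (sphere_param (x, y, z)) * (cos x * cos y)
     + f3 (sphere_param (x, y, z)) * (cos x * sin y * cos z) + f4 (sphere_param (x, y, z)) * (cos x * sin y * sin z)) (at x)"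
  "((\<lambda>y. f (sphere_param (x, y, z))) has_real_derivative
     f1 (sphere_param (x, y, z)) * 0 + f2 (sphere_param (x, y, z)) * - (sin x * sin y)
     + f3 (sphere_param (x, y, z)) * (sin x * cos y * cos z) + f4 (sphere_param (x, y, z)) * (sin x * cos y * sin z)) (at y)"
  "((\<lambda>z. f (sphere_param (x, y, z))) has_real_derivative
     f1 (sphere_param (x, y, z)) * 0 + f2 (sphere_param (x, y, z)) * 0
     + f3 (sphere_param (x, y, z)) * - (sin x * sin y * sin z) + f4 (sphere_param (x, y, z)) * (sin x * sin y * cos z)) (at z)"
  by (intro DERIV_sphere sphere_param_nz; unfold sphere_param_nth; auto intro!: derivative_eq_intros)+

lemma cont_sphere:
  "continuous_on UNIV (\<lambda>\<theta>. f (sphere_param \<theta>))" "continuous_on UNIV (\<lambda>\<theta>. f1 (sphere_param \<theta>))"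
  "continuous_on UNIV (\<lambda>\<theta>. f2 (sphere_param \<theta>))" "continuous_on UNIV (\<lambda>\<theta>. f3 (sphere_param \<theta>))"
  "continuous_on UNIV (\<lambda>\<theta>. f4 (sphere_param \<theta>))"
proof -
  have c: "continuous_on UNIV (\<lambda>\<theta>. g (sphere_param \<theta>))" if "continuous_on (- {0}) g" for g :: "real^4 \<Rightarrow> real"
    using that by (rule continuous_on_compose2 [OF _ continuous_on_sphere_param]) (auto simp: sphere_param_nz)
  have cf: "continuous_on (- {0}) f"
    by (rule has_derivative_continuous_on) (auto intro: has_derivative_at_withinI deriv)
  show "continuous_on UNIV (\<lambda>\<theta>. f (sphere_param \<theta>))" "continuous_on UNIV (\<lambda>\<theta>. f1 (sphere_param \<theta>))"
    "continuous_on UNIV (\<lambda>\<theta>. f2 (sphere_param \<theta>))" "continuous_on UNIV (\<lambda>\<theta>. f3 (sphere_param \<theta>))"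
    "continuous_on UNIV (\<lambda>\<theta>. f4 (sphere_param \<theta>))"
    by (rule c [OF cf] cont [THEN c])+
qed

text \<open>For \<open>f\<close> homogeneous of degree \<open>-3\<close> the partial derivative \<open>f\<^sub>i\<close> equals, on the sphere, the divergence of the tangential part of
\<open>f e\<^sub>i\<close>. In the applications \<open>h1, h2, h3\<close> are the components of the tangential part of \<open>e\<^sub>i\<close> in spherical coordinates, times the
volume density.\<close>

lemma sphere_divergence:
  assumes d1: "\<And>x y z. ((\<lambda>x. h1 x y z) has_real_derivative h1' (x, y, z)) (at x)"
    and d2: "\<And>x y z. ((\<lambda>y. h2 x y z) has_real_derivative h2' (x, y, z)) (at y)"
    and d3: "\<And>x y z. ((\<lambda>z. h3 x y z) has_real_derivative h3' (x, y, z)) (at z)"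
    and c: "continuous_on UNIV (\<lambda>(x, y, z). h1 x y z)" "continuous_on UNIV (\<lambda>(x, y, z). h2 x y z)"
      "continuous_on UNIV (\<lambda>(x, y, z). h3 x y z)"
    and c': "continuous_on UNIV h1'" "continuous_on UNIV h2'" "continuous_on UNIV h3'"
    and b: "\<And>y z. h1 0 y z = 0" "\<And>y z. h1 pi y z = 0" "\<And>x z. h2 x 0 z = 0" "\<And>x z. h2 x pi z = 0"
      "\<And>x y. h3 x y 0 = h3 x y (2 * pi)"
    and eq: "\<And>x y z. h1' (x, y, z) * f (sphere_param (x, y, z)) + h1 x y z *
        (f1 (sphere_param (x, y, z)) * - sin x + f2 (sphere_param (x, y, z)) * (cos x * cos y)
       + f3 (sphere_param (x, y, z)) * (cos x * sin y * cos z) + f4 (sphere_param (x, y, z)) * (cos x * sin y * sin z))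
     + (h2' (x, y, z) * f (sphere_param (x, y, z)) + h2 x y z *
        (f2 (sphere_param (x, y, z)) * - (sin x * sin y)
       + f3 (sphere_param (x, y, z)) * (sin x * cos y * cos z) + f4 (sphere_param (x, y, z)) * (sin x * cos y * sin z)))
     + (h3' (x, y, z) * f (sphere_param (x, y, z)) + h3 x y z *
        (f3 (sphere_param (x, y, z)) * - (sin x * sin y * sin z) + f4 (sphere_param (x, y, z)) * (sin x * sin y * cos z)))
     = R (x, y, z)"
  shows "(R has_integral 0) sphere_box"
proof -
  have R: "R p = h1' p * f (sphere_param p) + (case p of (x, y, z) \<Rightarrow> h1 x y z) *
        (f1 (sphere_param p) * - sin (fst p) + f2 (sphere_param p) * (cos (fst p) * cos (fst (snd p)))
       + f3 (sphere_param p) * (cos (fst p) * sin (fst (snd p)) * cos (snd (snd p))) + f4 (sphere_param p) * (cos (fst p) * sin (fst (snd p)) * sin (snd (snd p))))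
     + (h2' p * f (sphere_param p) + (case p of (x, y, z) \<Rightarrow> h2 x y z) *
        (f2 (sphere_param p) * - (sin (fst p) * sin (fst (snd p)))
       + f3 (sphere_param p) * (sin (fst p) * cos (fst (snd p)) * cos (snd (snd p))) + f4 (sphere_param p) * (sin (fst p) * cos (fst (snd p)) * sin (snd (snd p)))))
     + (h3' p * f (sphere_param p) + (case p of (x, y, z) \<Rightarrow> h3 x y z) *
        (f3 (sphere_param p) * - (sin (fst p) * sin (fst (snd p)) * sin (snd (snd p))) + f4 (sphere_param p) * (sin (fst p) * sin (fst (snd p)) * cos (snd (snd p)))))" for p
    by (cases p) (simp only: eq fst_conv snd_conv prod.case)
  \<comment> \<open>The third angle runs through a full turn, so its boundary terms cancel by
    periodicity; in the other two angles the components vanish at the ends.\<close>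
  have per: "sphere_param (x, y, 2 * pi) = sphere_param (x, y, 0)" for x y
    by (simp add: sphere_param_def)
  show ?thesis
    unfolding sphere_box_def R
    by (rule integral_divergence_zero [where ?H1.0 = "\<lambda>x y z. h1 x y z * f (sphere_param (x, y, z))"
        and ?H2.0 = "\<lambda>x y z. h2 x y z * f (sphere_param (x, y, z))" and ?H3.0 = "\<lambda>x y z. h3 x y z * f (sphere_param (x, y, z))"])
       (auto intro!: continuous_intros c c' cont_sphere DERIV_mult' [THEN DERIV_cong] d1 d2 d3 DERIV_sphere_param [simplified] simp: b per)
qed

lemma sphere_integral_partial_2: "((\<lambda>\<theta>. sphere_weight \<theta> * f2 (sphere_param \<theta>)) has_integral 0) sphere_box"
proof (rule sphere_divergence [where ?h1.0 = "\<lambda>x y z. (sin x)\<^sup>2 * sin y * cos x * cos y"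
    and ?h2.0 = "\<lambda>x y z. - (sin x * (sin y)\<^sup>2)" and ?h3.0 = "\<lambda>_ _ _. 0"
    and h1' = "\<lambda>p. sin (fst (snd p)) * cos (fst (snd p)) * (2 * sin (fst p) * (cos (fst p))\<^sup>2 - (sin (fst p)) ^ 3)"
    and h2' = "\<lambda>p. - (2 * sin (fst p) * sin (fst (snd p)) * cos (fst (snd p)))" and h3' = "\<lambda>_. 0"], goal_cases)
  \<comment> \<open>Goal 15 is the hypothesis \<open>eq\<close> of \<open>sphere_divergence\<close>,
    the only one that uses Euler's identity. The remaining goals are derivatives, continuity and
    boundary values.\<close>
  case (15 x y z)
  note s = sin_cos_squared_add [of x] sin_cos_squared_add [of y] sin_cos_squared_add [of z]
  note euler [OF sphere_param_nz, of "(x, y, z)", simplified]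
  with s show ?case
    unfolding sphere_weight_def fst_conv snd_conv by algebra
qed (auto intro!: continuous_intros derivative_eq_intros simp: split_def power2_eq_square power3_eq_cube algebra_simps)

lemma sphere_integral_partial_3: "((\<lambda>\<theta>. sphere_weight \<theta> * f3 (sphere_param \<theta>)) has_integral 0) sphere_box"
proof (rule sphere_divergence [where ?h1.0 = "\<lambda>x y z. (sin x)\<^sup>2 * cos x * (sin y)\<^sup>2 * cos z"
    and ?h2.0 = "\<lambda>x y z. sin x * sin y * cos y * cos z" and ?h3.0 = "\<lambda>x y z. - (sin x * sin z)"
    and h1' = "\<lambda>p. (sin (fst (snd p)))\<^sup>2 * cos (snd (snd p)) * (2 * sin (fst p) * (cos (fst p))\<^sup>2 - (sin (fst p)) ^ 3)"
    and h2' = "\<lambda>p. sin (fst p) * cos (snd (snd p)) * ((cos (fst (snd p)))\<^sup>2 - (sin (fst (snd p)))\<^sup>2)"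
    and h3' = "\<lambda>p. - (sin (fst p) * cos (snd (snd p)))"], goal_cases)
  case (15 x y z)
  note s = sin_cos_squared_add [of x] sin_cos_squared_add [of y] sin_cos_squared_add [of z]
  note euler [OF sphere_param_nz, of "(x, y, z)", simplified]
  with s show ?case
    unfolding sphere_weight_def fst_conv snd_conv by algebra
qed (auto intro!: continuous_intros derivative_eq_intros simp: split_def power2_eq_square power3_eq_cube algebra_simps)

lemma sphere_integral_partial_4: "((\<lambda>\<theta>. sphere_weight \<theta> * f4 (sphere_param \<theta>)) has_integral 0) sphere_box"
proof (rule sphere_divergence [where ?h1.0 = "\<lambda>x y z. (sin x)\<^sup>2 * cos x * (sin y)\<^sup>2 * sin z"
    and ?h2.0 = "\<lambda>x y z. sin x * sin y * cos y * sin z" and ?h3.0 = "\<lambda>x y z. sin x * cos z"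
    and h1' = "\<lambda>p. (sin (fst (snd p)))\<^sup>2 * sin (snd (snd p)) * (2 * sin (fst p) * (cos (fst p))\<^sup>2 - (sin (fst p)) ^ 3)"
    and h2' = "\<lambda>p. sin (fst p) * sin (snd (snd p)) * ((cos (fst (snd p)))\<^sup>2 - (sin (fst (snd p)))\<^sup>2)"
    and h3' = "\<lambda>p. - (sin (fst p) * sin (snd (snd p)))"], goal_cases)
  case (15 x y z)
  note s = sin_cos_squared_add [of x] sin_cos_squared_add [of y] sin_cos_squared_add [of z]
  note euler [OF sphere_param_nz, of "(x, y, z)", simplified]
  with s show ?case
    unfolding sphere_weight_def fst_conv snd_conv by algebra
qed (auto intro!: continuous_intros derivative_eq_intros simp: split_def power2_eq_square power3_eq_cube algebra_simps)

end

text \<open>This is p_2 as a quadratic form in \<xi>, with \<open>b\<close>, \<open>k\<close>,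
  \<open>l\<close> in the roles of 1/a, csc \<eta>, sec \<eta>.\<close>

definition quad :: "real \<Rightarrow> real \<Rightarrow> real \<Rightarrow> real^4 \<Rightarrow> real" where
  "quad b k l \<xi> = (\<xi>$1)\<^sup>2 + b\<^sup>2 * ((\<xi>$2)\<^sup>2 + (k * \<xi>$3)\<^sup>2 + (l * \<xi>$4)\<^sup>2)"

lemma quad_pos:
  assumes "b \<noteq> 0" "k \<noteq> 0" "l \<noteq> 0" "\<xi> \<noteq> 0"
  shows "quad b k l \<xi> > 0"
proof -
  have "\<xi>$1 \<noteq> 0 \<or> \<xi>$2 \<noteq> 0 \<or> \<xi>$3 \<noteq> 0 \<or> \<xi>$4 \<noteq> 0"
    using assms(4) by (auto simp: vec_eq_iff forall_4)
  then have "0 < (\<xi>$1)\<^sup>2 \<or> 0 < (\<xi>$2)\<^sup>2 + (k * \<xi>$3)\<^sup>2 + (l * \<xi>$4)\<^sup>2"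
    using assms(2,3) by (auto simp: add_pos_nonneg add_nonneg_pos)
  then show ?thesis
    using assms(1) unfolding quad_def by (auto simp: add_pos_nonneg add_nonneg_pos)
qed

lemma continuous_on_quad [continuous_intros]: "continuous_on S (quad b k l)"
  unfolding quad_def by (intro continuous_intros)

text \<open>The condition on the exponents says that \<open>mon\<close> divided by the m-th power of
  \<open>quad\<close> has degree -3; \<open>f2\<close>, \<open>f3\<close>, \<open>f4\<close> are its
  partial derivatives in \<xi>_2, \<xi>_3, \<xi>_4.\<close>

lemma sphere_integral_monomial:
  fixes p q s m :: nat and b k l :: real
  assumes nz: "b \<noteq> 0" "k \<noteq> 0" "l \<noteq> 0" and m: "p + q + s + 3 = 2 * m"
  defines "mon \<equiv> \<lambda>\<xi>::real^4. (\<xi>$2) ^ p * (\<xi>$3) ^ q * (\<xi>$4) ^ s"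
  defines "f2 \<equiv> \<lambda>\<xi>. p * (\<xi>$2) ^ (p - 1) * (\<xi>$3) ^ q * (\<xi>$4) ^ s / quad b k l \<xi> ^ m
      - 2 * m * b\<^sup>2 * \<xi>$2 * mon \<xi> / quad b k l \<xi> ^ Suc m"
    and "f3 \<equiv> \<lambda>\<xi>. q * (\<xi>$2) ^ p * (\<xi>$3) ^ (q - 1) * (\<xi>$4) ^ s / quad b k l \<xi> ^ m
      - 2 * m * b\<^sup>2 * k\<^sup>2 * \<xi>$3 * mon \<xi> / quad b k l \<xi> ^ Suc m"
    and "f4 \<equiv> \<lambda>\<xi>. s * (\<xi>$2) ^ p * (\<xi>$3) ^ q * (\<xi>$4) ^ (s - 1) / quad b k l \<xi> ^ m
      - 2 * m * b\<^sup>2 * l\<^sup>2 * \<xi>$4 * mon \<xi> / quad b k l \<xi> ^ Suc m"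
  shows "((\<lambda>\<theta>. sphere_weight \<theta> * f2 (sphere_param \<theta>)) has_integral 0) sphere_box" (is ?t1)
    and "((\<lambda>\<theta>. sphere_weight \<theta> * f3 (sphere_param \<theta>)) has_integral 0) sphere_box" (is ?t2)
    and "((\<lambda>\<theta>. sphere_weight \<theta> * f4 (sphere_param \<theta>)) has_integral 0) sphere_box" (is ?t3)
proof -
  define f where "f = (\<lambda>\<xi>. mon \<xi> / quad b k l \<xi> ^ m)"
  define f1 where "f1 = (\<lambda>\<xi>. - (2 * m * \<xi>$1 * mon \<xi> / quad b k l \<xi> ^ Suc m))"
  note fdefs = f1_def f2_def f3_def f4_def
  have pos: "quad b k l \<xi> \<noteq> 0" if "\<xi> \<noteq> 0" for \<xi>
    using quad_pos [of b k l \<xi>] nz that by simp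
  have D: "(f has_derivative (\<lambda>h. f1 \<xi> * h$1 + f2 \<xi> * h$2 + f3 \<xi> * h$3 + f4 \<xi> * h$4)) (at \<xi>)" if "\<xi> \<noteq> 0" for \<xi>
  proof -
    note c = has_derivative_nth
    have m1: "(mon has_derivative (\<lambda>h. p * (\<xi>$2) ^ (p - 1) * (\<xi>$3) ^ q * (\<xi>$4) ^ s * h$2
      + q * (\<xi>$2) ^ p * (\<xi>$3) ^ (q - 1) * (\<xi>$4) ^ s * h$3 + s * (\<xi>$2) ^ p * (\<xi>$3) ^ q * (\<xi>$4) ^ (s - 1) * h$4)) (at \<xi>)"
      unfolding mon_def by (auto intro!: derivative_eq_intros c simp: fun_eq_iff algebra_simps)
    have q1: "(quad b k l has_derivative (\<lambda>h. 2 * \<xi>$1 * h$1 + b\<^sup>2 * (2 * \<xi>$2 * h$2 + 2 * k\<^sup>2 * \<xi>$3 * h$3 + 2 * l\<^sup>2 * \<xi>$4 * h$4))) (at \<xi>)"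
      unfolding quad_def by (auto intro!: derivative_eq_intros c simp: fun_eq_iff algebra_simps power2_eq_square)
    have "((\<lambda>\<xi>. inverse (quad b k l \<xi> ^ m)) has_derivative
        (\<lambda>h. - (m / quad b k l \<xi> ^ Suc m) * (2 * \<xi>$1 * h$1 + b\<^sup>2 * (2 * \<xi>$2 * h$2 + 2 * k\<^sup>2 * \<xi>$3 * h$3 + 2 * l\<^sup>2 * \<xi>$4 * h$4)))) (at \<xi>)"
    proof -
      have "((\<lambda>t::real. inverse (t ^ m)) has_real_derivative - (m / quad b k l \<xi> ^ Suc m)) (at (quad b k l \<xi>))"
      proof -
        have "m \<noteq> 0" using m by auto
        then obtain n where "m = Suc n" by (cases m) auto
        then show ?thesis
          using pos [OF that] by (intro DERIV_cong [OF DERIV_inverse' [OF DERIV_pow]]) (auto simp: field_simps)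
      qed
      from has_derivative_compose [OF q1 this [unfolded has_field_derivative_def]] show ?thesis .
    qed
    from has_derivative_mult [OF m1 this]
    show ?thesis
      unfolding f_def divide_inverse
      by (rule has_derivative_eq_rhs) (simp add: fdefs fun_eq_iff algebra_simps divide_inverse)
  qed
  have C: "continuous_on (- {0}) f1" "continuous_on (- {0}) f2" "continuous_on (- {0}) f3" "continuous_on (- {0}) f4"
    unfolding fdefs mon_def by (intro continuous_intros; use pos in auto)+
  have E: "\<xi>$1 * f1 \<xi> + \<xi>$2 * f2 \<xi> + \<xi>$3 * f3 \<xi> + \<xi>$4 * f4 \<xi> = - 3 * f \<xi>" if "\<xi> \<noteq> 0" for \<xi>
  proof -
    \<comment> \<open>For n = 0 the exponent n - 1 is truncated to 0, but then the factor n makes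
      the term vanish.\<close>
    have e: "x * (real n * x ^ (n - 1)) = n * x ^ n" for x :: real and n
      by (cases n) auto
    have "\<xi>$1 * f1 \<xi> + \<xi>$2 * f2 \<xi> + \<xi>$3 * f3 \<xi> + \<xi>$4 * f4 \<xi>
      = ((\<xi>$2 * (p * (\<xi>$2) ^ (p - 1))) * (\<xi>$3) ^ q * (\<xi>$4) ^ s + (\<xi>$3 * (q * (\<xi>$3) ^ (q - 1))) * (\<xi>$2) ^ p * (\<xi>$4) ^ s
        + (\<xi>$4 * (s * (\<xi>$4) ^ (s - 1))) * (\<xi>$2) ^ p * (\<xi>$3) ^ q) / quad b k l \<xi> ^ m
       - 2 * m * mon \<xi> * quad b k l \<xi> / quad b k l \<xi> ^ Suc m"
      unfolding fdefs by (simp add: quad_def algebra_simps add_divide_distrib diff_divide_distrib power2_eq_square)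
    also have "\<dots> = (p + q + s - 2 * real m) * f \<xi>"
      unfolding e using pos [OF that] by (simp add: f_def mon_def algebra_simps add_divide_distrib diff_divide_distrib)
    also have "p + q + s - 2 * real m = - 3"
      using m by linarith
    finally show ?thesis .
  qed
  show ?t1 ?t2 ?t3
    using sphere_integral_partial_2 [OF D C E] sphere_integral_partial_3 [OF D C E] sphere_integral_partial_4 [OF D C E]
    by simp_all
qed

text \<open>The identity \<open>alg\<close> exhibits \<open>cot_part\<close> as a sum of derivatives of \<open>\<xi>\<^sub>2 r\<^sup>2\<close>, \<open>\<xi>\<^sub>2 \<xi>\<^sub>3\<^sup>2 r\<^sup>3\<close>, \<open>\<xi>\<^sub>2 \<xi>\<^sub>3\<^sup>4 r\<^sup>4\<close> in \<open>\<xi>\<^sub>2\<close> and of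
\<open>\<xi>\<^sub>3\<^sup>3 r\<^sup>3\<close> in \<open>\<xi>\<^sub>3\<close>, each homogeneous of degree \<open>-3\<close>.\<close>

lemma cot_part_integral:
  assumes nz: "b \<noteq> 0" "k \<noteq> 0" "l \<noteq> 0"
  shows "((\<lambda>\<theta>. sphere_weight \<theta> * cot_part b (1 / quad b k l (sphere_param \<theta>)) (sphere_param \<theta> $ 2) (k * sphere_param \<theta> $ 3))
     has_integral 0) sphere_box" (is ?t3)
    and "((\<lambda>\<theta>. sphere_weight \<theta> * cot_part b (1 / quad b k l (sphere_param \<theta>)) (sphere_param \<theta> $ 2) (l * sphere_param \<theta> $ 4))
     has_integral 0) sphere_box" (is ?t4)
proof -
  note i2 = sphere_integral_monomial(1) [OF nz] and i3 = sphere_integral_monomial(2) [OF nz]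
    and i4 = sphere_integral_monomial(3) [OF nz]
  have c0: "((\<lambda>x. c * f x) has_integral 0) S" if "(f has_integral 0) S" for c and f :: "R3 \<Rightarrow> real" and S
    using has_integral_mult_right [OF that, of c] by simp
  have a0: "((\<lambda>x. f x + g x) has_integral 0) S" if "(f has_integral 0) S" "(g has_integral 0) S" for f g :: "R3 \<Rightarrow> real" and S
    using has_integral_add [OF that] by simp
  have alg: "w * cot_part b r u (k * v) =
      - b\<^sup>2 * (w * (r\<^sup>2 - 4 * b\<^sup>2 * u\<^sup>2 * r ^ 3))
      + - 8 * b ^ 4 * k\<^sup>2 * (w * (v\<^sup>2 * r ^ 3 - 6 * b\<^sup>2 * u\<^sup>2 * v\<^sup>2 * r ^ 4))
      + 24 * b ^ 6 * k ^ 4 * (w * (v ^ 4 * r ^ 4 - 8 * b\<^sup>2 * u\<^sup>2 * v ^ 4 * r ^ 5))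
      + - 4 / 3 * b ^ 4 * k\<^sup>2 * (w * (3 * v\<^sup>2 * r ^ 3 - 6 * b\<^sup>2 * k\<^sup>2 * v ^ 4 * r ^ 4))" for w r u v b k :: real
    unfolding cot_part_def by algebra
  note s = power_divide eval_nat_numeral mult_ac
  \<comment> \<open>The four arguments of each instance are the exponents p, q, s and the power m of
    r; all satisfy p + q + s + 3 = 2m.\<close>
  show ?t3
    unfolding alg by (intro a0 c0) (use i2 [of 1 0 0 2] i2 [of 1 2 0 3] i2 [of 1 4 0 4] i3 [of 0 3 0 3] in \<open>simp_all add: s\<close>)
  show ?t4
    unfolding alg by (intro a0 c0) (use i2 [of 1 0 0 2] i2 [of 1 0 2 3] i2 [of 1 0 4 4] i4 [of 0 0 3 3] in \<open>simp_all add: s\<close>)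
qed

section \<open>Boundedness and integrability of the slice integrals\<close>

lemma dens_quad:
  "dens g0 g1 g2 \<eta> \<xi> = dens_poly (1 / g0) (1 / quad (1 / g0) (1 / sin \<eta>) (1 / cos \<eta>) \<xi>) g1 g2
     ((cot \<eta>)\<^sup>2) ((tan \<eta>)\<^sup>2) (\<xi>$1) (\<xi>$2) (1 / sin \<eta> * \<xi>$3) (1 / cos \<eta> * \<xi>$4)"
  by (simp add: dens_def quad_def Let_def power_divide)

lemma sin_cos_pos:
  assumes "0 < \<eta>" "\<eta> < pi / 2"
  shows "0 < sin \<eta>" "0 < cos \<eta>"
  using assms by (auto intro: sin_gt_zero cos_gt_zero)

lemma continuous_on_dens:
  assumes "g0 \<noteq> 0"
  shows "continuous_on ({0<..<pi/2} \<times> UNIV) (\<lambda>(\<eta>, \<theta>). sphere_weight \<theta> * dens g0 g1 g2 \<eta> (sphere_param \<theta>))"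
proof -
  have s: "sin (fst p) \<noteq> 0" "cos (fst p) \<noteq> 0" if "p \<in> {0<..<pi/2} \<times> UNIV" for p :: "real \<times> R3"
    using that sin_cos_pos [of "fst p"] by auto
  then have q: "quad (1 / g0) (1 / sin (fst p)) (1 / cos (fst p)) (sphere_param (snd p)) \<noteq> 0"
    if "p \<in> {0<..<pi/2} \<times> UNIV" for p :: "real \<times> R3"
    using that assms quad_pos [OF _ _ _ sphere_param_nz, of "1 / g0" "1 / sin (fst p)" "1 / cos (fst p)" "snd p"] by simp
  have S: "continuous_on A (\<lambda>p. sphere_param (snd p))" for A :: "(real \<times> R3) set"
    by (rule continuous_on_compose2 [OF continuous_on_sphere_param [of UNIV]]) (auto intro!: continuous_intros)
  have Q: "continuous_on ({0<..<pi/2} \<times> UNIV) (\<lambda>p. quad (1 / g0) (1 / sin (fst p)) (1 / cos (fst p)) (sphere_param (snd p)))"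
    unfolding quad_def by (intro continuous_intros S; use s in auto)
  show ?thesis
    unfolding split_def dens_quad dens_poly_def main_part_def cot_part_def Let_def sphere_weight_def cot_def tan_def
    by (intro continuous_intros S Q; use s q assms in auto)
qed

lemma continuous_on_dens_slice:
  assumes "g0 \<noteq> 0" "0 < \<eta>" "\<eta> < pi / 2"
  shows "continuous_on S (\<lambda>\<theta>. sphere_weight \<theta> * dens g0 g1 g2 \<eta> (sphere_param \<theta>))"
  by (rule continuous_on_compose2 [OF continuous_on_dens [OF assms(1), of g1 g2], of S "\<lambda>\<theta>. (\<eta>, \<theta>)", simplified])
     (use assms in \<open>auto intro!: continuous_intros\<close>)

definition slice_integral :: "real \<Rightarrow> real \<Rightarrow> real \<Rightarrow> real \<Rightarrow> real" where
  "slice_integral g0 g1 g2 \<eta> = integral sphere_box (\<lambda>\<theta>. sphere_weight \<theta> * dens g0 g1 g2 \<eta> (sphere_param \<theta>))"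

lemma continuous_on_slice_integral:
  assumes "g0 \<noteq> 0"
  shows "continuous_on {0<..<pi/2} (slice_integral g0 g1 g2)"
  unfolding slice_integral_def sphere_box_def
  by (rule integral_continuous_on_param, rule continuous_on_subset [OF continuous_on_dens [OF assms]]) auto

text \<open>Apart from the factor \<open>r\<^sup>2\<close>, \<open>main_part\<close> is a fixed
  polynomial \<open>q\<close> in the shares \<open>A\<close>, \<open>U\<close>, \<open>V\<close>,
  \<open>X\<close> that the four squares contribute to p_2. These are nonnegative with sum 1, so
  \<open>q\<close> is bounded by compactness. Since csc and sec are at least 1, p_2 is at least
  min(1, b^2) on the unit sphere, which bounds r independently of \<eta>.\<close>

lemma main_part_bound:
  assumes "b \<noteq> 0"
  obtains B where "\<And>k l \<xi>. 1 \<le> k \<Longrightarrow> 1 \<le> l \<Longrightarrow> (\<xi>$1)\<^sup>2 + (\<xi>$2)\<^sup>2 + (\<xi>$3)\<^sup>2 + (\<xi>$4)\<^sup>2 = 1 \<Longrightarrow>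
    \<bar>main_part b (1 / quad b k l \<xi>) g1 g2 (\<xi>$1) (\<xi>$2) (k * \<xi>$3) (l * \<xi>$4)\<bar> \<le> B"
proof -
  define h where "h = g1 * b"
  define q where "q = (\<lambda>(A, U, V, X). let W = U + V + X in
    - 4 * ((- 3 / 4 * h\<^sup>2 - 3 / 2 * g2 * b) + 6 * A * (g2 * b - h\<^sup>2) - (4 * A - 1) * W * (6 * h\<^sup>2 - 2 * g2 * b)
      + 9 * h\<^sup>2 * A - 7 * h\<^sup>2 * W + 36 * h\<^sup>2 * W * A + 48 * h\<^sup>2 * A * W\<^sup>2 - 8 * h\<^sup>2 * W\<^sup>2)
    - 4 * b\<^sup>2 * (3 / 2 - 6 * U + 4 * (V + X) - 20 * U * (V + X) - 8 * (12 * U - 2) * V * X))"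
  have "compact (q ` cbox (0, 0, 0, 0) (1, 1, 1, 1))"
    unfolding q_def Let_def split_def by (intro compact_continuous_image continuous_intros compact_cbox)
  then have "bounded (q ` cbox (0, 0, 0, 0) (1, 1, 1, 1))"
    by (rule compact_imp_bounded)
  then obtain B where "\<forall>y\<in>q ` cbox (0, 0, 0, 0) (1, 1, 1, 1). norm y \<le> B"
    unfolding bounded_iff by blast
  then have B: "\<bar>q (A, U, V, X)\<bar> \<le> B" if "(A, U, V, X) \<in> cbox (0, 0, 0, 0) (1, 1, 1, 1)" for A U V X
    using that by simp
  define m where "m = min 1 (b\<^sup>2)"
  have m: "m > 0" "m \<le> 1" "m \<le> b\<^sup>2" using assms by (auto simp: m_def)
  have "\<bar>main_part b (1 / quad b k l \<xi>) g1 g2 (\<xi>$1) (\<xi>$2) (k * \<xi>$3) (l * \<xi>$4)\<bar> \<le> (1 / m)\<^sup>2 * B"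
    if kl: "1 \<le> k" "1 \<le> l" and \<xi>: "(\<xi>$1)\<^sup>2 + (\<xi>$2)\<^sup>2 + (\<xi>$3)\<^sup>2 + (\<xi>$4)\<^sup>2 = 1" for k l :: real and \<xi> :: "real^4"
  proof -
    define r where "r = 1 / quad b k l \<xi>"
    define A where "A = r * (\<xi>$1)\<^sup>2"
    define U where "U = r * b\<^sup>2 * (\<xi>$2)\<^sup>2"
    define V where "V = r * b\<^sup>2 * (k * \<xi>$3)\<^sup>2"
    define X where "X = r * b\<^sup>2 * (l * \<xi>$4)\<^sup>2"
    have "m * 1 \<le> quad b k l \<xi>"
    proof -
      have "1 \<le> k\<^sup>2" "1 \<le> l\<^sup>2" using kl by (simp_all add: power_mono [of 1 _ 2, simplified])
      then have "(\<xi>$3)\<^sup>2 \<le> (k * \<xi>$3)\<^sup>2" "(\<xi>$4)\<^sup>2 \<le> (l * \<xi>$4)\<^sup>2"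
        using mult_right_mono [of 1 "k\<^sup>2" "(\<xi>$3)\<^sup>2"] mult_right_mono [of 1 "l\<^sup>2" "(\<xi>$4)\<^sup>2"]
        by (simp_all add: power_mult_distrib)
      then have "(\<xi>$2)\<^sup>2 + (\<xi>$3)\<^sup>2 + (\<xi>$4)\<^sup>2 \<le> (\<xi>$2)\<^sup>2 + (k * \<xi>$3)\<^sup>2 + (l * \<xi>$4)\<^sup>2" by simp
      then have "m * ((\<xi>$2)\<^sup>2 + (\<xi>$3)\<^sup>2 + (\<xi>$4)\<^sup>2) \<le> b\<^sup>2 * ((\<xi>$2)\<^sup>2 + (k * \<xi>$3)\<^sup>2 + (l * \<xi>$4)\<^sup>2)"
        using m by (intro mult_mono) auto
      moreover have "m * (\<xi>$1)\<^sup>2 \<le> 1 * (\<xi>$1)\<^sup>2"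
        using m by (intro mult_right_mono) auto
      moreover have "m * 1 = m * (\<xi>$1)\<^sup>2 + m * ((\<xi>$2)\<^sup>2 + (\<xi>$3)\<^sup>2 + (\<xi>$4)\<^sup>2)"
        unfolding \<xi> [symmetric] by (simp add: algebra_simps)
      ultimately show ?thesis by (simp add: quad_def)
    qed
    then have quad: "quad b k l \<xi> \<ge> m" "quad b k l \<xi> > 0" using m by auto
    have r: "0 < r" "r \<le> 1 / m" using quad m by (auto simp: r_def frac_le)
    have "A + U + V + X = r * quad b k l \<xi>"
      by (simp add: A_def U_def V_def X_def quad_def algebra_simps)
    then have sum: "A + U + V + X = 1" using quad by (simp add: r_def)
    have nonneg: "0 \<le> A" "0 \<le> U" "0 \<le> V" "0 \<le> X" using r by (auto simp: A_def U_def V_def X_def)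
    have "main_part b r g1 g2 (\<xi>$1) (\<xi>$2) (k * \<xi>$3) (l * \<xi>$4) = r\<^sup>2 * q (A, U, V, X)"
      unfolding main_part_def q_def Let_def prod.case A_def U_def V_def X_def h_def
      by algebra
    moreover have "\<bar>q (A, U, V, X)\<bar> \<le> B"
      using sum nonneg by (intro B) (auto simp: cbox_Pair_eq)
    moreover have "r\<^sup>2 \<le> (1 / m)\<^sup>2" using r by (intro power_mono) auto
    ultimately show ?thesis
      unfolding r_def [symmetric] by (simp only: abs_mult) (intro mult_mono, auto)
  qed
  then show thesis by (rule that)
qed

lemma slice_integral_bounded:
  assumes "g0 \<noteq> 0"
  obtains B where "\<And>\<eta>. 0 < \<eta> \<Longrightarrow> \<eta> < pi / 2 \<Longrightarrow> \<bar>slice_integral g0 g1 g2 \<eta>\<bar> \<le> B"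
proof -
  have nz: "1 / g0 \<noteq> 0" using assms by simp
  obtain B where B: "\<And>k l \<xi>. 1 \<le> k \<Longrightarrow> 1 \<le> l \<Longrightarrow> (\<xi>$1)\<^sup>2 + (\<xi>$2)\<^sup>2 + (\<xi>$3)\<^sup>2 + (\<xi>$4)\<^sup>2 = 1 \<Longrightarrow>
    \<bar>main_part (1 / g0) (1 / quad (1 / g0) k l \<xi>) g1 g2 (\<xi>$1) (\<xi>$2) (k * \<xi>$3) (l * \<xi>$4)\<bar> \<le> B"
    using main_part_bound [OF nz, of g1 g2] by blast
  have "\<bar>slice_integral g0 g1 g2 \<eta>\<bar> \<le> B * measure lborel sphere_box" if \<eta>: "0 < \<eta>" "\<eta> < pi / 2" for \<eta>
  proof -
    note sc = sin_cos_pos [OF \<eta>]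
    define k where "k = 1 / sin \<eta>"
    define l where "l = 1 / cos \<eta>"
    have kl: "1 \<le> k" "1 \<le> l" "k \<noteq> 0" "l \<noteq> 0" using sc by (auto simp: k_def l_def)
    note cot = cot_part_integral [OF nz kl(3,4)]
    define M where "M \<theta> = sphere_weight \<theta> * main_part (1 / g0) (1 / quad (1 / g0) k l (sphere_param \<theta>)) g1 g2
      (sphere_param \<theta> $ 1) (sphere_param \<theta> $ 2) (k * sphere_param \<theta> $ 3) (l * sphere_param \<theta> $ 4)" for \<theta>
    have "((\<lambda>\<theta>. sphere_weight \<theta> * dens g0 g1 g2 \<eta> (sphere_param \<theta>)) has_integral slice_integral g0 g1 g2 \<eta>) sphere_box"
      unfolding slice_integral_def sphere_box_def
      by (intro integrable_integral integrable_continuous continuous_on_dens_slice assms \<eta>)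
    from has_integral_diff [OF this has_integral_add [OF has_integral_mult_right [OF cot(1), of "(cot \<eta>)\<^sup>2"]
      has_integral_mult_right [OF cot(2), of "(tan \<eta>)\<^sup>2"]]]
    have "(M has_integral slice_integral g0 g1 g2 \<eta>) sphere_box"
      by (simp add: M_def [abs_def] dens_quad dens_poly_def k_def [symmetric] l_def [symmetric] algebra_simps)
    moreover have "norm (M \<theta>) \<le> B" for \<theta>
    proof -
      have "\<bar>sphere_weight \<theta>\<bar> \<le> 1"
        unfolding sphere_weight_def by (simp add: abs_mult power_le_one mult_le_one abs_square_le_1)
      from mult_mono [OF this B [OF kl(1,2) sphere_param_sq [of \<theta>]]] show ?thesis
        unfolding M_def real_norm_def abs_mult by simp
    qed
    moreover have "0 \<le> B"
      using B [OF kl(1,2) sphere_param_sq [of undefined]] by simp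
    ultimately have "norm (slice_integral g0 g1 g2 \<eta>) \<le> B * measure lborel sphere_box"
      unfolding sphere_box_def by (intro has_integral_bound)
    then show ?thesis by simp
  qed
  then show thesis by (rule that)
qed

lemma set_integrable_bounded_continuous:
  fixes f :: "real \<Rightarrow> real"
  assumes "continuous_on {a<..<b} f" "\<And>x. a < x \<Longrightarrow> x < b \<Longrightarrow> \<bar>f x\<bar> \<le> B"
  shows "set_integrable lborel {a<..<b} f"
proof -
  have "(\<lambda>x. indicator {a<..<b} x *\<^sub>R f x) \<in> borel_measurable borel"
    by (rule borel_measurable_continuous_on_indicator) (use assms in auto)
  moreover have "emeasure lborel {a<..<b} < \<infinity>"
    by (cases "a \<le> b") auto
  ultimately show ?thesis
    unfolding set_integrable_def
    by (intro integrableI_bounded_set [where A = "{a<..<b}" and B = B])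
       (use assms(2) in \<open>auto simp: indicator_def\<close>)
qed

lemma slice_integral_integrable:
  assumes "g0 \<noteq> 0"
  shows "set_integrable lborel {0<..<pi/2} (slice_integral g0 g1 g2)"
proof -
  obtain B where "\<And>\<eta>. 0 < \<eta> \<Longrightarrow> \<eta> < pi / 2 \<Longrightarrow> \<bar>slice_integral g0 g1 g2 \<eta>\<bar> \<le> B"
    using slice_integral_bounded [OF assms, of g1 g2] by blast
  then show ?thesis by (rule set_integrable_bounded_continuous [OF continuous_on_slice_integral [OF assms]])
qed

section \<open>Reflections of the sphere and the quarter sphere\<close>

lemma integral_reflect_shift:
  fixes f :: "real \<Rightarrow> real"
  shows "integral {a..b} (\<lambda>x. f (c - x)) = integral {c - b..c - a} f"
proof -
  have "integral {a..b} (\<lambda>x. f (c - x)) = integral {- (- a)..- (- b)} (\<lambda>x. (f \<circ> (+) c) (- x))"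
    by simp
  also have "\<dots> = integral {- b..- a} (f \<circ> (+) c)"
    using Henstock_Kurzweil_Integration.integral_reflect_real [where f = "f \<circ> (+) c" and a = "- b" and b = "- a"] by simp
  also have "\<dots> = integral {- b + c..- a + c} f"
    using has_integral_shift_Icc_real [of f c _ "- b" "- a"]
    by (metis has_integral_integrable_integral has_integral_iff integrable_integral not_integrable_integral)
  finally show ?thesis by (simp add: algebra_simps)
qed

lemma integral_reflect_fst:
  fixes f :: "real \<times> 'b::euclidean_space \<Rightarrow> real"
  assumes "continuous_on UNIV f"
  shows "integral (cbox (0, c) (h, d)) (\<lambda>p. f (h - fst p, snd p)) = integral (cbox (0, c) (h, d)) f"
proof -
  have f: "continuous_on S f" for S by (rule continuous_on_subset [OF assms]) simp
  have f': "continuous_on S (\<lambda>p. f (h - fst p, snd p))" for S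
    by (rule continuous_on_compose2 [OF assms]) (auto intro!: continuous_intros)
  have "integral (cbox (0, c) (h, d)) (\<lambda>p. f (h - fst p, snd p)) =
      integral {0..h} (\<lambda>x. integral (cbox c d) (\<lambda>y. f (h - x, y)))"
    by (subst integral_prod_continuous [OF f']) simp
  also have "\<dots> = integral {h - h..h - 0} (\<lambda>x. integral (cbox c d) (\<lambda>y. f (x, y)))"
    by (rule integral_reflect_shift)
  also have "\<dots> = integral (cbox (0, c) (h, d)) f"
    by (subst integral_prod_continuous [OF f]) simp
  finally show ?thesis .
qed

lemma integral_half_fst:
  fixes f :: "real \<times> 'b::euclidean_space \<Rightarrow> real"
  assumes "continuous_on UNIV f" "0 \<le> h" "\<And>x y. f (2 * h - x, y) = f (x, y)"
  shows "integral (cbox (0, c) (2 * h, d)) f = 2 * integral (cbox (0, c) (h, d)) f"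
proof -
  have f: "continuous_on S f" for S by (rule continuous_on_subset [OF assms(1)]) simp
  define g where "g x = integral (cbox c d) (\<lambda>y. f (x, y))" for x
  have "continuous_on {0..2 * h} g"
    unfolding g_def by (rule integral_continuous_on_param) (use f in \<open>simp add: split_def\<close>)
  then have "integral {0..2 * h} g = integral {0..h} g + integral {h..2 * h} g"
    by (intro Henstock_Kurzweil_Integration.integral_combine [symmetric]) (use assms(2) in \<open>auto intro: integrable_continuous_real\<close>)
  also have "integral {h..2 * h} g = integral {2 * h - h..2 * h - 0} g" by simp
  also have "\<dots> = integral {0..h} (\<lambda>x. g (2 * h - x))"
    by (rule integral_reflect_shift [symmetric])
  also have "\<dots> = integral {0..h} g"
    by (simp add: g_def [abs_def] assms(3))
  finally show ?thesis
    unfolding g_def by (simp add: integral_prod_continuous [OF f])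
qed

definition quarter_box :: "R3 set" where
  "quarter_box = cbox (0, 0, 0) (pi / 2, pi / 2, 2 * pi)"

text \<open>In hyperspherical angles the reflections in \<xi>_1 and \<xi>_2 are \<theta>_1 to \<pi>
  - \<theta>_1 and \<theta>_2 to \<pi> - \<theta>_2, so each invariance halves one side of the
  box.\<close>

lemma integral_quarter:
  fixes f :: "R3 \<Rightarrow> real"
  assumes "continuous_on UNIV f" "\<And>x y z. f (pi - x, y, z) = f (x, y, z)" "\<And>x y z. f (x, pi - y, z) = f (x, y, z)"
  shows "integral sphere_box f = 4 * integral quarter_box f"
proof -
  have f: "continuous_on S f" for S by (rule continuous_on_subset [OF assms(1)]) simp
  have f2: "continuous_on S (\<lambda>q. f (x, q))" for x S
    by (rule continuous_on_compose2 [OF assms(1)]) (auto intro!: continuous_intros)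
  have "integral sphere_box f = integral (cbox (0, (0, 0)) (2 * (pi / 2), (pi, 2 * pi))) f"
    by (simp add: sphere_box_def)
  also have "\<dots> = 2 * integral (cbox (0, (0, 0)) (pi / 2, (pi, 2 * pi))) f"
    by (rule integral_half_fst) (use assms in auto)
  also have "integral (cbox (0, (0, 0)) (pi / 2, (pi, 2 * pi))) f
    = integral (cbox 0 (pi / 2)) (\<lambda>x. integral (cbox (0, 0) (2 * (pi / 2), 2 * pi)) (\<lambda>q. f (x, q)))"
    by (subst integral_prod_continuous [OF f]) simp
  also have "\<dots> = integral (cbox 0 (pi / 2)) (\<lambda>x. 2 * integral (cbox (0, 0) (pi / 2, 2 * pi)) (\<lambda>q. f (x, q)))"
    by (intro integral_cong integral_half_fst f2) (use assms in auto)
  also have "\<dots> = 2 * integral quarter_box f"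
    unfolding quarter_box_def by (subst integral_prod_continuous [OF f]) simp
  finally show ?thesis by simp
qed

lemma sphere_weight_reflect:
  "sphere_weight (pi - x, y, z) = sphere_weight (x, y, z)" "sphere_weight (x, pi - y, z) = sphere_weight (x, y, z)"
  by (simp_all add: sphere_weight_def)

lemma slice_integral_quarter:
  assumes "g0 \<noteq> 0" "0 < \<eta>" "\<eta> < pi / 2"
  shows "slice_integral g0 g1 g2 \<eta> = 4 * integral quarter_box (\<lambda>\<theta>. sphere_weight \<theta> * dens g0 g1 g2 \<eta> (sphere_param \<theta>))"
  unfolding slice_integral_def
  by (rule integral_quarter [OF continuous_on_dens_slice [OF assms]])
     (simp_all add: sphere_weight_reflect, simp_all add: dens_def Let_def full_poly_flip)

text \<open>Connects the gauge integrals over closed boxes, used for Fubini and the divergences,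
  with the Lebesgue integrals over open boxes in the definitions.\<close>

lemma set_integral_open_box:
  fixes f :: "R3 \<Rightarrow> real"
  assumes "continuous_on UNIV f"
  shows "set_integrable lborel ({0<..<a} \<times> {0<..<b} \<times> {0<..<c}) f" (is ?t1)
    and "(LINT \<theta> : {0<..<a} \<times> {0<..<b} \<times> {0<..<c} | lborel. f \<theta>) = integral (cbox (0, 0, 0) (a, b, c)) f" (is ?t2)
proof -
  have box: "{0<..<a} \<times> {0<..<b} \<times> {0<..<c} = box (0, 0, 0) (a, b, c)"
    by (simp add: box_prod)
  have "set_integrable lborel (cbox (0, 0, 0) (a, b, c)) f"
    unfolding set_integrable_def
    by (rule borel_integrable_compact) (auto intro: continuous_on_subset [OF assms])
  then have *: "set_integrable lborel (box (0, 0, 0) (a, b, c)) f"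
    by (rule set_integrable_subset) (auto simp: box_subset_cbox)
  then show ?t1 by (simp only: box)
  show ?t2
    unfolding box set_borel_integral_eq_integral(2) [OF *] by (rule integral_open_interval)
qed

section \<open>The forms in the coordinates u\<close>

lemma dwedge_3:
  "dwedge [i, j, k] [a, b, c] = a$i * (b$j * c$k - b$k * c$j) - a$j * (b$i * c$k - b$k * c$i) + a$k * (b$i * c$j - b$j * c$i)"
proof -
  have l: "length [i, j, k] = 3" by simp
  have s: "{..<3::nat} = {0, 1, 2}" by (auto simp: lessThan_nat_numeral)
  have f: "finite {1::nat, 2}" "0 \<notin> {1::nat, 2}" "finite {2::nat}" "1 \<notin> {2::nat}" by auto
  show ?thesis
    unfolding dwedge_def l s sum_over_permutations_insert [OF f(1,2)] sum_over_permutations_insert [OF f(3,4)] permutes_sing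
    by (simp add: sign_swap_id permutation_swap_id sign_compose permutation_compose sign_id transpose_def algebra_simps)
qed

text \<open>Laplace expansion along the first vector.\<close>

lemma dwedge_4:
  "dwedge [i, j, k, l] [a, b, c, d] = a$i * dwedge [j, k, l] [b, c, d] - a$j * dwedge [i, k, l] [b, c, d]
     + a$k * dwedge [i, j, l] [b, c, d] - a$l * dwedge [i, j, k] [b, c, d]"
proof -
  have l: "length [i, j, k, l] = 4" by simp
  have s: "{..<4::nat} = {0, 1, 2, 3}" by (auto simp: lessThan_nat_numeral)
  have f: "finite {1::nat, 2, 3}" "0 \<notin> {1::nat, 2, 3}" "finite {2::nat, 3}" "1 \<notin> {2::nat, 3}" "finite {3::nat}" "2 \<notin> {3::nat}" by auto
  show ?thesis
    unfolding dwedge_def [of "[i, j, k, l]"] l s sum_over_permutations_insert [OF f(1,2)] sum_over_permutations_insert [OF f(3,4)]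
      sum_over_permutations_insert [OF f(5,6)] permutes_sing
    by (simp add: sign_swap_id permutation_swap_id sign_compose permutation_compose sign_id transpose_def dwedge_3)
      (simp add: algebra_simps)
qed

lemma exhaust_5: "i = 0 \<or> i = 1 \<or> i = 2 \<or> i = 3 \<or> i = (4 :: 5)"
proof (induct i)
  case (of_int z)
  then have "0 \<le> z" "z < 5" by simp_all
  then have "z = 0 \<or> z = 1 \<or> z = 2 \<or> z = 3 \<or> z = 4" by arith
  then show ?case by auto
qed

lemma forall_5: "(\<forall>i::5. P i) \<longleftrightarrow> P 0 \<and> P 1 \<and> P 2 \<and> P 3 \<and> P 4"
  by (metis exhaust_5)

definition sphere_deriv :: "R3 \<Rightarrow> R3 \<Rightarrow> real^4" where
  "sphere_deriv = (\<lambda>(x, y, z) (h1, h2, h3). vector [- sin x * h1, cos x * cos y * h1 - sin x * sin y * h2,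
     cos x * sin y * cos z * h1 + sin x * cos y * cos z * h2 - sin x * sin y * sin z * h3,
     cos x * sin y * sin z * h1 + sin x * cos y * sin z * h2 + sin x * sin y * cos z * h3])"

lemma sphere_deriv_nth:
  "sphere_deriv (x, y, z) h $ 1 = - sin x * fst h"
  "sphere_deriv (x, y, z) h $ 2 = cos x * cos y * fst h - sin x * sin y * fst (snd h)"
  "sphere_deriv (x, y, z) h $ 3 = cos x * sin y * cos z * fst h + sin x * cos y * cos z * fst (snd h) - sin x * sin y * sin z * snd (snd h)"
  "sphere_deriv (x, y, z) h $ 4 = cos x * sin y * sin z * fst h + sin x * cos y * sin z * fst (snd h) + sin x * sin y * cos z * snd (snd h)"
  by (simp_all add: sphere_deriv_def split_def)

lemma has_derivative_sphere_param: "(sphere_param has_derivative sphere_deriv \<theta>) (at \<theta>)"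
proof (rule has_derivative_vecI)
  show "((\<lambda>\<theta>. sphere_param \<theta> $ i) has_derivative (\<lambda>h. sphere_deriv \<theta> h $ i)) (at \<theta>)" for i
    using exhaust_4 [of i]
    by (elim disjE; simp add: sphere_param_def sphere_deriv_def split_def)
      (auto intro!: derivative_eq_intros simp: fun_eq_iff algebra_simps)
qed

lemma sigma_xi3_sphere:
  "sigma_xi3 (sphere_param \<theta>) (map (sphere_deriv \<theta>) [(1, 0, 0), (0, 1, 0), (0, 0, 1)]) = sphere_weight \<theta>"
proof (cases \<theta>)
  case (fields x y z)
  have s: "(sin x)\<^sup>2 + (cos x)\<^sup>2 = 1" "(sin y)\<^sup>2 + (cos y)\<^sup>2 = 1" "(sin z)\<^sup>2 + (cos z)\<^sup>2 = 1" by simp_all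
  show ?thesis
    unfolding sigma_xi3_def list.map dwedge_3 fields sphere_deriv_nth sphere_param_nth sphere_weight_def fst_conv snd_conv
    using s by algebra
qed

lemma sphere_pullback:
  "pullback sphere_param (\<lambda>\<xi> vs. g \<xi> * of_real (sigma_xi3 \<xi> vs)) \<theta> [(1, 0, 0), (0, 1, 0), (0, 0, 1)]
     = g (sphere_param \<theta>) * of_real (sphere_weight \<theta>)"
  unfolding pullback_def frechet_derivative_at [OF has_derivative_sphere_param, symmetric] sigma_xi3_sphere ..

section \<open>The coordinate change and the orientation form\<close>

definition of_u_deriv :: "real^5 \<Rightarrow> real^5 \<Rightarrow> real^5" where
  "of_u_deriv u v = (\<chi> i. if i = 0 then v$0 / (2 * sqrt (u$0) * sqrt (1 - u$0))
     else if i = 3 then sqrt (u$0) * v$3 + u$3 / (2 * sqrt (u$0)) * v$0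
     else if i = 4 then sqrt (1 - u$0) * v$4 - u$4 / (2 * sqrt (1 - u$0)) * v$0
     else v$i)"

lemma has_derivative_of_u:
  assumes "0 < u$0" "u$0 < 1"
  shows "(of_u has_derivative of_u_deriv u) (at u)"
proof (rule has_derivative_vecI)
  fix i :: 5
  have s: "0 < sqrt (u$0)" "sqrt (u$0) < 1" "- 1 < sqrt (u$0)"
    using assms by (auto intro: less_trans [of _ 0])
  have d: "((\<lambda>u::real^5. arcsin (sqrt (u$0))) has_derivative (\<lambda>v. v$0 / (2 * sqrt (u$0) * sqrt (1 - u$0)))) (at u)"
  proof -
    have "((\<lambda>x. arcsin (sqrt x)) has_real_derivative 1 / (2 * sqrt (u$0) * sqrt (1 - u$0))) (at (u$0))"
      using s assms by (auto intro!: derivative_eq_intros simp: field_simps)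
    from has_derivative_compose [OF has_derivative_nth this [unfolded has_field_derivative_def]]
    show ?thesis by simp
  qed
  show "((\<lambda>x. of_u x $ i) has_derivative (\<lambda>h. of_u_deriv u h $ i)) (at u)"
    using exhaust_5 [of i] assms s d
    by (elim disjE; simp add: of_u_def of_u_deriv_def)
       (auto intro!: has_derivative_nth derivative_eq_intros simp: fun_eq_iff field_simps)
qed

text \<open>All square roots cancel: d\<eta> brings 1 / (2 sqrt(u_0) sqrt(1 - u_0)), while \<xi>_3
  and \<xi>_4 bring sqrt(u_0) and sqrt(1 - u_0), leaving the constant 1/2. The du_0 components of
  d\<xi>_3 and d\<xi>_4 drop out because every summand already contains d\<eta>.\<close>

lemma A4_orientation_eq:
  assumes "0 < u$0" "u$0 < 1" "length vs = 4"
  shows "A4_orientation u vs = (u$1 * dwedge [0, 2, 3, 4] vs - u$2 * dwedge [0, 1, 3, 4] vs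
     + u$3 * dwedge [0, 1, 2, 4] vs - u$4 * dwedge [0, 1, 2, 3] vs) / 2"
proof -
  obtain a b c d where vs: "vs = [a, b, c, d]"
    using assms(3) by (auto simp: length_Suc_conv eval_nat_numeral)
  define p where "p = sqrt (u$0)"
  define q where "q = sqrt (1 - u$0)"
  define h where "h = 1 / (2 * p * q)"
  define s3 where "s3 = u$3 / (2 * p)"
  define s4 where "s4 = u$4 / (2 * q)"
  have pq: "p * q * h = 1 / 2" using assms by (simp add: p_def q_def h_def)
  have comp: "of_u_deriv u v $ 0 = h * v$0" "of_u_deriv u v $ 1 = v$1" "of_u_deriv u v $ 2 = v$2"
    "of_u_deriv u v $ 3 = p * v$3 + s3 * v$0" "of_u_deriv u v $ 4 = q * v$4 - s4 * v$0" for v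
    by (simp_all add: of_u_deriv_def p_def q_def h_def s3_def s4_def)
  \<comment> \<open>The last two wedges lack one of the factors \<open>p\<close>, \<open>q\<close>;
    it is supplied by the coefficients \<open>p * u$3\<close> and \<open>q * u$4\<close> of the
    form.\<close>
  have w: "dwedge [0, 2, 3, 4] (map (of_u_deriv u) vs) = p * q * h * dwedge [0, 2, 3, 4] vs"
    "dwedge [0, 1, 3, 4] (map (of_u_deriv u) vs) = p * q * h * dwedge [0, 1, 3, 4] vs"
    "dwedge [0, 1, 2, 4] (map (of_u_deriv u) vs) = q * h * dwedge [0, 1, 2, 4] vs"
    "dwedge [0, 1, 2, 3] (map (of_u_deriv u) vs) = p * h * dwedge [0, 1, 2, 3] vs"
    unfolding vs list.map dwedge_4 dwedge_3 comp by (simp_all add: algebra_simps)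
  have "A4_orientation u vs = eta_sigma (of_u u) (map (of_u_deriv u) vs)"
    unfolding A4_orientation_def pullback_def frechet_derivative_at [OF has_derivative_of_u [OF assms(1,2)], symmetric] ..
  also have "\<dots> = p * q * h * (u$1 * dwedge [0, 2, 3, 4] vs - u$2 * dwedge [0, 1, 3, 4] vs
     + u$3 * dwedge [0, 1, 2, 4] vs - u$4 * dwedge [0, 1, 2, 3] vs)"
  proof -
    have "of_u u $ 1 = u$1" "of_u u $ 2 = u$2" "of_u u $ 3 = p * u$3" "of_u u $ 4 = q * u$4"
      by (simp_all add: of_u_def p_def q_def)
    then show ?thesis unfolding eta_sigma_def w by (simp add: algebra_simps)
  qed
  finally show ?thesis unfolding pq by simp
qed

lemma jet_has_deriv: "(jet g0 g1 g2 has_real_derivative g1 + g2 * s) (at s)"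
  unfolding jet_def by (auto intro!: derivative_eq_intros)

lemma deriv_jet: "deriv (jet g0 g1 g2) = (\<lambda>s. g1 + g2 * s)"
  by (rule ext, rule DERIV_imp_deriv, rule jet_has_deriv)

lemma deriv_deriv_jet: "deriv (deriv (jet g0 g1 g2)) = (\<lambda>s. g2)"
  unfolding deriv_jet by (rule ext, rule DERIV_imp_deriv) (auto intro!: derivative_eq_intros)

lemma scale_factor_jet: "scale_factor (jet g0 g1 g2) {s. jet g0 g1 g2 s \<noteq> 0}"
proof
  have "continuous_on UNIV (jet g0 g1 g2)"
    unfolding jet_def by (intro continuous_intros) auto
  then have "open (jet g0 g1 g2 -` (- {0}))"
    by (intro open_vimage) auto
  then show "open {s. jet g0 g1 g2 s \<noteq> 0}" by (simp add: vimage_def)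
  show "(jet g0 g1 g2 has_real_derivative deriv (jet g0 g1 g2) s) (at s)" for s
    by (simp add: deriv_jet jet_has_deriv)
  show "(deriv (jet g0 g1 g2) has_real_derivative deriv (deriv (jet g0 g1 g2)) s) (at s)" for s
    unfolding deriv_deriv_jet unfolding deriv_jet by (auto intro!: derivative_eq_intros)
qed auto

lemma b4_jet_eq_dens:
  assumes "g0 \<noteq> 0" "0 < \<eta>" "\<eta> < pi / 2" "\<xi> \<noteq> 0"
  shows "b4_jet g0 g1 g2 \<eta> \<xi> = of_real (dens g0 g1 g2 \<eta> \<xi>)"
  unfolding b4_jet_def
  by (subst scale_factor.b4_eq_dens [OF scale_factor_jet])
     (use assms in \<open>simp_all add: deriv_deriv_jet, simp_all add: deriv_jet jet_def\<close>)

lemma scale_factor_smooth: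
  assumes "open T" "smooth_at_all T a" "\<forall>s\<in>T. a s > 0"
  shows "scale_factor a T"
proof
  have d: "(deriv ^^ n) a differentiable (at s)" if "s \<in> T" for n s
    using assms(2) that by (simp add: smooth_at_all_def)
  show "(a has_real_derivative deriv a s) (at s)" if "s \<in> T" for s
    using d [OF that, of 0] DERIV_deriv_iff_real_differentiable by auto
  show "(deriv a has_real_derivative deriv (deriv a) s) (at s)" if "s \<in> T" for s
    using d [OF that, of 1] DERIV_deriv_iff_real_differentiable by auto
qed (use assms in force)+

definition Omega_density :: "real \<Rightarrow> real \<Rightarrow> real \<Rightarrow> real^5 \<Rightarrow> real" where
  "Omega_density g0 g1 g2 u = dens_poly (1 / g0) (1 / Q2 g0 u) g1 g2 ((1 - u$0) / u$0) (u$0 / (1 - u$0))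
     (u$1) (u$2) (u$3) (u$4)"

lemma xi_part_of_u:
  "xi_part (of_u u) $ 1 = u$1" "xi_part (of_u u) $ 2 = u$2"
  "xi_part (of_u u) $ 3 = sqrt (u$0) * u$3" "xi_part (of_u u) $ 4 = sqrt (1 - u$0) * u$4"
  by (simp_all add: xi_part_def of_u_def)

lemma arcsin_sqrt:
  assumes "0 < s" "s < 1"
  shows "0 < arcsin (sqrt s)" "arcsin (sqrt s) < pi / 2" "sin (arcsin (sqrt s)) = sqrt s" "cos (arcsin (sqrt s)) = sqrt (1 - s)"
proof -
  have s: "0 < sqrt s" "sqrt s < 1" "- 1 \<le> sqrt s" using assms by (auto intro: order_trans [of _ 0])
  show "0 < arcsin (sqrt s)" using arcsin_less_arcsin [of 0 "sqrt s"] s by simp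
  show "arcsin (sqrt s) < pi / 2" using arcsin_lt_bounded [of "sqrt s"] s by auto
  show "sin (arcsin (sqrt s)) = sqrt s" using s by simp
  show "cos (arcsin (sqrt s)) = sqrt (1 - s)" using s assms by (simp add: cos_arcsin)
qed

lemma dens_of_u:
  assumes "0 < u$0" "u$0 < 1"
  shows "dens g0 g1 g2 (arcsin (sqrt (u$0))) (xi_part (of_u u)) = Omega_density g0 g1 g2 u"
  using assms
  by (simp add: dens_def Let_def xi_part_of_u arcsin_sqrt Omega_density_def Q2_def cot_def tan_def power_divide)

lemma Omega_eq:
  assumes "0 < u$0" "u$0 < 1" "g0 \<noteq> 0" "Q2 g0 u \<noteq> 0"
  shows "Omega g0 g1 g2 u vs = of_real (Omega_density g0 g1 g2 u * A4_orientation u vs)"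
proof -
  \<comment> \<open>For 0 < u_0 < 1 the covector vanishes only where \<open>Q2\<close> does, so the
    removed hypersurface keeps \<xi> away from the singularity of the parametrix.\<close>
  have nz: "xi_part (of_u u) \<noteq> 0"
  proof
    assume "xi_part (of_u u) = 0"
    then have "u$1 = 0" "u$2 = 0" "sqrt (u$0) * u$3 = 0" "sqrt (1 - u$0) * u$4 = 0"
      using xi_part_of_u [of u] by (metis zero_index)+
    then show False using assms by (simp add: Q2_def)
  qed
  have "of_u u $ 0 = arcsin (sqrt (u$0))" by (simp add: of_u_def)
  then show ?thesis
    using b4_jet_eq_dens [OF assms(3) arcsin_sqrt(1,2) [OF assms(1,2)] nz, of g1 g2]
    by (simp add: Omega_def A4_orientation_def pullback_def dens_of_u assms)
qed

section \<open>Regular functions and the algebraic form\<close>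

lemma polynomial_over_power: "1 \<in> K \<Longrightarrow> polynomial_over K P \<Longrightarrow> polynomial_over K (\<lambda>u. P u ^ n)"
  by (induction n) (auto intro: polynomial_over.intros)

lemma polynomial_over_prod:
  assumes "1 \<in> K" "\<And>g. g \<in> G \<Longrightarrow> polynomial_over K g"
  shows "polynomial_over K (\<lambda>u. \<Prod>g\<in>G. g u)"
  using assms(2) by (induction G rule: infinite_finite_induct) (auto intro: polynomial_over.intros assms(1))

lemma real_subfieldD:
  assumes "real_subfield K"
  shows "1 \<in> K" "0 \<in> K" "x \<in> K \<Longrightarrow> y \<in> K \<Longrightarrow> x - y \<in> K" "x \<in> K \<Longrightarrow> y \<in> K \<Longrightarrow> x * y \<in> K"
    "x \<in> K \<Longrightarrow> y \<in> K \<Longrightarrow> x / y \<in> K" "x \<in> K \<Longrightarrow> - x \<in> K" "x \<in> K \<Longrightarrow> y \<in> K \<Longrightarrow> x + y \<in> K"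
    "x \<in> K \<Longrightarrow> x ^ n \<in> K" "numeral m \<in> K"
proof -
  show 1: "1 \<in> K" and d: "\<And>x y. x \<in> K \<Longrightarrow> y \<in> K \<Longrightarrow> x - y \<in> K" and m: "\<And>x y. x \<in> K \<Longrightarrow> y \<in> K \<Longrightarrow> x * y \<in> K"
    and "\<And>x y. x \<in> K \<Longrightarrow> y \<in> K \<Longrightarrow> x / y \<in> K"
    using assms by (auto simp: real_subfield_def)
  show 0: "0 \<in> K" using d [OF 1 1] by simp
  show n: "\<And>x. x \<in> K \<Longrightarrow> - x \<in> K" using d [OF 0] by simp
  show a: "\<And>x y. x \<in> K \<Longrightarrow> y \<in> K \<Longrightarrow> x + y \<in> K" using d [OF _ n] by simp
  show "x \<in> K \<Longrightarrow> x ^ n \<in> K" by (induction n) (auto intro: 1 m)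
  have "real k \<in> K" for k by (induction k) (auto intro: 0 1 a)
  then show "numeral m \<in> K" by (metis of_nat_numeral)
qed

lemma rationals_subfield: "real_subfield \<rat>"
  by (simp add: real_subfield_def)

context
  fixes K :: "real set" and G :: "(real^'n \<Rightarrow> real) set"
  assumes K: "real_subfield K" and G: "finite G" "\<And>g. g \<in> G \<Longrightarrow> polynomial_over K g"
begin

lemma prod_nz: "u \<in> - zeros_of G \<Longrightarrow> (\<Prod>g\<in>G. g u) \<noteq> 0"
  using G(1) by (auto simp: zeros_of_def)

lemma regular_poly: "polynomial_over K P \<Longrightarrow> regular_function K G P"
  unfolding regular_function_def by (intro exI [of _ P] exI [of _ 0]) simp

lemma regular_const: "c \<in> K \<Longrightarrow> regular_function K G (\<lambda>u. c)"
  by (intro regular_poly polynomial_over.const)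

lemma regular_coord: "regular_function K G (\<lambda>u. u $ i)"
  by (intro regular_poly polynomial_over.coord)

lemma regular_add:
  assumes "regular_function K G f" "regular_function K G g"
  shows "regular_function K G (\<lambda>u. f u + g u)"
proof -
  obtain P m where P: "polynomial_over K P" "\<And>u. u \<in> - zeros_of G \<Longrightarrow> f u = P u / (\<Prod>g\<in>G. g u) ^ m"
    using assms(1) unfolding regular_function_def by blast
  obtain Q n where Q: "polynomial_over K Q" "\<And>u. u \<in> - zeros_of G \<Longrightarrow> g u = Q u / (\<Prod>g\<in>G. g u) ^ n"
    using assms(2) unfolding regular_function_def by blast
  have pr: "polynomial_over K (\<lambda>u. (\<Prod>g\<in>G. g u) ^ j)" for j
    by (intro polynomial_over_power polynomial_over_prod real_subfieldD(1) [OF K] G)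
  show ?thesis
    unfolding regular_function_def
  proof (intro exI conjI ballI)
    show "polynomial_over K (\<lambda>u. P u * (\<Prod>g\<in>G. g u) ^ n + Q u * (\<Prod>g\<in>G. g u) ^ m)"
      by (intro polynomial_over.intros P Q pr)
    fix u assume u: "u \<in> - zeros_of G"
    show "f u + g u = (P u * (\<Prod>g\<in>G. g u) ^ n + Q u * (\<Prod>g\<in>G. g u) ^ m) / (\<Prod>g\<in>G. g u) ^ (m + n)"
      unfolding P(2) [OF u] Q(2) [OF u] using prod_nz [OF u] by (simp add: power_add add_divide_distrib)
  qed
qed

lemma regular_mult:
  assumes "regular_function K G f" "regular_function K G g"
  shows "regular_function K G (\<lambda>u. f u * g u)"
proof -
  obtain P m where P: "polynomial_over K P" "\<And>u. u \<in> - zeros_of G \<Longrightarrow> f u = P u / (\<Prod>g\<in>G. g u) ^ m"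
    using assms(1) unfolding regular_function_def by blast
  obtain Q n where Q: "polynomial_over K Q" "\<And>u. u \<in> - zeros_of G \<Longrightarrow> g u = Q u / (\<Prod>g\<in>G. g u) ^ n"
    using assms(2) unfolding regular_function_def by blast
  show ?thesis
    unfolding regular_function_def
    by (intro exI [of _ "\<lambda>u. P u * Q u"] exI [of _ "m + n"] conjI ballI polynomial_over.intros P Q)
       (simp add: P(2) Q(2) power_add)
qed

lemma regular_minus: "regular_function K G f \<Longrightarrow> regular_function K G (\<lambda>u. - f u)"
  using regular_mult [OF regular_const [of "- 1"], of f] real_subfieldD(1,6) [OF K] by simp

lemma regular_diff: "regular_function K G f \<Longrightarrow> regular_function K G g \<Longrightarrow> regular_function K G (\<lambda>u. f u - g u)"
  using regular_add [OF _ regular_minus, of f g] by simp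

lemma regular_power: "regular_function K G f \<Longrightarrow> regular_function K G (\<lambda>u. f u ^ n)"
  by (induction n) (auto intro: regular_const regular_mult real_subfieldD(1) [OF K])

lemma regular_divide_const: "regular_function K G f \<Longrightarrow> c \<in> K \<Longrightarrow> regular_function K G (\<lambda>u. f u / c)"
  using regular_mult [OF _ regular_const [of "1 / c"], of f] real_subfieldD(1,5) [OF K] by simp

text \<open>The product of the remaining equations is the numerator over the common denominator.
  This is how each of the three removed hypersurfaces becomes an admissible pole.\<close>

lemma regular_inverse:
  assumes "g \<in> G"
  shows "regular_function K G (\<lambda>u. 1 / g u)"
  unfolding regular_function_def
proof (intro exI conjI ballI)
  show "polynomial_over K (\<lambda>u. \<Prod>g\<in>G - {g}. g u)"
    by (intro polynomial_over_prod real_subfieldD(1) [OF K] G) auto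
  fix u assume "u \<in> - zeros_of G"
  then have "g u \<noteq> 0" "(\<Prod>g\<in>G - {g}. g u) \<noteq> 0"
    using G(1) assms by (auto simp: zeros_of_def)
  then show "1 / g u = (\<Prod>g\<in>G - {g}. g u) / (\<Prod>g\<in>G. g u) ^ 1"
    using prod.remove [OF G(1) assms, of "\<lambda>g. g u"] by simp
qed

end

lemma regular_cong:
  assumes "regular_function K G f" "\<And>u. u \<in> - zeros_of G \<Longrightarrow> f u = g u"
  shows "regular_function K G g"
  using assms unfolding regular_function_def by metis

lemma Q2_polynomial:
  assumes "real_subfield K" "g0 \<in> K"
  shows "polynomial_over K (Q2 g0)"
proof -
  have "polynomial_over K (\<lambda>u::real^5. (u$1)\<^sup>2 + (1 / g0\<^sup>2) * ((u$2)\<^sup>2 + (u$3)\<^sup>2 + (u$4)\<^sup>2))"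
    using assms by (intro polynomial_over.intros polynomial_over_power real_subfieldD) auto
  then show ?thesis by (simp add: Q2_def [abs_def])
qed

lemma removed_polynomial:
  assumes "real_subfield K" "g0 \<in> K" "g \<in> removed g0"
  shows "polynomial_over K g"
proof -
  have "polynomial_over K (\<lambda>u::real^5. u$0 + - 1)"
    using assms by (intro polynomial_over.intros real_subfieldD)
  then show ?thesis
    using assms(3) Q2_polynomial [OF assms(1,2)] by (auto simp: removed_def intro: polynomial_over.intros)
qed

lemma not_removed:
  assumes "u \<in> - zeros_of (removed g0)"
  shows "Q2 g0 u \<noteq> 0" "u$0 \<noteq> 0" "1 - u$0 \<noteq> 0"
  using assms by (auto simp: zeros_of_def removed_def)

lemma Omega_density_regular:
  assumes K: "real_subfield K" "{g0, g1, g2} \<subseteq> K"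
  shows "regular_function K (removed g0) (Omega_density g0 g1 g2)"
proof -
  have KK: "g0 \<in> K" "g1 \<in> K" "g2 \<in> K" using K by auto
  have G: "finite (removed g0)" "\<And>g. g \<in> removed g0 \<Longrightarrow> polynomial_over K g"
    using removed_polynomial [OF K(1) KK(1)] by (auto simp: removed_def)
  note R = regular_const [OF K(1) G] regular_coord [OF K(1) G] regular_add [OF K(1) G] regular_mult [OF K(1) G]
    regular_minus [OF K(1) G] regular_diff [OF K(1) G] regular_power [OF K(1) G] regular_divide_const [OF K(1) G]
  have q: "regular_function K (removed g0) (\<lambda>u. 1 / Q2 g0 u)"
    by (rule regular_inverse [OF K(1) G]) (auto simp: removed_def)
  have "regular_function K (removed g0) (\<lambda>u. (1 - u$0) * (1 / u$0))"
    by (intro R real_subfieldD [OF K(1)] regular_inverse [OF K(1) G, of "\<lambda>u. u$0"]) (auto simp: removed_def)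
  then have k: "regular_function K (removed g0) (\<lambda>u. (1 - u$0) / u$0)" by simp
  \<comment> \<open>The equation in \<open>removed\<close> is \<open>u$0 - 1\<close>, opposite to
    the denominator \<open>1 - u$0\<close> of tan^2; hence the sign.\<close>
  have "regular_function K (removed g0) (\<lambda>u. - (u$0 * (1 / (u$0 - 1))))"
    by (intro R real_subfieldD [OF K(1)] regular_inverse [OF K(1) G, of "\<lambda>u. u$0 - 1"]) (auto simp: removed_def)
  then have t: "regular_function K (removed g0) (\<lambda>u. u$0 / (1 - u$0))"
    by (rule regular_cong) (simp add: minus_divide_right)
  show ?thesis
    unfolding Omega_density_def dens_poly_def main_part_def cot_part_def Let_def
    by (intro R q k t real_subfieldD [OF K(1)] KK)
qed

definition Omega_coeff :: "real \<Rightarrow> real \<Rightarrow> real \<Rightarrow> 5 list \<Rightarrow> real^5 \<Rightarrow> real" where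
  "Omega_coeff g0 g1 g2 is u = Omega_density g0 g1 g2 u * (if is = [0, 2, 3, 4] then u$1 / 2
     else if is = [0, 1, 3, 4] then - u$2 / 2 else if is = [0, 1, 2, 4] then u$3 / 2
     else if is = [0, 1, 2, 3] then - u$4 / 2 else 0)"

lemma sum_four_lists:
  fixes f :: "5 list \<Rightarrow> real"
  assumes "\<And>is. is \<notin> {[0, 2, 3, 4], [0, 1, 3, 4], [0, 1, 2, 4], [0, 1, 2, 3]} \<Longrightarrow> f is = 0"
  shows "(\<Sum>is | length is = 4. f is) = f [0, 2, 3, 4] + f [0, 1, 3, 4] + f [0, 1, 2, 4] + f [0, 1, 2, 3]"
proof -
  have fin: "finite {is :: 5 list. length is = 4}"
    using finite_lists_length_eq [of "UNIV :: 5 set" 4] by simp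
  have "(\<Sum>is | length is = 4. f is) = (\<Sum>is\<in>{[0, 2, 3, 4], [0, 1, 3, 4], [0, 1, 2, 4], [0, 1, 2, 3]}. f is)"
    by (rule sum.mono_neutral_right [OF fin]) (use assms in auto)
  then show ?thesis by (simp add: add_ac)
qed

text \<open>The algebraic continuation of \<open>Omega\<close>: its coefficients are rational in u
  on the whole complement, whereas \<open>Omega\<close> is governed by a square root substitution
  valid in the strip 0 < u_0 < 1.\<close>

definition Omega_alg :: "real \<Rightarrow> real \<Rightarrow> real \<Rightarrow> real^5 \<Rightarrow> (real^5) list \<Rightarrow> complex" where
  "Omega_alg g0 g1 g2 u vs = of_real (\<Sum>is | length is = 4. Omega_coeff g0 g1 g2 is u * dwedge is vs)"

lemma Omega_alg_eq:
  assumes "0 < u$0" "u$0 < 1" "length vs = 4"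
  shows "Omega_alg g0 g1 g2 u vs = of_real (Omega_density g0 g1 g2 u * A4_orientation u vs)"
  unfolding Omega_alg_def A4_orientation_eq [OF assms]
  by (subst sum_four_lists) (auto simp: Omega_coeff_def algebra_simps add_divide_distrib diff_divide_distrib)

lemma algebraic_form_Omega:
  assumes K: "real_subfield K" "{g0, g1, g2} \<subseteq> K"
  shows "algebraic_form K (removed g0) 4 (Omega_alg g0 g1 g2)"
proof -
  have KK: "g0 \<in> K" using K by auto
  have G: "finite (removed g0)" "\<And>g. g \<in> removed g0 \<Longrightarrow> polynomial_over K g"
    using removed_polynomial [OF K(1) KK] by (auto simp: removed_def)
  note R = regular_const [OF K(1) G] regular_coord [OF K(1) G] regular_mult [OF K(1) G]
    regular_minus [OF K(1) G] regular_divide_const [OF K(1) G] Omega_density_regular [OF K]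
  have "regular_function K (removed g0) (Omega_coeff g0 g1 g2 is)" for "is"
    unfolding Omega_coeff_def
    by (cases "is = [0, 2, 3, 4]"; cases "is = [0, 1, 3, 4]"; cases "is = [0, 1, 2, 4]"; cases "is = [0, 1, 2, 3]";
        simp; intro R real_subfieldD [OF K(1)])
  then show ?thesis
    unfolding algebraic_form_def Omega_alg_def by (intro exI [of _ "Omega_coeff g0 g1 g2"]) simp
qed

lemma restricts_Omega_alg:
  assumes "g0 \<noteq> 0"
  shows "restricts_to_Omega (Omega_alg g0 g1 g2) g0 g1 g2"
  unfolding restricts_to_Omega_def
  using Omega_eq [OF _ _ assms not_removed(1)] Omega_alg_eq by auto

lemma is_form_on_A4_orientation:
  assumes "\<And>u. u \<in> S \<Longrightarrow> 0 < u$0 \<and> u$0 < 1"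
  shows "is_form_on S 4 A4_orientation"
proof -
  define c where "c is u = (if is = [0, 2, 3, 4] then u$1 / 2
     else if is = [0, 1, 3, 4] then - u$2 / 2 else if is = [0, 1, 2, 4] then u$3 / 2
     else if is = [0, 1, 2, 3] then - u$4 / 2 else 0)" for "is" :: "5 list" and u :: "real^5"
  have "A4_orientation u vs = (\<Sum>is | length is = 4. c is u * dwedge is vs)" if "u \<in> S" "length vs = 4" for u vs
    using assms [OF that(1)] that(2)
    by (subst sum_four_lists) (auto simp: A4_orientation_eq c_def algebra_simps add_divide_distrib diff_divide_distrib)
  then show ?thesis unfolding is_form_on_def by blast
qed

section \<open>The domain of integration as a semialgebraic set\<close>

lemma Q_semialgebraic_pos:
  assumes "polynomial_over \<rat> P"
  shows "Q_semialgebraic {u. P u > 0}"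
proof -
  have "polynomial_over \<rat> (\<lambda>u. - 1 * P u)"
    by (intro polynomial_over.intros assms) auto
  then have "Q_semialgebraic (- {u. - 1 * P u \<ge> 0})"
    by (intro Q_semialgebraic.intros)
  also have "- {u. - 1 * P u \<ge> 0} = {u. P u > 0}" by auto
  finally show ?thesis .
qed

lemma Q_semialgebraic_zero:
  assumes "polynomial_over \<rat> P"
  shows "Q_semialgebraic {u. P u = 0}"
proof -
  have "polynomial_over \<rat> (\<lambda>u. - 1 * P u)"
    by (intro polynomial_over.intros assms) auto
  then have "Q_semialgebraic ({u. P u \<ge> 0} \<inter> {u. - 1 * P u \<ge> 0})"
    by (intro Q_semialgebraic.intros assms)
  also have "{u. P u \<ge> 0} \<inter> {u. - 1 * P u \<ge> 0} = {u. P u = 0}" by auto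
  finally show ?thesis .
qed

text \<open>Spelled with sums and products only, to match the generators of
  \<open>polynomial_over\<close>.\<close>

definition A4_poly :: "real^5 \<Rightarrow> real" where
  "A4_poly u = u$1 * u$1 + u$2 * u$2 + u$0 * (u$3 * u$3) + (1 + - 1 * u$0) * (u$4 * u$4) + - 1"

lemma A4_alt:
  "u \<in> A4 \<longleftrightarrow> A4_poly u = 0 \<and> 0 < u$0 \<and> u$0 < 1 \<and> 0 < u$1 \<and> u$1 < 1 \<and> 0 < u$2 \<and> u$2 < 1"
  by (auto simp: A4_def A4_poly_def power2_eq_square)

lemma Q_semialgebraic_A4: "Q_semialgebraic A4"
proof -
  have p: "polynomial_over \<rat> A4_poly" "polynomial_over \<rat> (\<lambda>u::real^5. 1 + - 1 * u$i)" for i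
    unfolding A4_poly_def by (intro polynomial_over.intros; simp)+
  have "A4 = {u. A4_poly u = 0} \<inter> ({u. u$0 > 0} \<inter> ({u. 1 + - 1 * u$0 > 0} \<inter> ({u. u$1 > 0} \<inter>
    ({u. 1 + - 1 * u$1 > 0} \<inter> ({u. u$2 > 0} \<inter> {u. 1 + - 1 * u$2 > 0})))))"
    by (auto simp: A4_alt)
  also have "Q_semialgebraic \<dots>"
    by (intro Q_semialgebraic.inter Q_semialgebraic_zero Q_semialgebraic_pos p polynomial_over.coord)
  finally show ?thesis .
qed

section \<open>Charts of the domain of integration\<close>

lemma param_chartI:
  fixes \<phi> :: "real \<times> 'p::euclidean_space \<Rightarrow> real^'n"
  assumes "open U" "inj_on \<phi> U"
    and D: "\<And>p. p \<in> U \<Longrightarrow> (\<phi> has_derivative D p) (at p)"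
    and ker: "\<And>p v. p \<in> U \<Longrightarrow> D p v = 0 \<Longrightarrow> v = 0"
    and cont: "\<And>v. continuous_on U (\<lambda>p. D p v)"
  shows "param_chart \<phi> U"
proof -
  have fr: "frechet_derivative \<phi> (at p) = D p" if "p \<in> U" for p
    using frechet_derivative_at [OF D [OF that]] by simp
  have "inj (D p)" if "p \<in> U" for p
    using linear_injective_0 [OF has_derivative_linear [OF D [OF that]]] ker [OF that] by blast
  moreover have "continuous_on U (\<lambda>p. frechet_derivative \<phi> (at p) v)" for v
    using cont [of v] by (rule continuous_on_eq) (simp add: fr)
  moreover have "\<phi> differentiable (at p)" if "p \<in> U" for p
    using D [OF that] by (rule differentiableI)
  ultimately show ?thesis
    using assms(1,2) unfolding param_chart_def by (simp add: fr)
qed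

definition R3_basis :: "R3 list" where "R3_basis = [(1, 0, 0), (0, 1, 0), (0, 0, 1)]"

lemma R3_basis: "distinct R3_basis" "set R3_basis = Basis"
  by (auto simp: R3_basis_def Basis_prod_def zero_prod_def)

lemma param_frame_R3: "param_frame R3_basis = [(1, 0), (0, (1, 0, 0)), (0, (0, 1, 0)), (0, (0, 0, 1))]"
  by (simp add: param_frame_def R3_basis_def)

text \<open>The graph of \<open>u\<^sub>1\<close> over the other coordinates covers all of \<open>A4\<close>, including the points at which the spherical
coordinates degenerate; it is what shows that no point of \<open>A4\<close> is a boundary point.\<close>

definition graph_dom :: "(real \<times> R3) set" where
  "graph_dom = {(s, x, y, z). 0 < s \<and> s < 1 \<and> 0 < x \<and> 0 < 1 - x\<^sup>2 - s * y\<^sup>2 - (1 - s) * z\<^sup>2}"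

definition graph_height :: "real \<times> R3 \<Rightarrow> real" where
  "graph_height = (\<lambda>(s, x, y, z). sqrt (1 - x\<^sup>2 - s * y\<^sup>2 - (1 - s) * z\<^sup>2))"

definition graph_chart :: "real \<times> R3 \<Rightarrow> real^5" where
  "graph_chart p = (\<chi> i. if i = 0 then fst p else if i = 1 then graph_height p else if i = 2 then fst (snd p)
     else if i = 3 then fst (snd (snd p)) else snd (snd (snd p)))"

definition graph_deriv :: "real \<times> R3 \<Rightarrow> real \<times> R3 \<Rightarrow> real^5" where
  "graph_deriv = (\<lambda>(s, x, y, z) (ds, dx, dy, dz). \<chi> i. if i = 0 then ds
     else if i = 1 then (((z\<^sup>2 - y\<^sup>2) / 2) * ds - x * dx - s * y * dy - (1 - s) * z * dz) / graph_height (s, x, y, z)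
     else if i = 2 then dx else if i = 3 then dy else dz)"

lemma open_graph_dom: "open graph_dom"
proof -
  have "graph_dom = {p. 0 < fst p} \<inter> {p. fst p < 1} \<inter> {p. 0 < fst (snd p)} \<inter>
    {p. 0 < 1 - (fst (snd p))\<^sup>2 - fst p * (fst (snd (snd p)))\<^sup>2 - (1 - fst p) * (snd (snd (snd p)))\<^sup>2}"
    by (auto simp: graph_dom_def)
  also have "open \<dots>"
    by (intro open_Int open_Collect_less continuous_intros)
  finally show ?thesis .
qed

lemma graph_chart_deriv:
  assumes "p \<in> graph_dom"
  shows "(graph_chart has_derivative graph_deriv p) (at p)"
proof (rule has_derivative_vecI)
  show "((\<lambda>p. graph_chart p $ i) has_derivative (\<lambda>h. graph_deriv p h $ i)) (at p)" for i :: 5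
    using exhaust_5 [of i] assms
    by (elim disjE; simp add: graph_chart_def graph_deriv_def graph_height_def graph_dom_def split_def)
      (auto intro!: derivative_eq_intros simp: fun_eq_iff field_simps)
qed

lemma graph_chart_inverse:
  assumes "u \<in> A4"
  shows "(u$0, u$2, u$3, u$4) \<in> graph_dom" "graph_chart (u$0, u$2, u$3, u$4) = u"
proof -
  have e: "1 - (u$2)\<^sup>2 - u$0 * (u$3)\<^sup>2 - (1 - u$0) * (u$4)\<^sup>2 = (u$1)\<^sup>2" and "0 < u$1" "0 < u$0" "u$0 < 1" "0 < u$2"
    using assms by (auto simp: A4_def)
  then show "(u$0, u$2, u$3, u$4) \<in> graph_dom" "graph_chart (u$0, u$2, u$3, u$4) = u"
    unfolding graph_dom_def graph_height_def graph_chart_def prod.case mem_Collect_eq fst_conv snd_conv e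
    by (auto simp: vec_eq_iff forall_5)
qed

lemma graph_chart_A4: "graph_chart ` graph_dom = A4"
proof
  show "graph_chart ` graph_dom \<subseteq> A4"
  proof
    fix u assume "u \<in> graph_chart ` graph_dom"
    then obtain s x y z where u: "u = graph_chart (s, x, y, z)" and sx: "0 < s" "s < 1" "0 < x"
      and pos: "0 < 1 - x\<^sup>2 - s * y\<^sup>2 - (1 - s) * z\<^sup>2" by (auto simp: graph_dom_def)
    \<comment> \<open>The upper bounds on u_1 and u_2 come for free: all four summands of the
      equation are nonnegative, and u_1, u_2 are both positive.\<close>
    have ge: "0 \<le> s * y\<^sup>2" "0 \<le> (1 - s) * z\<^sup>2" "0 < x\<^sup>2" using sx by auto
    then have "x\<^sup>2 < 1\<^sup>2" "1 - x\<^sup>2 - s * y\<^sup>2 - (1 - s) * z\<^sup>2 < 1"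
      using pos unfolding one_power2 by linarith+
    then have "x < 1" "sqrt (1 - x\<^sup>2 - s * y\<^sup>2 - (1 - s) * z\<^sup>2) < 1"
      by (auto intro: power_less_imp_less_base simp: real_sqrt_lt_1_iff)
    then show "u \<in> A4" using sx pos by (simp add: u A4_def graph_chart_def graph_height_def)
  qed
  show "A4 \<subseteq> graph_chart ` graph_dom"
    using graph_chart_inverse by (metis image_eqI subsetI)
qed

lemma positive_graph_chart: "positive_chart A4_orientation graph_chart graph_dom R3_basis"
proof -
  have "param_chart graph_chart graph_dom"
  proof (rule param_chartI [OF open_graph_dom _ graph_chart_deriv])
    show "inj_on graph_chart graph_dom"
      by (auto simp: inj_on_def graph_chart_def vec_eq_iff forall_5)
    show "v = 0" if "graph_deriv p v = 0" for p v
      using that by (cases p, cases v) (auto simp: graph_deriv_def vec_eq_iff forall_5 zero_prod_def)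
    show "continuous_on graph_dom (\<lambda>p. graph_deriv p v)" for v
    proof (rule continuous_on_vecI)
      show "continuous_on graph_dom (\<lambda>p. graph_deriv p v $ i)" for i :: 5
        using exhaust_5 [of i]
        by (elim disjE; simp add: graph_deriv_def graph_height_def split_def)
          (intro continuous_intros; force simp: graph_dom_def)+
    qed
  qed
  moreover have "pullback graph_chart A4_orientation p (param_frame R3_basis) > 0" if p: "p \<in> graph_dom" for p
  proof -
    obtain s x y z where pp: "p = (s, x, y, z)" by (cases p) auto
    define h where "h = graph_height p"
    have h: "0 < h" "h * h = 1 - x\<^sup>2 - s * y\<^sup>2 - (1 - s) * z\<^sup>2"
      using p by (auto simp: pp graph_dom_def graph_height_def h_def)
    have u: "graph_chart p $ 0 = s" "graph_chart p $ 1 = h" "graph_chart p $ 2 = x" "graph_chart p $ 3 = y" "graph_chart p $ 4 = z"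
      by (simp_all add: graph_chart_def pp h_def)
    have fr: "frechet_derivative graph_chart (at p) = graph_deriv p"
      using frechet_derivative_at [OF graph_chart_deriv [OF p]] by simp
    have len: "length (map (graph_deriv p) (param_frame R3_basis)) = 4" by (simp add: param_frame_R3)
    have s: "0 < graph_chart p $ 0" "graph_chart p $ 0 < 1" using p by (auto simp: u, auto simp: pp graph_dom_def)
    \<comment> \<open>Expanding the determinant pairs the coefficients of the orientation with the
      slopes of the graph; the equation of \<open>A4\<close> then collapses the numerator to
      1.\<close>
    have "pullback graph_chart A4_orientation p (param_frame R3_basis) = (h + x * (x / h) + y * (s * y / h) + z * ((1 - s) * z / h)) / 2"
      unfolding pullback_def fr A4_orientation_eq [OF s len] u
      unfolding param_frame_R3 list.map dwedge_4 dwedge_3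
      by (simp add: graph_deriv_def pp zero_prod_def h_def [unfolded pp, symmetric])
    also have "\<dots> = (h * h + x\<^sup>2 + s * y\<^sup>2 + (1 - s) * z\<^sup>2) / (2 * h)"
      using h(1) by (simp add: field_simps power2_eq_square)
    also have "\<dots> = 1 / (2 * h)" unfolding h(2) by simp
    finally show ?thesis using h(1) by simp
  qed
  ultimately show ?thesis by (simp add: positive_chart_def R3_basis)
qed

lemma homeomorphism_graph_chart:
  "homeomorphism graph_dom A4 graph_chart (\<lambda>u. (u$0, u$2, u$3, u$4))"
proof -
  have "continuous_on graph_dom graph_chart"
    by (rule has_derivative_continuous_on) (auto intro: has_derivative_at_withinI graph_chart_deriv)
  moreover have "continuous_on A4 (\<lambda>u. (u$0, u$2, u$3, u$4))"
    by (intro continuous_intros)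
  moreover have "(\<lambda>u. (u$0, u$2, u$3, u$4)) (graph_chart p) = p" for p
    by (cases p) (simp add: graph_chart_def)
  ultimately show ?thesis
    using graph_chart_A4 graph_chart_inverse by (intro homeomorphismI) auto
qed

lemma closure_A4:
  "closure A4 \<subseteq> {u. A4_poly u = 0 \<and> 0 \<le> u$0 \<and> u$0 \<le> 1 \<and> 0 \<le> u$1 \<and> u$1 \<le> 1 \<and> 0 \<le> u$2 \<and> u$2 \<le> 1}"
proof (rule closure_minimal)
  show "closed {u. A4_poly u = 0 \<and> 0 \<le> u$0 \<and> u$0 \<le> 1 \<and> 0 \<le> u$1 \<and> u$1 \<le> 1 \<and> 0 \<le> u$2 \<and> u$2 \<le> 1}"
    unfolding A4_poly_def by (intro closed_Collect_conj closed_Collect_eq closed_Collect_le continuous_intros)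
qed (auto simp: A4_alt)

lemma oriented_boundary_A4: "oriented_boundary TYPE(R3) A4_orientation A4 \<subseteq> zeros_of Sigma_div"
proof
  fix u assume u: "u \<in> oriented_boundary TYPE(R3) A4_orientation A4"
  have "u \<notin> A4"
  proof
    assume "u \<in> A4"
    \<comment> \<open>One global chart serves every point, so the neighbourhood can be the whole
      space and the boundary lies in the closure minus \<open>A4\<close>.\<close>
    have "\<exists>W (\<psi> :: real \<times> R3 \<Rightarrow> real^5) V bs g. open W \<and> u \<in> W \<and>
        positive_chart A4_orientation \<psi> V bs \<and> homeomorphism V (A4 \<inter> W) \<psi> g"
      using positive_graph_chart homeomorphism_graph_chart
      by (intro exI [of _ UNIV] exI [of _ graph_chart] exI [of _ graph_dom] exI [of _ R3_basis]
        exI [of _ "\<lambda>u. (u$0, u$2, u$3, u$4)"]) auto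
    with u \<open>u \<in> A4\<close> show False by (auto simp: oriented_boundary_def)
  qed
  moreover have "u \<in> closure A4" using u by (auto simp: oriented_boundary_def)
  ultimately have cases: "u$0 = 0 \<or> u$0 = 1 \<or> u$1 = 0 \<or> u$1 = 1 \<or> u$2 = 0 \<or> u$2 = 1"
    using closure_A4 by (fastforce simp: A4_alt)
  have z: "u \<in> zeros_of Sigma_div" if "i \<in> {0, 1, 2}" "c \<in> {0, 1}" "u$i = c" for i :: 5 and c :: real
  proof -
    have "(\<lambda>u. u$i - c) \<in> Sigma_div"
      unfolding Sigma_div_def mem_Collect_eq
      by (rule exI [of _ i], rule exI [of _ c]) (use that(1,2) in blast)
    then show ?thesis
      unfolding zeros_of_def mem_Collect_eq
      by (rule bexI [rotated]) (simp add: that(3))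
  qed
  show "u \<in> zeros_of Sigma_div"
    using cases z [of 0 0] z [of 0 1] z [of 1 0] z [of 1 1] z [of 2 0] z [of 2 1] by auto
qed

text \<open>The first parameter is u_0 itself, as the slicing requires, and the angles are those of
  \<xi> on the unit sphere. Each slice of \<open>A4\<close> thus becomes a quarter sphere, up to
  null sets, and the vanishing integrals over the sphere apply to it.\<close>

definition sphere_chart :: "real \<times> R3 \<Rightarrow> real^5" where
  "sphere_chart p = (\<chi> i. if i = 0 then fst p else if i = 1 then sphere_param (snd p) $ 1 else if i = 2 then sphere_param (snd p) $ 2
     else if i = 3 then sphere_param (snd p) $ 3 / sqrt (fst p) else sphere_param (snd p) $ 4 / sqrt (1 - fst p))"

definition sphere_chart_deriv :: "real \<times> R3 \<Rightarrow> real \<times> R3 \<Rightarrow> real^5" where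
  "sphere_chart_deriv p h = (let d = sphere_deriv (snd p) (snd h) in
     \<chi> i. if i = 0 then fst h else if i = 1 then d $ 1 else if i = 2 then d $ 2
     else if i = 3 then d $ 3 / sqrt (fst p) - sphere_param (snd p) $ 3 / (2 * fst p * sqrt (fst p)) * fst h
     else d $ 4 / sqrt (1 - fst p) + sphere_param (snd p) $ 4 / (2 * (1 - fst p) * sqrt (1 - fst p)) * fst h)"

definition quarter_dom :: "R3 set" where
  "quarter_dom = {0<..<pi/2} \<times> {0<..<pi/2} \<times> {0<..<2*pi}"

definition sphere_dom :: "(real \<times> R3) set" where "sphere_dom = {0<..<1} \<times> quarter_dom"

lemma has_derivative_sphere_chart:
  assumes "0 < fst p" "fst p < 1"
  shows "(sphere_chart has_derivative sphere_chart_deriv p) (at p)"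
proof (rule has_derivative_vecI)
  have d: "((\<lambda>t. 1 / sqrt t) has_real_derivative - (1 / (2 * fst p * sqrt (fst p)))) (at (fst p))"
    "((\<lambda>t. 1 / sqrt (1 - t)) has_real_derivative 1 / (2 * (1 - fst p) * sqrt (1 - fst p))) (at (fst p))"
    using assms by (auto intro!: derivative_eq_intros simp: field_simps)
  note r = has_derivative_compose [OF has_derivative_fst [OF has_derivative_ident] d(1) [unfolded has_field_derivative_def]]
    has_derivative_compose [OF has_derivative_fst [OF has_derivative_ident] d(2) [unfolded has_field_derivative_def]]
  have S: "((\<lambda>p. sphere_param (snd p) $ j) has_derivative (\<lambda>h. sphere_deriv (snd p) (snd h) $ j)) (at p)" for j
    by (rule has_derivative_compose [OF has_derivative_compose
          [OF has_derivative_snd [OF has_derivative_ident] has_derivative_sphere_param] has_derivative_nth])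
  show "((\<lambda>p. sphere_chart p $ i) has_derivative (\<lambda>h. sphere_chart_deriv p h $ i)) (at p)" for i :: 5
    using exhaust_5 [of i] S [of 1] S [of 2] has_derivative_mult [OF S [of 3] r(1)] has_derivative_mult [OF S [of 4] r(2)]
    by (elim disjE)
      (auto simp: sphere_chart_def sphere_chart_deriv_def Let_def algebra_simps intro!: derivative_eq_intros)
qed

lemma open_sphere_dom: "open sphere_dom"
  unfolding sphere_dom_def quarter_dom_def by (intro open_Times open_greaterThanLessThan)

lemma sphere_domD:
  assumes "(s, x, y, z) \<in> sphere_dom"
  shows "0 < s" "s < 1" "0 < sin x" "0 < cos x" "0 < sin y" "0 < cos y"
  using assms by (auto simp: sphere_dom_def quarter_dom_def sin_gt_zero cos_gt_zero)

lemma sphere_chart_nth: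
  "sphere_chart (s, x, y, z) $ 0 = s" "sphere_chart (s, x, y, z) $ 1 = cos x"
  "sphere_chart (s, x, y, z) $ 2 = sin x * cos y" "sphere_chart (s, x, y, z) $ 3 = sin x * sin y * cos z / sqrt s"
  "sphere_chart (s, x, y, z) $ 4 = sin x * sin y * sin z / sqrt (1 - s)"
  by (simp_all add: sphere_chart_def)

lemma sphere_chart_subset: "sphere_chart ` sphere_dom \<subseteq> A4"
proof
  fix u assume "u \<in> sphere_chart ` sphere_dom"
  then obtain s x y z where p: "(s, x, y, z) \<in> sphere_dom" and u: "u = sphere_chart (s, x, y, z)" by force
  note pos = sphere_domD [OF p]
  have sq: "s * (sin x * sin y * cos z / sqrt s)\<^sup>2 = (sin x * sin y * cos z)\<^sup>2"
    "(1 - s) * (sin x * sin y * sin z / sqrt (1 - s))\<^sup>2 = (sin x * sin y * sin z)\<^sup>2"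
    using pos by (simp_all add: power_divide)
  have "cos x \<noteq> 1" "cos y \<noteq> 1" using cos_one_sin_zero [of x] cos_one_sin_zero [of y] pos by auto
  then have c: "cos x < 1" "cos y < 1" using cos_le_one [of x] cos_le_one [of y] by linarith+
  then have "sin x * cos y < sin x * 1" using pos by (intro mult_strict_left_mono)
  then have "cos x < 1" "sin x * cos y < 1" using c sin_le_one [of x] by linarith+
  then show "u \<in> A4"
    using pos sphere_param_sq [of "(x, y, z)"]
    by (simp add: u A4_def sphere_chart_nth sq)
qed

lemma inj_on_sphere_chart: "inj_on sphere_chart sphere_dom"
proof (rule inj_onI)
  fix p q assume p: "p \<in> sphere_dom" and q: "q \<in> sphere_dom" and eq: "sphere_chart p = sphere_chart q"
  obtain s x y z s' x' y' z' where pq: "p = (s, x, y, z)" "q = (s', x', y', z')" by (cases p, cases q) auto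
  note P = sphere_domD [OF p [unfolded pq]] and Q = sphere_domD [OF q [unfolded pq]]
  have rng: "0 < x" "x < pi/2" "0 < y" "y < pi/2" "0 < z" "z < 2*pi" "0 < x'" "x' < pi/2" "0 < y'" "y' < pi/2" "0 < z'" "z' < 2*pi"
    using p q by (auto simp: pq sphere_dom_def quarter_dom_def)
  have comp: "sphere_chart (s, x, y, z) $ i = sphere_chart (s', x', y', z') $ i" for i
    using eq by (simp add: pq)
  note comps = comp [of 0] comp [of 1] comp [of 2] comp [of 3] comp [of 4]
  note comps = comps [unfolded sphere_chart_nth]
  have s: "s = s'" and c: "cos x = cos x'" using comps(1,2) .
  have x: "x = x'" using c by (rule cos_inj_pi [rotated 4]) (use rng in auto)
  have "cos y = cos y'" using comps(3) x P by simp
  then have y: "y = y'" by (rule cos_inj_pi [rotated 4]) (use rng in auto)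
  have "cos z = cos z'" "sin z = sin z'" using comps(4,5) s x y P by simp_all
  then obtain n where n: "z = z' + 2 * pi * of_int n"
    using sin_cos_eq_iff [of z z'] by auto
  have "n = 0"
  proof (rule ccontr)
    assume "n \<noteq> 0"
    then have "1 \<le> \<bar>of_int n :: real\<bar>" by linarith
    then have "2 * pi \<le> \<bar>2 * pi * of_int n\<bar>" by (simp add: abs_mult)
    then show False using n rng by linarith
  qed
  then show "p = q" using n s x y by (simp add: pq)
qed

lemma sphere_chart_deriv_nth:
  "sphere_chart_deriv (s, \<theta>) (ds, h) $ 0 = ds" "sphere_chart_deriv (s, \<theta>) (ds, h) $ 1 = sphere_deriv \<theta> h $ 1"
  "sphere_chart_deriv (s, \<theta>) (ds, h) $ 2 = sphere_deriv \<theta> h $ 2"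
  "sphere_chart_deriv (s, \<theta>) (ds, h) $ 3 = sphere_deriv \<theta> h $ 3 / sqrt s - sphere_param \<theta> $ 3 / (2 * s * sqrt s) * ds"
  "sphere_chart_deriv (s, \<theta>) (ds, h) $ 4 = sphere_deriv \<theta> h $ 4 / sqrt (1 - s) + sphere_param \<theta> $ 4 / (2 * (1 - s) * sqrt (1 - s)) * ds"
  by (simp_all add: sphere_chart_deriv_def Let_def)

text \<open>The system is triangular: components 0, 1 and 2 determine \<open>ds\<close> and the
  first two angles in turn, and the last two say that both \<open>sin z * c\<close> and
  \<open>cos z * c\<close> vanish.\<close>

lemma sphere_chart_deriv_kernel:
  assumes "p \<in> sphere_dom" "sphere_chart_deriv p v = 0"
  shows "v = 0"
proof -
  obtain s x y z where p: "p = (s, x, y, z)" by (cases p) auto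
  obtain ds a b c where v: "v = (ds, a, b, c)" by (cases v) auto
  note pos = sphere_domD [OF assms(1) [unfolded p]]
  have nth: "sphere_chart_deriv p v $ i = 0" for i using assms(2) by simp
  have ds: "ds = 0" using nth [of 0] by (simp add: p v sphere_chart_deriv_nth)
  have a: "a = 0" using nth [of 1] pos by (simp add: p v sphere_chart_deriv_nth sphere_deriv_nth)
  have b: "b = 0" using nth [of 2] pos by (simp add: p v sphere_chart_deriv_nth sphere_deriv_nth a)
  have "sin z * c = 0" "cos z * c = 0"
    using nth [of 3] nth [of 4] pos by (simp_all add: p v sphere_chart_deriv_nth sphere_deriv_nth a b ds)
  then have "c = 0" using sin_cos_squared_add [of z] by (metis mult_eq_0_iff power2_eq_square add_0 zero_neq_one)
  then show ?thesis by (simp add: v ds a b zero_prod_def)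
qed

lemma continuous_on_sphere_chart_deriv: "continuous_on sphere_dom (\<lambda>p. sphere_chart_deriv p v)"
proof (rule continuous_on_vecI)
  show "continuous_on sphere_dom (\<lambda>p. sphere_chart_deriv p v $ i)" for i :: 5
    using exhaust_5 [of i]
    by (elim disjE; simp add: sphere_chart_deriv_def sphere_param_def sphere_deriv_def split_def Let_def)
      (intro continuous_intros; force simp: sphere_dom_def)+
qed

text \<open>The orientation is d\<eta> wedge the volume form of the sphere, so the density is the
  product of the spherical weight and the derivative of \<eta> = arcsin(sqrt s). The s-derivatives
  of u_3 and u_4 do not contribute.\<close>

lemma A4_orientation_sphere_chart:
  assumes "0 < s" "s < 1"
  shows "pullback sphere_chart A4_orientation (s, \<theta>) (param_frame R3_basis) = sphere_weight \<theta> / (2 * sqrt s * sqrt (1 - s))"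
proof -
  have fr: "frechet_derivative sphere_chart (at (s, \<theta>)) = sphere_chart_deriv (s, \<theta>)"
    using frechet_derivative_at [OF has_derivative_sphere_chart, of "(s, \<theta>)"] assms by simp
  have len: "length (map (sphere_chart_deriv (s, \<theta>)) (param_frame R3_basis)) = 4" by (simp add: param_frame_R3)
  have u: "sphere_chart (s, \<theta>) $ 0 = s" "sphere_chart (s, \<theta>) $ 1 = sphere_param \<theta> $ 1" "sphere_chart (s, \<theta>) $ 2 = sphere_param \<theta> $ 2"
    "sphere_chart (s, \<theta>) $ 3 = sphere_param \<theta> $ 3 / sqrt s" "sphere_chart (s, \<theta>) $ 4 = sphere_param \<theta> $ 4 / sqrt (1 - s)"
    by (simp_all add: sphere_chart_def)
  have s: "0 < sphere_chart (s, \<theta>) $ 0" "sphere_chart (s, \<theta>) $ 0 < 1" using assms by (simp_all add: u)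
  have z: "sphere_chart_deriv (s, \<theta>) (0, h) $ 3 = sphere_deriv \<theta> h $ 3 / sqrt s"
    "sphere_chart_deriv (s, \<theta>) (0, h) $ 4 = sphere_deriv \<theta> h $ 4 / sqrt (1 - s)" for h
    by (simp_all add: sphere_chart_deriv_nth)
  define k where "k = 1 / sqrt s"
  define l where "l = 1 / sqrt (1 - s)"
  have "pullback sphere_chart A4_orientation (s, \<theta>) (param_frame R3_basis)
    = k * l / 2 * sigma_xi3 (sphere_param \<theta>) (map (sphere_deriv \<theta>) [(1, 0, 0), (0, 1, 0), (0, 0, 1)])"
  proof -
    have d: "x / sqrt s = x * k" "x / sqrt (1 - s) = x * l" for x by (simp_all add: k_def l_def)
    show ?thesis
      unfolding pullback_def fr A4_orientation_eq [OF s len] u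
      unfolding param_frame_R3 list.map dwedge_4 dwedge_3 sigma_xi3_def z sphere_chart_deriv_nth(1-3) d
      by (simp add: algebra_simps add_divide_distrib diff_divide_distrib)
  qed
  then show ?thesis unfolding sigma_xi3_sphere by (simp add: k_def l_def)
qed

lemma sphere_weight_pos: "\<theta> \<in> quarter_dom \<Longrightarrow> 0 < sphere_weight \<theta>"
  by (auto simp: quarter_dom_def sphere_weight_def intro!: mult_pos_pos sin_gt_zero zero_less_power)

lemma positive_sphere_chart: "positive_chart A4_orientation sphere_chart sphere_dom R3_basis"
proof -
  have "param_chart sphere_chart sphere_dom"
  proof (rule param_chartI [OF open_sphere_dom inj_on_sphere_chart has_derivative_sphere_chart])
    show "0 < fst p" "fst p < 1" if "p \<in> sphere_dom" for p
      using that by (auto simp: sphere_dom_def)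
  qed (fact sphere_chart_deriv_kernel continuous_on_sphere_chart_deriv)+
  moreover have "pullback sphere_chart A4_orientation p (param_frame R3_basis) > 0" if "p \<in> sphere_dom" for p
    using that sphere_weight_pos
    by (cases p) (auto simp: sphere_dom_def A4_orientation_sphere_chart)
  ultimately show ?thesis by (simp add: positive_chart_def R3_basis)
qed

text \<open>Parameters containing the points of \<open>A4\<close> missed by the open angles. As 0 <
  u_1 < 1 and 0 < u_2, the only ends of the angle ranges that can occur are y = 0, where u_3 = u_4 =
  0, and z = 0.\<close>

definition sphere_null :: "(real \<times> R3) set" where
  "sphere_null = {(s, x, y, z). 0 < s \<and> s < 1 \<and> (y = 0 \<or> z = 0)}"

lemma negligible_sphere_null: "negligible sphere_null"
proof -
  have b: "(0, (0, 1, 0)) \<in> (Basis :: (real \<times> R3) set)" "(0, (0, 0, 1)) \<in> (Basis :: (real \<times> R3) set)"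
  proof -
    have "(0, 1, 0) \<in> (Basis :: R3 set)" "(0, 0, 1) \<in> (Basis :: R3 set)"
      by (simp_all flip: R3_basis(2) add: R3_basis_def)
    then show "(0, (0, 1, 0)) \<in> (Basis :: (real \<times> R3) set)" "(0, (0, 0, 1)) \<in> (Basis :: (real \<times> R3) set)"
      unfolding Basis_prod_def [where 'a = real and 'b = R3] by (auto intro!: UnI2 imageI)
  qed
  have "negligible ({p :: real \<times> R3. p \<bullet> (0, (0, 1, 0)) = 0} \<union> {p. p \<bullet> (0, (0, 0, 1)) = 0})"
    by (intro negligible_Un negligible_standard_hyperplane b)
  then show ?thesis by (rule negligible_subset) (auto simp: sphere_null_def)
qed

lemma sphere_chart_differentiable_null: "sphere_chart differentiable_on sphere_null"
  unfolding differentiable_on_def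
proof
  fix p assume "p \<in> sphere_null"
  then have "0 < fst p" "fst p < 1" by (auto simp: sphere_null_def)
  from differentiableI [OF has_derivative_sphere_chart [OF this]]
  show "sphere_chart differentiable (at p within sphere_null)" by (rule differentiable_at_withinI)
qed

lemma A4_sphere_cover: "A4 - sphere_chart ` sphere_dom \<subseteq> sphere_chart ` sphere_null"
proof
  fix u assume u: "u \<in> A4 - sphere_chart ` sphere_dom"
  define s where "s = u$0"
  have s: "0 < s" "s < 1" and u12: "0 < u$1" "u$1 < 1" "0 < u$2"
    and eq: "(u$1)\<^sup>2 + (u$2)\<^sup>2 + s * (u$3)\<^sup>2 + (1 - s) * (u$4)\<^sup>2 = 1"
    using u by (auto simp: A4_def s_def)
  define x where "x = arccos (u$1)"
  have x: "0 < x" "x < pi / 2" "cos x = u$1"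
    using u12 arccos_lt_bounded [of "u$1"] arccos_less_arccos [of 0 "u$1"] by (auto simp: x_def)
  have sx: "0 < sin x" using x by (intro sin_gt_zero) auto
  have sx2: "(sin x)\<^sup>2 = (u$2)\<^sup>2 + s * (u$3)\<^sup>2 + (1 - s) * (u$4)\<^sup>2"
    using eq by (simp add: sin_squared_eq x)
  have "(u$2)\<^sup>2 \<le> (sin x)\<^sup>2" unfolding sx2 using s by simp
  then have "u$2 \<le> sin x" using sx u12 by (simp add: power2_le_iff_abs_le)
  then have q: "0 < u$2 / sin x" "u$2 / sin x \<le> 1" using sx u12 by simp_all
  define y where "y = arccos (u$2 / sin x)"
  have y: "0 \<le> y" "y < pi / 2" "cos y = u$2 / sin x"
    using q arccos_lbound [of "u$2 / sin x"] arccos_less_arccos [of 0 "u$2 / sin x"] by (auto simp: y_def)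
  \<comment> \<open>The length of (\<xi>_3, \<xi>_4), whose polar angle will be z.\<close>
  define R where "R = sin x * sin y"
  have R0: "0 \<le> R" using sx y sin_ge_zero [of y] by (auto simp: R_def)
  have "(sin x * cos y)\<^sup>2 = (u$2)\<^sup>2" using sx y by simp
  then have "R\<^sup>2 = (sin x)\<^sup>2 - (u$2)\<^sup>2"
    by (simp add: R_def power_mult_distrib sin_squared_eq [of y] algebra_simps)
  then have R2: "R\<^sup>2 = (sqrt s * u$3)\<^sup>2 + (sqrt (1 - s) * u$4)\<^sup>2"
    using s by (simp add: sx2 power_mult_distrib)
  obtain z where z: "0 \<le> z" "z < 2 * pi" "R * cos z = sqrt s * u$3" "R * sin z = sqrt (1 - s) * u$4"
  proof (cases "R = 0")
    \<comment> \<open>The polar angle is undetermined here; the choice 0 puts the point into the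
      image of \<open>sphere_null\<close>.\<close>
    case True
    then have "sqrt s * u$3 = 0" "sqrt (1 - s) * u$4 = 0" using R2 by (auto simp: sum_power2_eq_zero_iff)
    then show thesis using that [of 0] True by simp
  next
    case False
    have "(sqrt s * u$3 / R)\<^sup>2 + (sqrt (1 - s) * u$4 / R)\<^sup>2 = R\<^sup>2 / R\<^sup>2"
      unfolding power_divide add_divide_distrib [symmetric] R2 ..
    then have "(sqrt s * u$3 / R)\<^sup>2 + (sqrt (1 - s) * u$4 / R)\<^sup>2 = 1"
      using False by simp
    from sincos_total_2pi [OF this] obtain t where "0 \<le> t" "t < 2 * pi" "sqrt s * u$3 / R = cos t" "sqrt (1 - s) * u$4 / R = sin t"
      by blast
    then show thesis using that [of t] False by (simp add: field_simps)
  qed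
  have "sphere_chart (s, x, y, z) = u"
    using s sx y z x
    by (simp add: vec_eq_iff forall_5 sphere_chart_nth R_def [symmetric] s_def [symmetric])
  moreover have "(s, x, y, z) \<notin> sphere_dom" using u calculation by auto
  then have "y = 0 \<or> z = 0"
    using s x y z by (auto simp: sphere_dom_def quarter_dom_def)
  then have "(s, x, y, z) \<in> sphere_null" using s by (simp add: sphere_null_def)
  ultimately show "u \<in> sphere_chart ` sphere_null" by (intro image_eqI) auto
qed

section \<open>The integral over the domain and the heat kernel coefficient\<close>

text \<open>The substitution \<open>u\<^sub>0 = sin\<^sup>2 \<eta>\<close> in the outer integral.
  Its Jacobian is exactly the factor that the orientation form acquires in
  \<open>sphere_chart\<close>.\<close>

lemma set_integral_arcsin_sqrt:
  fixes F :: "real \<Rightarrow> real"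
  assumes cont: "continuous_on {0<..<pi/2} F" and int: "set_integrable lborel {0<..<pi/2} F"
  shows "set_integrable lborel {0<..<1} (\<lambda>s. F (arcsin (sqrt s)) / (2 * sqrt s * sqrt (1 - s)))" (is ?t1)
    and "(LINT s : {0<..<1} | lborel. F (arcsin (sqrt s)) / (2 * sqrt s * sqrt (1 - s))) = (LINT \<eta> : {0<..<pi/2} | lborel. F \<eta>)" (is ?t2)
proof -
  define g where "g s = arcsin (sqrt s)" for s
  define g' where "g' s = 1 / (2 * sqrt s * sqrt (1 - s))" for s
  have rng: "0 < g s" "g s < pi / 2" if "s \<in> {0<..<1}" for s
    using arcsin_sqrt [of s] that by (auto simp: g_def)
  have img: "g ` {0<..<1} = {0<..<pi/2}"
  proof
    show "{0<..<pi/2} \<subseteq> g ` {0<..<1}"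
    proof
      fix y :: real assume y: "y \<in> {0<..<pi/2}"
      then have sc: "0 < sin y" "0 < cos y" using sin_cos_pos by auto
      have "0 < (sin y)\<^sup>2" "0 < (cos y)\<^sup>2" using sc by simp_all
      then have "0 < (sin y)\<^sup>2" "(sin y)\<^sup>2 < 1" using sin_cos_squared_add [of y] by linarith+
      moreover have "y = g ((sin y)\<^sup>2)" using y sc by (simp add: g_def arcsin_sin)
      ultimately have "(sin y)\<^sup>2 \<in> {0<..<1}" "y = g ((sin y)\<^sup>2)" by simp_all
      then show "y \<in> g ` {0<..<1}" by (rule image_eqI [rotated])
    qed
  qed (use rng in auto)
  have inj: "inj_on g {0<..<1}"
  proof (rule inj_onI)
    fix s t assume st: "s \<in> {0<..<1}" "t \<in> {0<..<1}" "g s = g t"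
    have "sin (g s) = sqrt s" "sin (g t) = sqrt t"
      unfolding g_def using st(1,2) by (intro arcsin_sqrt(3); simp)+
    then have "sqrt s = sqrt t" by (simp only: st(3))
    then show "s = t" by simp
  qed
  have der: "(g has_field_derivative g' s) (at s within {0<..<1})" if "s \<in> {0<..<1}" for s
  proof -
    have "0 \<le> sqrt s" using that by simp
    then have "- 1 < sqrt s" by linarith
    then have "((\<lambda>x. arcsin (sqrt x)) has_real_derivative 1 / (2 * sqrt s * sqrt (1 - s))) (at s)"
      using that by (auto intro!: derivative_eq_intros simp: field_simps)
    then show ?thesis unfolding g_def g'_def by (rule has_field_derivative_at_within)
  qed
  have gc: "continuous_on {0<..<1} g"
    using der by (rule DERIV_continuous_on)
  have g'c: "continuous_on {0<..<1} g'"
    unfolding g'_def by (intro continuous_intros) auto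
  have Fg: "continuous_on {0<..<1} (\<lambda>s. \<bar>g' s\<bar> * F (g s))"
    by (intro continuous_intros g'c continuous_on_compose2 [OF cont gc]) (use img in auto)
  \<comment> \<open>The change of variables gives integrability for the completed measure; Borel
    measurability, needed to return to \<open>lborel\<close>, comes from continuity.\<close>
  have meas: "(\<lambda>s. indicator {0<..<1} s *\<^sub>R (\<bar>g' s\<bar> * F (g s))) \<in> borel_measurable borel"
    by (rule borel_measurable_continuous_on_indicator [OF _ Fg]) auto
  have "F absolutely_integrable_on g ` {0<..<1}"
    using int unfolding img set_integrable_def by (rule integrable_completion [THEN iffD2, rotated]) (use int in \<open>auto simp: set_integrable_def\<close>)
  then have "(\<lambda>s. \<bar>g' s\<bar> * F (g s)) absolutely_integrable_on {0<..<1} \<and>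
      integral {0<..<1} (\<lambda>s. \<bar>g' s\<bar> * F (g s)) = integral (g ` {0<..<1}) F"
    by (subst has_absolute_integral_change_of_variables_1' [OF _ der inj]) auto
  then have ai: "(\<lambda>s. \<bar>g' s\<bar> * F (g s)) absolutely_integrable_on {0<..<1}"
    and eq: "integral {0<..<1} (\<lambda>s. \<bar>g' s\<bar> * F (g s)) = integral {0<..<pi/2} F"
    by (auto simp: img)
  have si: "set_integrable lborel {0<..<1} (\<lambda>s. \<bar>g' s\<bar> * F (g s))"
    using ai meas unfolding set_integrable_def by (subst (asm) integrable_completion) auto
  have c: "\<bar>g' s\<bar> * F (g s) = F (arcsin (sqrt s)) / (2 * sqrt s * sqrt (1 - s))" if "s \<in> {0<..<1}" for s
    using that by (simp add: g_def g'_def)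
  show ?t1
    using si by (rule set_integrable_cong [THEN iffD1, rotated -1]) (auto simp: c)
  have "(LINT s : {0<..<1} | lborel. F (arcsin (sqrt s)) / (2 * sqrt s * sqrt (1 - s))) = (LINT s : {0<..<1} | lborel. \<bar>g' s\<bar> * F (g s))"
    by (rule set_lebesgue_integral_cong) (auto simp: c)
  also have "\<dots> = (LINT \<eta> : {0<..<pi/2} | lborel. F \<eta>)"
    using set_borel_integral_eq_integral(2) [OF si] set_borel_integral_eq_integral(2) [OF int] eq by simp
  finally show ?t2 .
qed

text \<open>The value of the integral over \<open>A4\<close>, written as an integral in \<eta> over
  full spheres; the divisor 4 restores the quarter with u_1, u_2 > 0.\<close>

definition period_value :: "real \<Rightarrow> real \<Rightarrow> real \<Rightarrow> complex" where
  "period_value g0 g1 g2 = of_real ((LINT \<eta> : {0<..<pi/2} | lborel. slice_integral g0 g1 g2 \<eta>) / 4)"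

text \<open>Formulated for any form with the prescribed values on \<open>A4\<close>, so that it
  gives the same value for \<open>Omega\<close> and for \<open>Omega_alg\<close>.\<close>

lemma has_form_integral_density:
  assumes g0: "g0 \<noteq> 0"
    and \<omega>: "\<And>u vs. u \<in> A4 \<Longrightarrow> length vs = 4 \<Longrightarrow> \<omega> u vs = of_real (Omega_density g0 g1 g2 u * A4_orientation u vs)"
  shows "has_form_integral TYPE(R3) 0 A4_orientation A4 \<omega> (period_value g0 g1 g2)"
proof -
  define f where "f s \<theta> = indicator sphere_dom (s, \<theta>) *\<^sub>R pullback sphere_chart \<omega> (s, \<theta>) (param_frame R3_basis)" for s \<theta>
  define w where "w s = 1 / (2 * sqrt s * sqrt (1 - s))" for s :: real
  define F where "F s \<theta> = sphere_weight \<theta> * dens g0 g1 g2 (arcsin (sqrt s)) (sphere_param \<theta>)" for s \<theta>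
  have f: "f s \<theta> = complex_of_real (indicator quarter_dom \<theta> *\<^sub>R F s \<theta>) * of_real (w s)" if s: "0 < s" "s < 1" for s \<theta>
  proof (cases "\<theta> \<in> quarter_dom")
    case True
    then have p: "(s, \<theta>) \<in> sphere_dom" using s by (simp add: sphere_dom_def)
    have fr: "frechet_derivative sphere_chart (at (s, \<theta>)) = sphere_chart_deriv (s, \<theta>)"
      using frechet_derivative_at [OF has_derivative_sphere_chart, of "(s, \<theta>)"] s by simp
    have A: "sphere_chart (s, \<theta>) \<in> A4" using p sphere_chart_subset by blast
    have u0: "sphere_chart (s, \<theta>) $ 0 = s" by (simp add: sphere_chart_def)
    have "xi_part (of_u (sphere_chart (s, \<theta>))) = sphere_param \<theta>"
      using s by (simp add: vec_eq_iff forall_4 xi_part_of_u sphere_chart_def)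
    with dens_of_u [of "sphere_chart (s, \<theta>)" g0 g1 g2] s
    have d: "Omega_density g0 g1 g2 (sphere_chart (s, \<theta>)) = dens g0 g1 g2 (arcsin (sqrt s)) (sphere_param \<theta>)"
      by (simp add: u0)
    have "pullback sphere_chart \<omega> (s, \<theta>) (param_frame R3_basis) =
      of_real (Omega_density g0 g1 g2 (sphere_chart (s, \<theta>)) * pullback sphere_chart A4_orientation (s, \<theta>) (param_frame R3_basis))"
      unfolding pullback_def by (rule \<omega> [OF A]) (simp add: param_frame_R3)
    then show ?thesis
      using p True by (simp add: f_def d A4_orientation_sphere_chart [OF s] F_def w_def)
  qed (simp add: f_def sphere_dom_def)
  have f0: "f s \<theta> = 0" if "\<not> (0 < s \<and> s < 1)" for s \<theta>
    using that by (auto simp: f_def sphere_dom_def)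
  have int: "integrable lborel (f s) \<and> integral\<^sup>L lborel (f s) =
      of_real (indicator {0<..<1} s *\<^sub>R (slice_integral g0 g1 g2 (arcsin (sqrt s)) / 4 * w s))" for s
  proof (cases "0 < s \<and> s < 1")
    case True
    then have s: "0 < s" "s < 1" by auto
    note \<eta> = arcsin_sqrt(1,2) [OF s]
    have cF: "continuous_on UNIV (F s)"
      unfolding F_def by (rule continuous_on_dens_slice [OF g0 \<eta>])
    \<comment> \<open>For fixed u_0 the density is continuous on the closed box of angles, so the
      inner integral converges absolutely; the delicate limit is only in u_0.\<close>
    note I = set_integral_open_box [OF cF, of "pi/2" "pi/2" "2 * pi", folded quarter_dom_def]
    have i1: "integrable lborel (\<lambda>\<theta>. complex_of_real (indicator quarter_dom \<theta> *\<^sub>R F s \<theta>) * of_real (w s))"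
      using I(1) unfolding set_integrable_def by (intro integrable_mult_left integrable_of_real)
    have i2: "(LINT \<theta>|lborel. complex_of_real (indicator quarter_dom \<theta> *\<^sub>R F s \<theta>) * of_real (w s))
      = of_real ((LINT \<theta>:quarter_dom|lborel. F s \<theta>) * w s)"
      by (simp add: set_lebesgue_integral_def del: of_real_mult flip: of_real_mult)
    have i3: "(LINT \<theta>:quarter_dom|lborel. F s \<theta>) = slice_integral g0 g1 g2 (arcsin (sqrt s)) / 4"
      unfolding I(2) unfolding slice_integral_quarter [OF g0 \<eta>] F_def quarter_box_def by simp
    have fs: "f s = (\<lambda>\<theta>. complex_of_real (indicator quarter_dom \<theta> *\<^sub>R F s \<theta>) * of_real (w s))"
      by (rule ext) (rule f [OF s])
    have "indicator {0<..<1} s *\<^sub>R x = x" for x :: real using s by simp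
    then show ?thesis using i1 unfolding fs i2 i3 by simp
  next
    case False
    have "f s = (\<lambda>\<theta>. 0)" by (rule ext) (rule f0 [OF False])
    moreover have "s \<notin> {0<..<1}" using False by simp
    ultimately show ?thesis by simp
  qed
  note S = set_integral_arcsin_sqrt [OF continuous_on_slice_integral [OF g0] slice_integral_integrable [OF g0], of g1 g2]
  have eq: "indicator {0<..<1} s *\<^sub>R (slice_integral g0 g1 g2 (arcsin (sqrt s)) / 4 * w s)
    = (indicator {0<..<1} s *\<^sub>R (slice_integral g0 g1 g2 (arcsin (sqrt s)) / (2 * sqrt s * sqrt (1 - s)))) / 4" for s :: real
    by (simp add: w_def)
  have outer: "integrable lborel (\<lambda>s. integral\<^sup>L lborel (f s))" "(LINT s|lborel. integral\<^sup>L lborel (f s)) = period_value g0 g1 g2"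
  proof -
    have e: "integral\<^sup>L lborel (f s) = complex_of_real ((indicator {0<..<1} s *\<^sub>R (slice_integral g0 g1 g2 (arcsin (sqrt s)) / (2 * sqrt s * sqrt (1 - s)))) / 4)" for s
      using int [of s] unfolding eq by blast
    show "integrable lborel (\<lambda>s. integral\<^sup>L lborel (f s))"
      unfolding e using S(1) unfolding set_integrable_def by (intro integrable_of_real integrable_divide)
    show "(LINT s|lborel. integral\<^sup>L lborel (f s)) = period_value g0 g1 g2"
      unfolding e integral_complex_of_real period_value_def integral_divide_zero
      by (simp only: S(2) [unfolded set_lebesgue_integral_def] set_lebesgue_integral_def)
  qed
  have nth0: "\<forall>s \<theta>. (s, \<theta>) \<in> sphere_dom \<longrightarrow> sphere_chart (s, \<theta>) $ 0 = s" by (simp add: sphere_chart_def)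
  have cover: "\<exists>(N :: (real \<times> R3) set) \<psi>. negligible N \<and> \<psi> differentiable_on N \<and> A4 - sphere_chart ` sphere_dom \<subseteq> \<psi> ` N"
    using negligible_sphere_null sphere_chart_differentiable_null A4_sphere_cover by blast
  show ?thesis
    unfolding has_form_integral_def Let_def
    by (intro exI [of _ sphere_chart] exI [of _ sphere_dom] exI [of _ R3_basis] conjI positive_sphere_chart
        sphere_chart_subset cover nth0, fold f_def)
       (use int outer in auto)
qed

lemma A4_range: "u \<in> A4 \<Longrightarrow> 0 < u$0 \<and> u$0 < 1"
  by (simp add: A4_alt)

lemma A4_Q2_nz:
  assumes "u \<in> A4" "g0 \<noteq> 0"
  shows "Q2 g0 u \<noteq> 0"
proof -
  have "0 < (u$1)\<^sup>2" "0 \<le> ((u$2)\<^sup>2 + (u$3)\<^sup>2 + (u$4)\<^sup>2) / g0\<^sup>2" using assms by (auto simp: A4_alt)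
  then show ?thesis unfolding Q2_def by linarith
qed

section \<open>From the heat kernel coefficient to the slice integrals\<close>

lemma continuous_on_full_poly:
  assumes "continuous_on S r" "continuous_on S y" "continuous_on S x1" "continuous_on S x2" "continuous_on S x3" "continuous_on S x4"
  shows "continuous_on S (\<lambda>p. full_poly b (r p) g1 g2 d (y p) k t (x1 p) (x2 p) (x3 p) (x4 p))"
  unfolding full_poly_def Let_def by (intro continuous_intros assms) auto

context scale_factor
begin

text \<open>The coefficient is defined with the full trace, odd terms included. The sphere is
  symmetric under the reflection in \<xi>_1, so the integral equals that of the average of the trace
  with its reflection, which is \<open>dens\<close>.\<close>

lemma sphere_integral_trace:
  assumes "t \<in> T" "0 < \<eta>" "\<eta> < pi / 2"
  shows "sphere_integral (\<lambda>\<xi> vs. trace (sigma a 2 (vector [t, \<eta>, \<phi>1, \<phi>2]) \<xi>) * of_real (sigma_xi3 \<xi> vs))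
    = of_real (slice_integral (a t) (deriv a t) (deriv (deriv a) t) \<eta>)"
proof -
  define x :: "real^4" where "x = vector [t, \<eta>, \<phi>1, \<phi>2]"
  have x1: "x$1 = t" "x$2 = \<eta>" by (simp_all add: x_def)
  note sc = sin_cos_pos [OF assms(2,3)]
  have x: "x \<in> adm" using assms sc by (simp add: adm_def x1)
  have at: "a t \<noteq> 0" using assms a_nz by simp
  define G where "G \<xi> = full_poly (1 / a t) (1 / quad (1 / a t) (1 / sin \<eta>) (1 / cos \<eta>) \<xi>) (deriv a t) (deriv (deriv a) t)
    (cot \<eta> - tan \<eta>) ((2 * tan \<eta> * (\<xi>$4 / cos \<eta>)\<^sup>2 - 2 * cot \<eta> * (\<xi>$3 / sin \<eta>)\<^sup>2) / (a t)\<^sup>2) ((cot \<eta>)\<^sup>2) ((tan \<eta>)\<^sup>2)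
    (\<xi>$1) (\<xi>$2) (\<xi>$3 / sin \<eta>) (\<xi>$4 / cos \<eta>)" for \<xi> :: "real^4"
  have tr: "trace (sigma a 2 x \<xi>) = of_real (G \<xi>)" if "\<xi> \<noteq> 0" for \<xi>
  proof -
    have "PP a x \<xi> = quad (1 / a t) (1 / sin \<eta>) (1 / cos \<eta>) \<xi>"
      by (simp add: PP_def quad_def csc3_def sec4_def x1 power_divide)
    then show ?thesis
      unfolding trace_sigma_2 [OF x that] G_def by (simp add: YY2_def csc3_def sec4_def x1)
  qed
  define F where "F \<theta> = sphere_weight \<theta> * G (sphere_param \<theta>)" for \<theta>
  have cF: "continuous_on UNIV F"
  proof -
    have S: "continuous_on UNIV (\<lambda>\<theta>. sphere_param \<theta> $ i)" for i
      by (intro continuous_intros continuous_on_sphere_param)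
    have q: "quad (1 / a t) (1 / sin \<eta>) (1 / cos \<eta>) (sphere_param \<theta>) \<noteq> 0" for \<theta>
      using quad_pos [OF _ _ _ sphere_param_nz, of "1 / a t" "1 / sin \<eta>" "1 / cos \<eta>" \<theta>] at sc by simp
    have Q: "continuous_on UNIV (\<lambda>\<theta>. quad (1 / a t) (1 / sin \<eta>) (1 / cos \<eta>) (sphere_param \<theta>))"
      unfolding quad_def by (intro continuous_intros S)
    have x: "continuous_on UNIV (\<lambda>\<theta>. sphere_param \<theta> $ 3 / sin \<eta>)" "continuous_on UNIV (\<lambda>\<theta>. sphere_param \<theta> $ 4 / cos \<eta>)"
      using sc by (intro continuous_on_divide S continuous_on_const; simp)+
    have y: "continuous_on UNIV (\<lambda>\<theta>. (2 * tan \<eta> * (sphere_param \<theta> $ 4 / cos \<eta>)\<^sup>2 - 2 * cot \<eta> * (sphere_param \<theta> $ 3 / sin \<eta>)\<^sup>2) / (a t)\<^sup>2)"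
      using at by (intro continuous_on_divide continuous_on_diff continuous_on_mult continuous_on_power x continuous_on_const) simp
    have r: "continuous_on UNIV (\<lambda>\<theta>. 1 / quad (1 / a t) (1 / sin \<eta>) (1 / cos \<eta>) (sphere_param \<theta>))"
      by (intro continuous_on_divide Q continuous_on_const) (use q in blast)
    have w: "continuous_on UNIV sphere_weight"
      unfolding sphere_weight_def by (intro continuous_intros)
    show ?thesis
      unfolding F_def G_def by (intro continuous_on_mult w continuous_on_full_poly r y S x)
  qed
  define D where "D \<theta> = sphere_weight \<theta> * dens (a t) (deriv a t) (deriv (deriv a) t) \<eta> (sphere_param \<theta>)" for \<theta>
  have cD: "continuous_on UNIV D"
    unfolding D_def by (rule continuous_on_dens_slice [OF at assms(2,3)])
  \<comment> \<open>The first angle is reflected by \<theta>_1 to \<pi> - \<theta>_1, which changes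
    the sign of \<xi>_1 and preserves the weight.\<close>
  have FD: "F \<theta> + F (pi - fst \<theta>, snd \<theta>) = 2 * D \<theta>" for \<theta>
  proof -
    obtain p q r where \<theta>: "\<theta> = (p, q, r)" by (cases \<theta>)
    have fl: "flip1 (sphere_param \<theta>) = sphere_param (pi - p, q, r)"
      by (simp add: \<theta> flip1_def vec_eq_iff forall_4)
    have "complex_of_real (G (sphere_param \<theta>)) + of_real (G (sphere_param (pi - p, q, r)))
      = of_real (2 * dens (a t) (deriv a t) (deriv (deriv a) t) \<eta> (sphere_param \<theta>))"
      using trace_sigma_2_flip1 [OF x sphere_param_nz [of \<theta>]] unfolding fl tr [OF sphere_param_nz] x1 .
    then have "G (sphere_param \<theta>) + G (sphere_param (pi - p, q, r)) = 2 * dens (a t) (deriv a t) (deriv (deriv a) t) \<eta> (sphere_param \<theta>)"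
      by (simp only: of_real_add [symmetric] of_real_eq_iff)
    then show ?thesis
      unfolding F_def D_def by (simp add: \<theta> sphere_weight_reflect flip: distrib_left)
  qed
  have "2 * integral sphere_box F = integral sphere_box F + integral sphere_box (\<lambda>\<theta>. F (pi - fst \<theta>, snd \<theta>))"
    unfolding sphere_box_def integral_reflect_fst [OF cF] by simp
  also have "\<dots> = integral sphere_box (\<lambda>\<theta>. F \<theta> + F (pi - fst \<theta>, snd \<theta>))"
    unfolding sphere_box_def
  proof (rule Henstock_Kurzweil_Integration.integral_add [symmetric]; rule integrable_continuous)
    show "continuous_on (cbox (0, 0, 0) (pi, pi, 2 * pi)) F"
      by (rule continuous_on_subset [OF cF]) simp
    show "continuous_on (cbox (0, 0, 0) (pi, pi, 2 * pi)) (\<lambda>\<theta>. F (pi - fst \<theta>, snd \<theta>))"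
      by (rule continuous_on_compose2 [OF cF]) (auto intro!: continuous_intros)
  qed
  also have "\<dots> = 2 * integral sphere_box D" unfolding FD by simp
  finally have FD': "integral sphere_box F = integral sphere_box D" by simp
  have "sphere_integral (\<lambda>\<xi> vs. trace (sigma a 2 x \<xi>) * of_real (sigma_xi3 \<xi> vs))
    = (LINT \<theta> : {0<..<pi} \<times> {0<..<pi} \<times> {0<..<2*pi} | lborel. complex_of_real (F \<theta>))"
    unfolding sphere_integral_def sphere_pullback tr [OF sphere_param_nz] F_def by (simp add: mult.commute)
  also have "\<dots> = of_real (integral sphere_box F)"
    unfolding set_integral_complex_of_real set_integral_open_box(2) [OF cF] sphere_box_def ..
  finally show ?thesis unfolding x_def FD' D_def slice_integral_def .
qed

lemma a2_term_eq:
  assumes "t \<in> T"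
  shows "a2_term a t = of_real (1 / (2 * pi\<^sup>2)) * period_value (a t) (deriv a t) (deriv (deriv a) t)"
proof -
  define G where "G = slice_integral (a t) (deriv a t) (deriv (deriv a) t)"
  have c: "(LINT \<phi> : {0<..<2*pi} | lborel. c) = of_real (2 * pi) * c" for c :: complex
    by (simp add: set_lebesgue_integral_def scaleR_conv_of_real)
  have "(LINT \<eta> : {0<..<pi/2} | lborel. LINT \<phi>1 : {0<..<2*pi} | lborel. LINT \<phi>2 : {0<..<2*pi} | lborel.
        sphere_integral (\<lambda>\<xi> vs. trace (sigma a 2 (vector [t, \<eta>, \<phi>1, \<phi>2]) \<xi>) * of_real (sigma_xi3 \<xi> vs)))
    = (LINT \<eta> : {0<..<pi/2} | lborel. complex_of_real (4 * pi\<^sup>2 * G \<eta>))"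
  proof (rule set_lebesgue_integral_cong)
    show "\<forall>\<eta>. \<eta> \<in> {0<..<pi/2} \<longrightarrow> (LINT \<phi>1 : {0<..<2*pi} | lborel. LINT \<phi>2 : {0<..<2*pi} | lborel.
        sphere_integral (\<lambda>\<xi> vs. trace (sigma a 2 (vector [t, \<eta>, \<phi>1, \<phi>2]) \<xi>) * of_real (sigma_xi3 \<xi> vs))) = complex_of_real (4 * pi\<^sup>2 * G \<eta>)"
      using sphere_integral_trace [OF assms] by (simp add: c G_def power2_eq_square)
  qed simp
  also have "\<dots> = of_real (4 * pi\<^sup>2 * (LINT \<eta> : {0<..<pi/2} | lborel. G \<eta>))"
    by (simp add: set_integral_complex_of_real flip: of_real_mult)
  finally have "a2_term a t = 1 / (2 ^ 5 * of_real pi ^ 4) * of_real (4 * pi\<^sup>2 * (LINT \<eta> : {0<..<pi/2} | lborel. G \<eta>))"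
    unfolding a2_term_def by simp
  then show ?thesis
    by (simp add: period_value_def G_def field_simps eval_nat_numeral)
qed

end

theorem theorem4p2:
  shows
    "(\<forall>a T t \<eta> \<xi>. open T \<and> smooth_at_all T a \<and> (\<forall>s\<in>T. a s > 0) \<and> t \<in> T \<and>
        0 < \<eta> \<and> \<eta> < pi/2 \<and> \<xi> \<noteq> 0 \<longrightarrow>
        b4 a t \<eta> \<xi> = b4_jet (a t) (deriv a t) (deriv (deriv a) t) \<eta> \<xi>) \<and>
     (\<forall>K \<alpha> \<alpha>1 \<alpha>2. real_subfield K \<and> {\<alpha>, \<alpha>1, \<alpha>2} \<subseteq> K \<and> \<alpha> \<noteq> 0 \<longrightarrow>
        (\<exists>\<omega>. algebraic_form K (removed \<alpha>) 4 \<omega> \<and> restricts_to_Omega \<omega> \<alpha> \<alpha>1 \<alpha>2)) \<and>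
     Q_semialgebraic A4 \<and>
     (\<exists>I. (\<forall>\<alpha> \<alpha>1 \<alpha>2. \<alpha> \<noteq> 0 \<longrightarrow>
              has_form_integral TYPE(R3) 0 A4_orientation A4 (Omega \<alpha> \<alpha>1 \<alpha>2) (I \<alpha> \<alpha>1 \<alpha>2)) \<and>
          (\<exists>r :: rat poly. \<forall>a T t. open T \<and> smooth_at_all T a \<and> (\<forall>s\<in>T. a s > 0) \<and> t \<in> T \<longrightarrow>
              a2_term a t = poly (map_poly of_rat r) (inverse (2 * of_real pi * \<i>)) *
                I (a t) (deriv a t) (deriv (deriv a) t)) \<and>
          (\<forall>\<alpha>\<in>\<rat>. \<forall>\<alpha>1\<in>\<rat>. \<forall>\<alpha>2\<in>\<rat>. \<alpha> \<noteq> 0 \<longrightarrow>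
              (\<exists>\<omega>. restricts_to_Omega \<omega> \<alpha> \<alpha>1 \<alpha>2 \<and>
                 is_period_integral TYPE(R3) (removed \<alpha>) Sigma_div \<omega> 0 A4_orientation A4
                   (I \<alpha> \<alpha>1 \<alpha>2)) \<and>
              is_period_of_motive TYPE(R3) (removed \<alpha>) Sigma_div (I \<alpha> \<alpha>1 \<alpha>2)))"
proof (intro conjI, goal_cases)
  case 1
  show ?case
  proof (intro allI impI)
    fix a :: "real \<Rightarrow> real" and T t \<eta> and \<xi> :: "real^4"
    assume h: "open T \<and> smooth_at_all T a \<and> (\<forall>s\<in>T. a s > 0) \<and> t \<in> T \<and> 0 < \<eta> \<and> \<eta> < pi/2 \<and> \<xi> \<noteq> 0"
    then interpret scale_factor a T by (intro scale_factor_smooth) auto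
    show "b4 a t \<eta> \<xi> = b4_jet (a t) (deriv a t) (deriv (deriv a) t) \<eta> \<xi>"
      using h a_nz by (simp add: b4_eq_dens b4_jet_eq_dens)
  qed
next
  case 2
  show ?case
  proof (intro allI impI, elim conjE)
    fix K :: "real set" and \<alpha> \<alpha>1 \<alpha>2
    assume "real_subfield K" "{\<alpha>, \<alpha>1, \<alpha>2} \<subseteq> K" "\<alpha> \<noteq> 0"
    then show "\<exists>\<omega>. algebraic_form K (removed \<alpha>) 4 \<omega> \<and> restricts_to_Omega \<omega> \<alpha> \<alpha>1 \<alpha>2"
      by (intro exI [of _ "Omega_alg \<alpha> \<alpha>1 \<alpha>2"] conjI algebraic_form_Omega restricts_Omega_alg)
  qed
next
  case 3
  show ?case by (rule Q_semialgebraic_A4)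
next
  case 4
  have form: "has_form_integral TYPE(R3) 0 A4_orientation A4 (Omega \<alpha> \<alpha>1 \<alpha>2) (period_value \<alpha> \<alpha>1 \<alpha>2)" if "\<alpha> \<noteq> 0" for \<alpha> \<alpha>1 \<alpha>2
    by (rule has_form_integral_density [OF that]) (use that A4_range A4_Q2_nz Omega_eq in auto)
  have a2: "a2_term a t = poly (map_poly of_rat [:0, 0, - 2:]) (inverse (2 * of_real pi * \<i>)) * period_value (a t) (deriv a t) (deriv (deriv a) t)"
    if "open T \<and> smooth_at_all T a \<and> (\<forall>s\<in>T. a s > 0) \<and> t \<in> T" for a T t
  proof -
    interpret scale_factor a T using that by (intro scale_factor_smooth) auto
    have "poly (map_poly of_rat [:0, 0, - 2:]) (inverse (2 * of_real pi * \<i>)) = complex_of_real (1 / (2 * pi\<^sup>2))"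
      by (simp add: map_poly_pCons power2_eq_square field_simps)
    then show ?thesis using a2_term_eq that by simp
  qed
  \<comment> \<open>\<open>Omega_alg\<close> takes the place of \<open>Omega\<close> here, since a
    period requires a form algebraic on the whole complement; on \<open>A4\<close> the two agree, so
    the value is unchanged.\<close>
  have period: "is_period_integral TYPE(R3) (removed \<alpha>) Sigma_div (Omega_alg \<alpha> \<alpha>1 \<alpha>2) 0 A4_orientation A4 (period_value \<alpha> \<alpha>1 \<alpha>2)"
    if \<alpha>: "\<alpha> \<in> \<rat>" "\<alpha>1 \<in> \<rat>" "\<alpha>2 \<in> \<rat>" "\<alpha> \<noteq> 0" for \<alpha> \<alpha>1 \<alpha>2
  proof -
    have Sig: "\<exists>i c. c \<in> {0, 1} \<and> g = (\<lambda>u. u$i - c)" if "g \<in> Sigma_div" for g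
      using that unfolding Sigma_div_def by blast
    have "Sigma_div \<subseteq> (\<lambda>(i, c) u. u$i - c) ` (UNIV \<times> {0, 1})"
      using Sig by force
    then have "finite Sigma_div"
      by (rule finite_subset) simp
    moreover have "polynomial_over \<rat> g" if g: "g \<in> Sigma_div" for g
    proof -
      obtain i c where ic: "c \<in> {0, 1}" "g = (\<lambda>u. u$i - c)" using Sig [OF g] by blast
      have "polynomial_over \<rat> (\<lambda>u :: real^5. u$i + - c)"
        using ic(1) by (intro polynomial_over.intros) auto
      then show ?thesis by (simp add: ic(2))
    qed
    moreover have "polynomial_over \<rat> g" if "g \<in> removed \<alpha>" for g
      using removed_polynomial [OF rationals_subfield \<alpha>(1) that] .
    moreover have "finite (removed \<alpha>)" by (simp add: removed_def)
    moreover have "A4 \<subseteq> - zeros_of (removed \<alpha>)"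
      using A4_range A4_Q2_nz [OF _ \<alpha>(4)] by (fastforce simp: zeros_of_def removed_def)
    moreover have "has_form_integral TYPE(R3) 0 A4_orientation A4 (Omega_alg \<alpha> \<alpha>1 \<alpha>2) (period_value \<alpha> \<alpha>1 \<alpha>2)"
      by (rule has_form_integral_density [OF \<alpha>(4)]) (use A4_range Omega_alg_eq in auto)
    moreover have "algebraic_form \<rat> (removed \<alpha>) 4 (Omega_alg \<alpha> \<alpha>1 \<alpha>2)"
      using \<alpha> by (intro algebraic_form_Omega rationals_subfield) auto
    moreover have "is_form_on A4 4 A4_orientation" by (rule is_form_on_A4_orientation) (rule A4_range)
    moreover have "DIM(R3) + 1 = 4" by simp
    ultimately show ?thesis
      unfolding is_period_integral_def \<open>DIM(R3) + 1 = 4\<close> using oriented_boundary_A4 Q_semialgebraic_A4 by auto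
  qed
  show ?case
  proof (intro exI [of _ period_value] conjI)
    show "\<forall>\<alpha> \<alpha>1 \<alpha>2. \<alpha> \<noteq> 0 \<longrightarrow>
        has_form_integral TYPE(R3) 0 A4_orientation A4 (Omega \<alpha> \<alpha>1 \<alpha>2) (period_value \<alpha> \<alpha>1 \<alpha>2)"
      using form by blast
    show "\<exists>r :: rat poly. \<forall>a T t. open T \<and> smooth_at_all T a \<and> (\<forall>s\<in>T. a s > 0) \<and> t \<in> T \<longrightarrow>
        a2_term a t = poly (map_poly of_rat r) (inverse (2 * of_real pi * \<i>)) *
          period_value (a t) (deriv a t) (deriv (deriv a) t)"
      by (intro exI allI impI) (rule a2)
    show "\<forall>\<alpha>\<in>\<rat>. \<forall>\<alpha>1\<in>\<rat>. \<forall>\<alpha>2\<in>\<rat>. \<alpha> \<noteq> 0 \<longrightarrow>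
        (\<exists>\<omega>. restricts_to_Omega \<omega> \<alpha> \<alpha>1 \<alpha>2 \<and>
           is_period_integral TYPE(R3) (removed \<alpha>) Sigma_div \<omega> 0 A4_orientation A4 (period_value \<alpha> \<alpha>1 \<alpha>2)) \<and>
        is_period_of_motive TYPE(R3) (removed \<alpha>) Sigma_div (period_value \<alpha> \<alpha>1 \<alpha>2)"
    proof (intro ballI impI conjI)
      fix \<alpha> \<alpha>1 \<alpha>2 :: real
      assume h: "\<alpha> \<in> \<rat>" "\<alpha>1 \<in> \<rat>" "\<alpha>2 \<in> \<rat>" "\<alpha> \<noteq> 0"
      show "\<exists>\<omega>. restricts_to_Omega \<omega> \<alpha> \<alpha>1 \<alpha>2 \<and>
          is_period_integral TYPE(R3) (removed \<alpha>) Sigma_div \<omega> 0 A4_orientation A4 (period_value \<alpha> \<alpha>1 \<alpha>2)"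
        by (intro exI [of _ "Omega_alg \<alpha> \<alpha>1 \<alpha>2"] conjI restricts_Omega_alg period h)
      show "is_period_of_motive TYPE(R3) (removed \<alpha>) Sigma_div (period_value \<alpha> \<alpha>1 \<alpha>2)"
        unfolding is_period_of_motive_def by (intro exI) (rule period [OF h])
    qed
  qed
qed

end
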